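(* (i) Let $(M,J,\nabla)$ be a simply connected conic complex manifold of complex dimension $n$. Then there exists a conic holomorphic totally complex immersion $\phi : M \to V = T^*\mathbb{C}^n$ inducing the connection $\nabla$ on $M$. Moreover, $\phi$ is unique up to a linear transformation of $V$ preserving the real structure $\tau$. Here the real structure is considered as a (constant) field of antilinear involutions on the tangent spaces of $V$. Finally, $\omega = 2\phi^*(\sum_{i=1}^n dx^i\wedge dy_i)$ is a $\nabla$-parallel symplectic structure defining on $(M,J,\nabla)$ the structure of a conic symplectic manifold. (ii) Let $(M,J,\nabla,\omega)$ be a simply connected conic symplectic manifold of complex dimension $n$. Then there exists a conic holomorphic totally complex immersion $\phi : M \to V = T^*\mathbb{C}^n$ inducing the connection $\nabla$ and the symplectic form $\omega$ on $M$. Moreover, $\phi$ is unique up to a linear transformation of $V$ preserving the complex symplectic form $\Omega$ and the real structure $\tau$. (iii) Let $(M,J,\nabla,\omega)$ be a simply connected conic Kähler manifold of complex dimension $n$. Then there exists a conic holomorphic nondegenerate Lagrangian (and hence totally complex) immersion $\phi : M \to V = T^*\mathbb{C}^n$ inducing the Kähler metric $g$, the connection $\nabla$ and the symplectic form $\omega = 2\phi^*(\sum_{i=1}^n dx^i\wedge dy_i) = g(\cdot,J\cdot)$ on $M$. Moreover, $\phi$ is unique up to a linear transformation of $V$ preserving the complex symplectic form $\Omega$ and the real structure $\tau$. Here the real structure is considered as a field of antilinear involutions on the tangent spaces of $V$.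
   Context: Metrics are allowed to be indefinite. A local holomorphic $\mathbb{C}^*$-action on a complex manifold $M$ is a holomorphic map $(\lambda,p)\mapsto\varphi_\lambda(p)\in M$ defined on an open neighbourhood $W$ of $\{1\}\times M$ in $\mathbb{C}^*\times M$ such that $\varphi_1(p)=p$ for all $p\in M$ and $\varphi_\lambda(\varphi_\mu(p))=\varphi_{\lambda\mu}(p)$ whenever both sides are defined. Equations involving $\varphi_\lambda$ are meant to hold locally, i.e. on any open set $U\subset M$ on which $\varphi_\lambda$ is defined and is a diffeomorphism onto its image. A conic complex manifold $(M,J,\nabla)$ is a complex manifold $(M,J)$ with a flat torsionfree connection $\nabla$ (on the real tangent bundle) which admits a local holomorphic $\mathbb{C}^*$-action $\varphi_\lambda$ such that locally $d\varphi_\lambda X=re^{\theta J}X=r(\cos\theta)X+r(\sin\theta)JX$ for all (local) $\nabla$-parallel vector fields $X$, where $\lambda=re^{i\theta}$, $r>0$. A conic symplectic manifold $(M,J,\nabla,\omega)$ is a conic complex manifold together with a $\nabla$-parallel symplectic form $\omega$; it is called a conic Kähler manifold if $\omega$ is $J$-invariant, and its Kähler metric is then $g=\omega(J\cdot,\cdot)$. $V=T^*\mathbb{C}^n=\mathbb{C}^{2n}$ has canonical coordinates $(z^1,\dots,z^n,w_1,\dots,w_n)$, standard complex symplectic form $\Omega=\sum_{i=1}^n dz^i\wedge dw_i$, standard real structure $\tau:V\to V$ (complex conjugation) with fixed point set $V^\tau=T^*\mathbb{R}^n$, and Hermitian form $\gamma=\sqrt{-1}\,\Omega(\cdot,\tau\cdot)$.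 Put $x^i=\mathrm{Re}\,z^i$, $y_i=\mathrm{Re}\,w_i$. A holomorphic immersion $\phi:M\to V$ of a connected complex $n$-fold $M$ is called nondegenerate if $\phi^*\gamma$ is nondegenerate; Lagrangian if $\phi^*\Omega=0$; totally complex if $V^\tau\cap d\phi(T_pM)=0$ for all $p\in M$; conic if for every $p\in M$ and every neighbourhood $U$ of $p$ there exist neighbourhoods $U_1$ of $1\in\mathbb{C}^*$ and $U_p$ of $p$ such that $\lambda\phi(U_p)\subset\phi(U)$ for all $\lambda\in U_1$. A nondegenerate $\phi$ induces the (possibly indefinite) Kähler metric $\mathrm{Re}\,\phi^*\gamma$ on $M$. If $\phi$ is totally complex, the functions $x^i\circ\phi,\ y_j\circ\phi$ give local coordinates around each point of $M$; the induced connection is the flat torsionfree connection for which these functions are affine, and the induced symplectic form is $2\phi^*(\sum_{i=1}^n dx^i\wedge dy_i)$.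
   Formalization: Uniqueness as stated fails (M=C, (z,iz) vs. (z+1,i(z+1))). Proved: φ is unique up to such a linear map plus a translation, which vanishes if both immersions are equivariant for the same local C*-action, or if no X≠0 has X and JX both parallel. *)

theory Defs
  imports "HOL-Analysis.Analysis"
begin

section \<open>Smooth and holomorphic maps between vector spaces\<close>

text \<open>Only meant for open \<open>S\<close>.\<close>

primrec Ck_on :: "nat \<Rightarrow> ('a::real_normed_vector \<Rightarrow> 'b::real_normed_vector) \<Rightarrow> 'a set \<Rightarrow> bool" where
  "Ck_on 0 f S \<longleftrightarrow> continuous_on S f"
| "Ck_on (Suc k) f S \<longleftrightarrow> (\<forall>x\<in>S. f differentiable (at x)) \<and>
     (\<forall>v. Ck_on k (\<lambda>x. frechet_derivative f (at x) v) S)"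

definition smooth_on :: "('a::real_normed_vector \<Rightarrow> 'b::real_normed_vector) \<Rightarrow> 'a set \<Rightarrow> bool" where
  "smooth_on f S \<longleftrightarrow> (\<forall>k. Ck_on k f S)"

definition holomorphic_map_on :: "(complex^'a \<Rightarrow> complex^'b) \<Rightarrow> (complex^'a) set \<Rightarrow> bool" where
  "holomorphic_map_on f S \<longleftrightarrow>
     (\<forall>x\<in>S. \<exists>D. (f has_derivative D) (at x) \<and> Vector_Spaces.linear (*s) (*s) D)"


section \<open>Complex manifolds\<close>

text \<open>The underlying space of a manifold is a type; a chart is a pair of a domain and a map.\<close>

type_synonym ('m, 'n) chart = "'m set \<times> ('m \<Rightarrow> complex^'n)"

abbreviation chart_dom :: "('m, 'n) chart \<Rightarrow> 'm set" where
  "chart_dom \<equiv> fst"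

abbreviation chart_map :: "('m, 'n) chart \<Rightarrow> 'm \<Rightarrow> complex^'n" where
  "chart_map \<equiv> snd"

definition chart_inv :: "('m, 'n) chart \<Rightarrow> complex^'n \<Rightarrow> 'm" where
  "chart_inv c = inv_into (chart_dom c) (chart_map c)"

definition complex_atlas :: "('m::topological_space, 'n::finite) chart set \<Rightarrow> bool" where
  "complex_atlas A \<longleftrightarrow>
     (\<Union>c\<in>A. chart_dom c) = UNIV \<and>
     (\<forall>c\<in>A. open (chart_dom c) \<and> open (chart_map c ` chart_dom c) \<and>
        homeomorphism (chart_dom c) (chart_map c ` chart_dom c) (chart_map c) (chart_inv c)) \<and>
     (\<forall>c\<in>A. \<forall>c'\<in>A. holomorphic_map_on (chart_map c' \<circ> chart_inv c)
        (chart_map c ` (chart_dom c \<inter> chart_dom c')))"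

text \<open>
  The tangent space at \<open>p\<close> is identified with \<open>complex^'n\<close> through a chart around \<open>p\<close> that is
  chosen once and for all. A vector field is thus a function \<open>'m \<Rightarrow> complex^'n\<close> whose value
  at \<open>p\<close> is to be read in the chart \<open>chart_at A p\<close>. As the transition maps are holomorphic,
  the complex structure of the tangent space at every point is multiplication by the
  imaginary unit, whatever the choice.
\<close>

definition chart_at :: "('m, 'n) chart set \<Rightarrow> 'm \<Rightarrow> ('m, 'n) chart" where
  "chart_at A p = (SOME c. c \<in> A \<and> p \<in> chart_dom c)"

definition cstruct :: "complex^'n \<Rightarrow> complex^'n" where
  "cstruct v = \<i> *s v"

definition mdiff :: "('m, 'n::finite) chart set \<Rightarrow> ('m \<Rightarrow> 'b::real_normed_vector) \<Rightarrow>
    'm \<Rightarrow> complex^'n \<Rightarrow> 'b" where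
  "mdiff A f p v =
     frechet_derivative (f \<circ> chart_inv (chart_at A p)) (at (chart_map (chart_at A p) p)) v"

definition smooth_fun :: "('m, 'n::finite) chart set \<Rightarrow> 'm set \<Rightarrow>
    ('m \<Rightarrow> 'b::real_normed_vector) \<Rightarrow> bool" where
  "smooth_fun A U f \<longleftrightarrow> (\<forall>c\<in>A. smooth_on (f \<circ> chart_inv c) (chart_map c ` (U \<inter> chart_dom c)))"

definition smooth_map :: "('m::topological_space, 'n::finite) chart set \<Rightarrow> 'm set \<Rightarrow>
    ('m \<Rightarrow> 'm) \<Rightarrow> bool" where
  "smooth_map A U F \<longleftrightarrow> continuous_on U F \<and>
     (\<forall>c\<in>A. \<forall>c'\<in>A. smooth_on (chart_map c' \<circ> F \<circ> chart_inv c)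
        (chart_map c ` (U \<inter> chart_dom c \<inter> F -` chart_dom c')))"

definition diffeo_onto_image :: "('m::topological_space, 'n::finite) chart set \<Rightarrow> 'm set \<Rightarrow>
    ('m \<Rightarrow> 'm) \<Rightarrow> bool" where
  "diffeo_onto_image A U F \<longleftrightarrow> inj_on F U \<and> open (F ` U) \<and>
     smooth_map A U F \<and> smooth_map A (F ` U) (inv_into U F)"

definition mdiff_map :: "('m, 'n::finite) chart set \<Rightarrow> ('m \<Rightarrow> 'm) \<Rightarrow>
    'm \<Rightarrow> complex^'n \<Rightarrow> complex^'n" where
  "mdiff_map A F p = mdiff A (chart_map (chart_at A (F p)) \<circ> F) p"

text \<open>Coordinate expression of a vector field in an arbitrary chart \<open>c\<close>.\<close>

definition field_rep :: "('m, 'n::finite) chart set \<Rightarrow> ('m, 'n) chart \<Rightarrow>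
    ('m \<Rightarrow> complex^'n) \<Rightarrow> complex^'n \<Rightarrow> complex^'n" where
  "field_rep A c X x = mdiff A (chart_map c) (chart_inv c x) (X (chart_inv c x))"

definition vector_field :: "('m, 'n::finite) chart set \<Rightarrow> 'm set \<Rightarrow>
    ('m \<Rightarrow> complex^'n) \<Rightarrow> bool" where
  "vector_field A U X \<longleftrightarrow> (\<forall>c\<in>A. smooth_on (field_rep A c X) (chart_map c ` (U \<inter> chart_dom c)))"

definition lie_bracket :: "('m, 'n::finite) chart set \<Rightarrow> ('m \<Rightarrow> complex^'n) \<Rightarrow>
    ('m \<Rightarrow> complex^'n) \<Rightarrow> 'm \<Rightarrow> complex^'n" where
  "lie_bracket A X Y p = (let c = chart_at A p; x = chart_map c p in
     frechet_derivative (field_rep A c Y) (at x) (X p) -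
     frechet_derivative (field_rep A c X) (at x) (Y p))"


section \<open>Connections\<close>

text \<open>
  \<open>nabla p v Y\<close> is the covariant derivative at \<open>p\<close>, in the direction of the tangent vector
  \<open>v\<close>, of a vector field \<open>Y\<close> that is smooth near \<open>p\<close>; its value for other \<open>Y\<close> is irrelevant.
\<close>

type_synonym ('m, 'n) conn =
  "'m \<Rightarrow> complex^'n \<Rightarrow> ('m \<Rightarrow> complex^'n) \<Rightarrow> complex^'n"

definition connection :: "('m::topological_space, 'n::finite) chart set \<Rightarrow> ('m, 'n) conn \<Rightarrow> bool" where
  "connection A nabla \<longleftrightarrow>
     (\<forall>U. open U \<longrightarrow>
        (\<forall>Y. vector_field A U Y \<longrightarrow>
           (\<forall>p\<in>U. linear (\<lambda>v. nabla p v Y)) \<and>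
           (\<forall>X. vector_field A U X \<longrightarrow> vector_field A U (\<lambda>q. nabla q (X q) Y)) \<and>
           (\<forall>Z. vector_field A U Z \<longrightarrow>
              (\<forall>p\<in>U. \<forall>v. nabla p v (\<lambda>q. Y q + Z q) = nabla p v Y + nabla p v Z)) \<and>
           (\<forall>f :: 'm \<Rightarrow> real. smooth_fun A U f \<longrightarrow>
              (\<forall>p\<in>U. \<forall>v. nabla p v (\<lambda>q. f q *\<^sub>R Y q) =
                 mdiff A f p v *\<^sub>R Y p + f p *\<^sub>R nabla p v Y)) \<and>
           (\<forall>Z. (\<forall>q\<in>U. Y q = Z q) \<longrightarrow> (\<forall>p\<in>U. \<forall>v. nabla p v Y = nabla p v Z))))"

definition torsion_free :: "('m::topological_space, 'n::finite) chart set \<Rightarrow> ('m, 'n) conn \<Rightarrow> bool" where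
  "torsion_free A nabla \<longleftrightarrow>
     (\<forall>U X Y. open U \<and> vector_field A U X \<and> vector_field A U Y \<longrightarrow>
        (\<forall>p\<in>U. nabla p (X p) Y - nabla p (Y p) X - lie_bracket A X Y p = 0))"

definition flat :: "('m::topological_space, 'n::finite) chart set \<Rightarrow> ('m, 'n) conn \<Rightarrow> bool" where
  "flat A nabla \<longleftrightarrow>
     (\<forall>U X Y Z. open U \<and> vector_field A U X \<and> vector_field A U Y \<and> vector_field A U Z \<longrightarrow>
        (\<forall>p\<in>U. nabla p (X p) (\<lambda>q. nabla q (Y q) Z) - nabla p (Y p) (\<lambda>q. nabla q (X q) Z)
           - nabla p (lie_bracket A X Y p) Z = 0))"

definition parallel_field :: "('m, 'n::finite) chart set \<Rightarrow> ('m, 'n) conn \<Rightarrow> 'm set \<Rightarrow>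
    ('m \<Rightarrow> complex^'n) \<Rightarrow> bool" where
  "parallel_field A nabla U X \<longleftrightarrow> vector_field A U X \<and> (\<forall>p\<in>U. \<forall>v. nabla p v X = 0)"

text \<open>A function \<open>f\<close> is affine if its differential is parallel.\<close>

definition affine_function :: "('m::topological_space, 'n::finite) chart set \<Rightarrow> ('m, 'n) conn \<Rightarrow>
    ('m \<Rightarrow> real) \<Rightarrow> bool" where
  "affine_function A nabla f \<longleftrightarrow> smooth_fun A UNIV f \<and>
     (\<forall>U Y. open U \<and> vector_field A U Y \<longrightarrow>
        (\<forall>p\<in>U. \<forall>v. mdiff A (\<lambda>q. mdiff A f q (Y q)) p v = mdiff A f p (nabla p v Y)))"


section \<open>Two-forms\<close>

type_synonym ('m, 'n) form2 = "'m \<Rightarrow> complex^'n \<Rightarrow> complex^'n \<Rightarrow> real"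

definition two_form :: "('m::topological_space, 'n::finite) chart set \<Rightarrow> ('m, 'n) form2 \<Rightarrow> bool" where
  "two_form A \<omega> \<longleftrightarrow>
     (\<forall>p. bilinear (\<omega> p)) \<and> (\<forall>p v. \<omega> p v v = 0) \<and>
     (\<forall>U X Y. open U \<and> vector_field A U X \<and> vector_field A U Y \<longrightarrow>
        smooth_fun A U (\<lambda>q. \<omega> q (X q) (Y q)))"

definition closed_form :: "('m::topological_space, 'n::finite) chart set \<Rightarrow> ('m, 'n) form2 \<Rightarrow> bool" where
  "closed_form A \<omega> \<longleftrightarrow>
     (\<forall>U X Y Z. open U \<and> vector_field A U X \<and> vector_field A U Y \<and> vector_field A U Z \<longrightarrow>
        (\<forall>p\<in>U.
           mdiff A (\<lambda>q. \<omega> q (Y q) (Z q)) p (X p) + mdiff A (\<lambda>q. \<omega> q (Z q) (X q)) p (Y p)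
           + mdiff A (\<lambda>q. \<omega> q (X q) (Y q)) p (Z p)
           - \<omega> p (lie_bracket A X Y p) (Z p) - \<omega> p (lie_bracket A Y Z p) (X p)
           - \<omega> p (lie_bracket A Z X p) (Y p) = 0))"

definition symplectic_form :: "('m::topological_space, 'n::finite) chart set \<Rightarrow> ('m, 'n) form2 \<Rightarrow> bool" where
  "symplectic_form A \<omega> \<longleftrightarrow> two_form A \<omega> \<and> closed_form A \<omega> \<and>
     (\<forall>p u. (\<forall>v. \<omega> p u v = 0) \<longrightarrow> u = 0)"

definition parallel_form :: "('m::topological_space, 'n::finite) chart set \<Rightarrow> ('m, 'n) conn \<Rightarrow>
    ('m, 'n) form2 \<Rightarrow> bool" where
  "parallel_form A nabla \<omega> \<longleftrightarrow>
     (\<forall>U X Y. open U \<and> vector_field A U X \<and> vector_field A U Y \<longrightarrow>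
        (\<forall>p\<in>U. \<forall>v. mdiff A (\<lambda>q. \<omega> q (X q) (Y q)) p v =
           \<omega> p (nabla p v X) (Y p) + \<omega> p (X p) (nabla p v Y)))"


section \<open>Conic manifolds\<close>

text \<open>
  Joint holomorphy of \<open>(\<lambda>, p) \<mapsto> act \<lambda> p\<close> is complex differentiability of its coordinate
  expressions on subsets of the product of the plane with a chart.
\<close>

definition local_action :: "('m::topological_space, 'n::finite) chart set \<Rightarrow>
    (complex \<times> 'm) set \<Rightarrow> (complex \<Rightarrow> 'm \<Rightarrow> 'm) \<Rightarrow> bool" where
  "local_action A W act \<longleftrightarrow>
     open W \<and> W \<subseteq> (- {0}) \<times> UNIV \<and> {1} \<times> UNIV \<subseteq> W \<and>
     continuous_on W (\<lambda>(l, p). act l p) \<and>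
     (\<forall>c\<in>A. \<forall>c'\<in>A. \<forall>l. \<forall>p\<in>chart_dom c. (l, p) \<in> W \<and> act l p \<in> chart_dom c' \<longrightarrow>
        (\<exists>D. ((\<lambda>(m, x). chart_map c' (act m (chart_inv c x))) has_derivative D)
               (at (l, chart_map c p)) \<and>
             (\<forall>a m v. D (a * m, a *s v) = a *s D (m, v)))) \<and>
     (\<forall>p. act 1 p = p) \<and>
     (\<forall>l m p. (m, p) \<in> W \<and> (l, act m p) \<in> W \<and> (l * m, p) \<in> W \<longrightarrow>
        act l (act m p) = act (l * m) p)"

text \<open>
  In \<open>d\<phi>\<^sub>\<lambda> X = r e\<^sup>\<theta>\<^sup>J X\<close> the field \<open>X\<close> occurs both on \<open>U\<close> and on the image of \<open>U\<close>. It is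
  therefore taken to be parallel on a connected open set \<open>D\<close> containing both; without
  connectedness the values of \<open>X\<close> on \<open>U\<close> and on its image could be unrelated. Note that
  \<open>r cos \<theta>\<close> and \<open>r sin \<theta>\<close> are the real and imaginary part of \<open>\<lambda>\<close>.
\<close>

definition conic_action :: "('m::topological_space, 'n::finite) chart set \<Rightarrow> ('m, 'n) conn \<Rightarrow>
    (complex \<times> 'm) set \<Rightarrow> (complex \<Rightarrow> 'm \<Rightarrow> 'm) \<Rightarrow> bool" where
  "conic_action A nabla W act \<longleftrightarrow> local_action A W act \<and>
     (\<forall>l U D X. open U \<and> {l} \<times> U \<subseteq> W \<and> diffeo_onto_image A U (act l) \<and>
        open D \<and> connected D \<and> U \<subseteq> D \<and> act l ` U \<subseteq> D \<and> parallel_field A nabla D X \<longrightarrow>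
        (\<forall>q\<in>U. mdiff_map A (act l) q (X q) =
           Re l *\<^sub>R X (act l q) + Im l *\<^sub>R cstruct (X (act l q))))"

definition conic_complex_manifold ::
    "('m::topological_space, 'n::finite) chart set \<Rightarrow> ('m, 'n) conn \<Rightarrow> bool" where
  "conic_complex_manifold A nabla \<longleftrightarrow>
     complex_atlas A \<and> connection A nabla \<and> flat A nabla \<and> torsion_free A nabla \<and>
     (\<exists>W act. conic_action A nabla W act)"

definition conic_symplectic_manifold ::
    "('m::topological_space, 'n::finite) chart set \<Rightarrow> ('m, 'n) conn \<Rightarrow> ('m, 'n) form2 \<Rightarrow> bool" where
  "conic_symplectic_manifold A nabla \<omega> \<longleftrightarrow> conic_complex_manifold A nabla \<and>
     symplectic_form A \<omega> \<and> parallel_form A nabla \<omega>"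

definition conic_kaehler_manifold ::
    "('m::topological_space, 'n::finite) chart set \<Rightarrow> ('m, 'n) conn \<Rightarrow> ('m, 'n) form2 \<Rightarrow> bool" where
  "conic_kaehler_manifold A nabla \<omega> \<longleftrightarrow> conic_symplectic_manifold A nabla \<omega> \<and>
     (\<forall>p u v. \<omega> p (cstruct u) (cstruct v) = \<omega> p u v)"

definition kaehler_metric :: "('m, 'n) form2 \<Rightarrow> 'm \<Rightarrow> complex^'n \<Rightarrow> complex^'n \<Rightarrow> real" where
  "kaehler_metric \<omega> p u v = \<omega> p (cstruct u) v"


section \<open>The vector space \<open>V = T\<^sup>*C\<^sup>n\<close> and immersions into it\<close>

text \<open>The coordinates of a vector \<open>v\<close> are \<open>z\<^sup>i = v $ Inl i\<close> and \<open>w\<^sub>i = v $ Inr i\<close>.\<close>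

type_synonym 'n cotangent = "complex^('n + 'n)"

definition Omega :: "'n::finite cotangent \<Rightarrow> 'n cotangent \<Rightarrow> complex" where
  "Omega u v = (\<Sum>i\<in>UNIV. u $ Inl i * v $ Inr i - u $ Inr i * v $ Inl i)"

definition tau :: "'n::finite cotangent \<Rightarrow> 'n cotangent" where
  "tau v = (\<chi> k. cnj (v $ k))"

definition gam :: "'n::finite cotangent \<Rightarrow> 'n cotangent \<Rightarrow> complex" where
  "gam u v = \<i> * Omega u (tau v)"

text \<open>The real two-form given by the sum of \<open>dx\<^sup>i \<and> dy\<^sub>i\<close>.\<close>

definition dx_dy :: "'n::finite cotangent \<Rightarrow> 'n cotangent \<Rightarrow> real" where
  "dx_dy u v = (\<Sum>i\<in>UNIV. Re (u $ Inl i) * Re (v $ Inr i) - Re (u $ Inr i) * Re (v $ Inl i))"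

definition holomorphic_immersion ::
    "('m, 'n::finite) chart set \<Rightarrow> ('m \<Rightarrow> 'n cotangent) \<Rightarrow> bool" where
  "holomorphic_immersion A \<phi> \<longleftrightarrow>
     (\<forall>c\<in>A. holomorphic_map_on (\<phi> \<circ> chart_inv c) (chart_map c ` chart_dom c)) \<and>
     (\<forall>p. inj (mdiff A \<phi> p))"

definition nondegenerate :: "('m, 'n::finite) chart set \<Rightarrow> ('m \<Rightarrow> 'n cotangent) \<Rightarrow> bool" where
  "nondegenerate A \<phi> \<longleftrightarrow>
     (\<forall>p u. (\<forall>v. gam (mdiff A \<phi> p u) (mdiff A \<phi> p v) = 0) \<longrightarrow> u = 0)"

definition lagrangian :: "('m, 'n::finite) chart set \<Rightarrow> ('m \<Rightarrow> 'n cotangent) \<Rightarrow> bool" where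
  "lagrangian A \<phi> \<longleftrightarrow> (\<forall>p u v. Omega (mdiff A \<phi> p u) (mdiff A \<phi> p v) = 0)"

definition totally_complex :: "('m, 'n::finite) chart set \<Rightarrow> ('m \<Rightarrow> 'n cotangent) \<Rightarrow> bool" where
  "totally_complex A \<phi> \<longleftrightarrow> (\<forall>p. {v. tau v = v} \<inter> range (mdiff A \<phi> p) = {0})"

definition conic_immersion :: "('m::topological_space \<Rightarrow> 'n::finite cotangent) \<Rightarrow> bool" where
  "conic_immersion \<phi> \<longleftrightarrow>
     (\<forall>p U. open U \<and> p \<in> U \<longrightarrow>
        (\<exists>U1 Up. open U1 \<and> 1 \<in> U1 \<and> U1 \<subseteq> - {0} \<and> open Up \<and> p \<in> Up \<and>
           (\<forall>l\<in>U1. (\<lambda>q. l *s \<phi> q) ` Up \<subseteq> \<phi> ` U)))"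

text \<open>
  For a totally complex immersion, the affineness of the functions below determines a flat
  torsionfree connection, because these functions are local coordinates around each point.
\<close>

definition induces_connection :: "('m::topological_space, 'n::finite) chart set \<Rightarrow> ('m, 'n) conn \<Rightarrow>
    ('m \<Rightarrow> 'n cotangent) \<Rightarrow> bool" where
  "induces_connection A nabla \<phi> \<longleftrightarrow>
     (\<forall>i. affine_function A nabla (\<lambda>p. Re (\<phi> p $ Inl i)) \<and>
          affine_function A nabla (\<lambda>p. Re (\<phi> p $ Inr i)))"

definition induced_form :: "('m, 'n::finite) chart set \<Rightarrow> ('m \<Rightarrow> 'n cotangent) \<Rightarrow> ('m, 'n) form2" where
  "induced_form A \<phi> p u v = 2 * dx_dy (mdiff A \<phi> p u) (mdiff A \<phi> p v)"

definition induced_metric :: "('m, 'n::finite) chart set \<Rightarrow> ('m \<Rightarrow> 'n cotangent) \<Rightarrow>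
    'm \<Rightarrow> complex^'n \<Rightarrow> complex^'n \<Rightarrow> real" where
  "induced_metric A \<phi> p u v = Re (gam (mdiff A \<phi> p u) (mdiff A \<phi> p v))"


section \<open>Uniqueness up to linear transformations\<close>

definition preserves_tau :: "('n::finite cotangent \<Rightarrow> 'n cotangent) \<Rightarrow> bool" where
  "preserves_tau T \<longleftrightarrow> Vector_Spaces.linear (*s) (*s) T \<and> bij T \<and> (\<forall>v. T (tau v) = tau (T v))"

definition preserves_Omega_tau :: "('n::finite cotangent \<Rightarrow> 'n cotangent) \<Rightarrow> bool" where
  "preserves_Omega_tau T \<longleftrightarrow> preserves_tau T \<and> (\<forall>u v. Omega (T u) (T v) = Omega u v)"

text \<open>
  The immersion turns the local action into scalar multiplication, for scalars close to 1.
\<close>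

definition equivariant :: "(complex \<times> 'm::topological_space) set \<Rightarrow> (complex \<Rightarrow> 'm \<Rightarrow> 'm) \<Rightarrow>
    ('m \<Rightarrow> 'n::finite cotangent) \<Rightarrow> bool" where
  "equivariant W act \<phi> \<longleftrightarrow>
     (\<forall>p. \<exists>N. open N \<and> (1, p) \<in> N \<and> N \<subseteq> W \<and> (\<forall>(l, q)\<in>N. \<phi> (act l q) = l *s \<phi> q))"

text \<open>
  Linear transformations alone do not relate all conic immersions inducing the same
  connection. For the flat manifold of complex numbers, both \<open>z \<mapsto> (z, \<i> z)\<close> and its
  translate \<open>z \<mapsto> (z + 1, \<i> (z + 1))\<close> are conic; they belong to the actions by scalar
  multiplication about \<open>0\<close> and about \<open>-1\<close>. In general a translation remains. It vanishes if
  the two immersions are adapted to the same local action, and also if there is no vector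
  field \<open>X \<noteq> 0\<close> such that \<open>X\<close> and \<open>J X\<close> are both parallel.
\<close>

definition unique_up_to :: "(('n::finite cotangent \<Rightarrow> 'n cotangent) \<Rightarrow> bool) \<Rightarrow>
    ('m::topological_space, 'n) chart set \<Rightarrow> ('m, 'n) conn \<Rightarrow>
    (('m \<Rightarrow> 'n cotangent) \<Rightarrow> bool) \<Rightarrow> bool" where
  "unique_up_to G A nabla P \<longleftrightarrow>
     (\<forall>\<phi> \<psi>. P \<phi> \<and> P \<psi> \<longrightarrow>
        (\<exists>T b. G T \<and> (\<forall>p. \<psi> p = T (\<phi> p) + b) \<and>
           ((\<exists>W act. conic_action A nabla W act \<and> equivariant W act \<phi> \<and> equivariant W act \<psi>) \<or>
            \<not> (\<exists>X. parallel_field A nabla UNIV X \<and>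
                   parallel_field A nabla UNIV (\<lambda>p. cstruct (X p)) \<and> (\<exists>p. X p \<noteq> 0))
            \<longrightarrow> b = 0)))"

text \<open>
  Existence, in the form matching the above notion of uniqueness: every local action making
  the manifold conic is realised by scalar multiplication on \<open>V\<close>.
\<close>

definition exists_for_each_action :: "('m::topological_space, 'n::finite) chart set \<Rightarrow>
    ('m, 'n) conn \<Rightarrow> (('m \<Rightarrow> 'n cotangent) \<Rightarrow> bool) \<Rightarrow> bool" where
  "exists_for_each_action A nabla P \<longleftrightarrow>
     (\<forall>W act. conic_action A nabla W act \<longrightarrow> (\<exists>\<phi>. P \<phi> \<and> equivariant W act \<phi>))"

end

theory Submission
  imports Defs "HOL-Complex_Analysis.Cauchy_Integral_Formula"
begin

text \<open>
  Flatness gives local parallel frames, which are patched together to a global frame \<open>Q\<close> by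
  simple connectedness; let \<open>\<theta>\<close> be the inverse coframe. Differentiating
  \<open>d\<phi>\<^sub>\<lambda> X = \<lambda> X\<close> at \<open>\<lambda> = 1\<close> for parallel \<open>X\<close> shows that the Euler field \<open>\<xi>\<close> of the
  action satisfies \<open>\<nabla>\<xi> = id\<close> and \<open>\<nabla>(J\<xi>) = J\<close>. Hence for every parallel one-form \<open>\<alpha>\<close>,
  that is, every real linear function of \<open>\<theta>\<close>, the function \<open>\<alpha>(\<xi>) - \<i> \<alpha>(J\<xi>)\<close> has
  differential \<open>\<alpha> - \<i> \<alpha> \<circ> J\<close>. It is therefore holomorphic with affine real part, and it is
  homogeneous of degree one under the action. A basis of parallel one-forms, chosen symplectic for
  \<open>\<omega>\<close> in the symplectic case, gives the immersion. Conversely, the differential of any such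
  immersion is of the form \<open>\<alpha> - \<i> \<alpha> \<circ> J\<close> for a basis \<open>\<alpha>\<close> of parallel one-forms, so two of
  them differ by a complexified real linear map and a translation \<open>b\<close>. Conicity means
  \<open>\<phi>(p) \<in> d\<phi>(T\<^sub>pM)\<close>; if \<open>b \<noteq> 0\<close>, this produces a nonzero \<open>X\<close> with \<open>X\<close> and \<open>JX\<close> parallel.
\<close>

section \<open>Calculus of \<open>C\<^sup>k\<close> maps\<close>

text \<open>\<open>nabla\<close> lives on the real tangent bundle and need not commute with
  \<open>cstruct\<close>: for parallel X the field J X is in general not parallel. So there are 2n
  real affine functions rather than n complex ones, and each is completed to a holomorphic function
  on its own; this is why the target has complex dimension 2n. Total complexity of an immersion says
  that the real parts of the differentials already separate tangent vectors.

  Differentiating the conic identity in the scalar gives a mixed second derivative of the action.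
  Taken in the other order it is the derivative of the Euler field, up to Christoffel terms that
  cancel because the torsion vanishes. Transition maps and the action are only assumed complex
  differentiable, so both smoothness and the symmetry of second derivatives are drawn from Cauchy's
  integral formula.

  A parallel frame near a point solves an overdetermined system. It is solved as an ordinary
  differential equation along rays, and flatness takes care of the remaining directions. The coframe
  is only a pointwise inverse; its differentiability comes from the inverse function
  theorem.\<close>

lemma Ck_on_cong:
  assumes "open S" "\<And>x. x \<in> S \<Longrightarrow> f x = g x" "Ck_on k f S"
  shows "Ck_on k g S"
  using assms(2,3)
proof (induction k arbitrary: f g)
  case 0
  then show ?case using continuous_on_cong by force
next
  case (Suc k)
  have d: "(g has_derivative frechet_derivative f (at x)) (at x)" if "x \<in> S" for x
    using Suc.prems that assms(1)
    by (auto intro!: has_derivative_transform_within_open[of f _ x UNIV S g] simp: frechet_derivative_works)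
  then have "frechet_derivative g (at x) = frechet_derivative f (at x)" if "x \<in> S" for x
    using that frechet_derivative_at by metis
  moreover have "Ck_on k (\<lambda>x. frechet_derivative g (at x) v) S" for v
    using Suc.IH[of "\<lambda>x. frechet_derivative f (at x) v" "\<lambda>x. frechet_derivative g (at x) v"]
      Suc.prems calculation by simp
  ultimately show ?case using d by (auto simp: differentiable_def)
qed

text \<open>The workhorse of this section: on an open set the derivative may be given explicitly,
  and the class of its values is then checked instead of that of
  \<open>frechet_derivative\<close>.\<close>

lemma Ck_on_Suc_intro:
  assumes "open S" "\<And>x. x \<in> S \<Longrightarrow> (f has_derivative f' x) (at x)"
    and "\<And>v. Ck_on k (\<lambda>x. f' x v) S"
  shows "Ck_on (Suc k) f S"
proof -
  have "f' x = frechet_derivative f (at x)" if "x \<in> S" for x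
    using assms(2)[OF that] by (rule frechet_derivative_at)
  then have "Ck_on k (\<lambda>x. frechet_derivative f (at x) v) S" for v
    using Ck_on_cong[OF assms(1) _ assms(3)[of v]] by auto
  then show ?thesis using assms(2) by (auto simp: differentiable_def)
qed

lemma Ck_on_has_derivative:
  "Ck_on (Suc k) f S \<Longrightarrow> x \<in> S \<Longrightarrow> (f has_derivative frechet_derivative f (at x)) (at x)"
  by (simp add: frechet_derivative_works)

lemma Ck_on_frechet_derivative:
  "Ck_on (Suc k) f S \<Longrightarrow> Ck_on k (\<lambda>x. frechet_derivative f (at x) v) S"
  by simp

lemma Ck_on_SucD:
  assumes "Ck_on (Suc k) f S"
  shows "Ck_on k f S"
  using assms
proof (induction k arbitrary: f)
  case 0
  then show ?case
    by (auto intro!: continuous_at_imp_continuous_on differentiable_imp_continuous_within)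
next
  case (Suc k)
  then show ?case by auto
qed

lemma Ck_on_subset:
  assumes "Ck_on k f S" "T \<subseteq> S"
  shows "Ck_on k f T"
  using assms by (induction k arbitrary: f) (auto intro: continuous_on_subset)

lemma Ck_on_local:
  assumes "\<And>x. x \<in> S \<Longrightarrow> \<exists>N. open N \<and> x \<in> N \<and> Ck_on k f N"
  shows "Ck_on k f S"
  using assms
proof (induction k arbitrary: f)
  case 0
  then show ?case
    by (auto intro!: continuous_at_imp_continuous_on) (meson continuous_on_eq_continuous_at)
next
  case (Suc k)
  show ?case
  proof (simp only: Ck_on.simps, intro conjI allI ballI)
    show "f differentiable at x" if "x \<in> S" for x
      using Suc.prems[OF that] by auto
    show "Ck_on k (\<lambda>x. frechet_derivative f (at x) v) S" for v
    proof (rule Suc.IH)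
      show "\<exists>N. open N \<and> x \<in> N \<and> Ck_on k (\<lambda>x. frechet_derivative f (at x) v) N" if "x \<in> S" for x
        using Suc.prems[OF that] by auto
    qed
  qed
qed

lemma Ck_on_const [simp]: "Ck_on k (\<lambda>x. c) S"
  by (induction k arbitrary: c) (auto simp: frechet_derivative_const)

lemma Ck_on_bounded_linear:
  assumes "open S" "bounded_linear h" "Ck_on k f S"
  shows "Ck_on k (\<lambda>x. h (f x)) S"
  using assms(3)
proof (induction k arbitrary: f)
  case 0
  then show ?case using assms(2) by (simp add: bounded_linear.continuous_on)
next
  case (Suc k)
  show ?case
  proof (rule Ck_on_Suc_intro[OF assms(1)])
    show "((\<lambda>x. h (f x)) has_derivative (\<lambda>v. h (frechet_derivative f (at x) v))) (at x)" if "x \<in> S" for x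
      using bounded_linear.has_derivative[OF assms(2) Ck_on_has_derivative] Suc.prems that by blast
    show "Ck_on k (\<lambda>x. h (frechet_derivative f (at x) v)) S" for v
      using Suc by auto
  qed
qed

lemma Ck_on_add:
  assumes "open S" "Ck_on k f S" "Ck_on k g S"
  shows "Ck_on k (\<lambda>x. f x + g x) S"
  using assms(2,3)
proof (induction k arbitrary: f g)
  case 0
  then show ?case by (auto intro: continuous_on_add)
next
  case (Suc k)
  show ?case
    by (rule Ck_on_Suc_intro[OF assms(1), where
          f' = "\<lambda>x v. frechet_derivative f (at x) v + frechet_derivative g (at x) v"])
       (use Suc in \<open>auto simp del: Ck_on.simps intro!: has_derivative_add Ck_on_has_derivative
          dest: Ck_on_frechet_derivative\<close>)
qed

lemma Ck_on_sum:
  assumes "open S" "finite I" "\<And>i. i \<in> I \<Longrightarrow> Ck_on k (f i) S"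
  shows "Ck_on k (\<lambda>x. \<Sum>i\<in>I. f i x) S"
  using assms(2,3) by (induction I rule: finite_induct) (auto intro: Ck_on_add assms(1))

lemma Ck_on_bilinear:
  assumes "open S" "bounded_bilinear h" "Ck_on k f S" "Ck_on k g S"
  shows "Ck_on k (\<lambda>x. h (f x) (g x)) S"
  using assms(3,4)
proof (induction k arbitrary: f g)
  case 0
  then show ?case using assms(2) by (auto intro: bounded_bilinear.continuous_on)
next
  case (Suc k)
  \<comment> \<open>The product rule pairs a derivative with an undifferentiated factor, so the
    factors are needed in class \<open>k\<close> as well.\<close>
  have "Ck_on k f S" "Ck_on k g S"
    using Suc.prems Ck_on_SucD by blast+
  then show ?case
    by (intro Ck_on_Suc_intro[OF assms(1), where
          f' = "\<lambda>x v. h (f x) (frechet_derivative g (at x) v) + h (frechet_derivative f (at x) v) (g x)"])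
       (use Suc in \<open>auto simp del: Ck_on.simps intro!: Ck_on_add assms(1)
          bounded_bilinear.FDERIV[OF assms(2)] Ck_on_has_derivative dest: Ck_on_frechet_derivative\<close>)
qed

lemmas Ck_on_scaleR = Ck_on_bilinear[OF _ bounded_bilinear_scaleR]

lemma linear_sum_Basis:
  fixes h :: "'a::euclidean_space \<Rightarrow> 'b::real_vector"
  assumes "linear h"
  shows "h v = (\<Sum>b\<in>Basis. (v \<bullet> b) *\<^sub>R h b)"
proof -
  have "h v = h (\<Sum>b\<in>Basis. (v \<bullet> b) *\<^sub>R b)" by (simp add: euclidean_representation)
  also have "\<dots> = (\<Sum>b\<in>Basis. (v \<bullet> b) *\<^sub>R h b)"
    by (simp add: linear_sum[OF assms] linear_scale[OF assms])
  finally show ?thesis .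
qed

text \<open>Regularity of \<open>L\<close> is known only for a fixed argument \<open>w\<close>.
  Expanding the moving argument in a basis leaves finitely many products of a scalar function with
  such terms.\<close>

lemma Ck_on_apply_linear:
  fixes g :: "'a::real_normed_vector \<Rightarrow> 'b::euclidean_space"
    and L :: "'a \<Rightarrow> 'b \<Rightarrow> 'c::real_normed_vector"
  assumes "open S" "\<And>x. x \<in> S \<Longrightarrow> linear (L x)" "\<And>w. Ck_on k (\<lambda>x. L x w) S" "Ck_on k g S"
  shows "Ck_on k (\<lambda>x. L x (g x)) S"
proof (rule Ck_on_cong[OF assms(1)])
  show "(\<Sum>b\<in>Basis. (g x \<bullet> b) *\<^sub>R L x b) = L x (g x)" if "x \<in> S" for x
    using linear_sum_Basis[OF assms(2)[OF that]] by metis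
  show "Ck_on k (\<lambda>x. \<Sum>b\<in>Basis. (g x \<bullet> b) *\<^sub>R L x b) S"
    by (intro Ck_on_sum Ck_on_scaleR assms Ck_on_bounded_linear[OF _ bounded_linear_inner_left] finite_Basis)
qed

text \<open>By the chain rule the derivative is that of \<open>f\<close> at \<open>g x\<close>,
  applied to that of \<open>g\<close>. The induction hypothesis handles the first factor on fixed
  vectors, and \<open>Ck_on_apply_linear\<close> supplies the moving argument.\<close>

lemma Ck_on_compose:
  fixes g :: "'a::real_normed_vector \<Rightarrow> 'b::euclidean_space"
    and f :: "'b \<Rightarrow> 'c::real_normed_vector"
  assumes "open S" "open T" "\<And>x. x \<in> S \<Longrightarrow> g x \<in> T" "Ck_on k f T" "Ck_on k g S"
  shows "Ck_on k (\<lambda>x. f (g x)) S"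
  using assms(4,5)
proof (induction k arbitrary: f)
  case 0
  then show ?case using assms(3) by (auto intro: continuous_on_compose2)
next
  case (Suc k)
  show ?case
  proof (rule Ck_on_Suc_intro[OF assms(1)])
    show "((\<lambda>x. f (g x)) has_derivative
        (\<lambda>v. frechet_derivative f (at (g x)) (frechet_derivative g (at x) v))) (at x)" if "x \<in> S" for x
      by (rule has_derivative_compose[OF Ck_on_has_derivative[OF Suc.prems(2) that]
            Ck_on_has_derivative[OF Suc.prems(1) assms(3)[OF that]]])
    show "Ck_on k (\<lambda>x. frechet_derivative f (at (g x)) (frechet_derivative g (at x) v)) S" for v
    proof (rule Ck_on_apply_linear[OF assms(1)])
      show "linear (frechet_derivative f (at (g x)))" if "x \<in> S" for x
        using linear_frechet_derivative Suc.prems(1) assms(3)[OF that] by auto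
      show "Ck_on k (\<lambda>x. frechet_derivative f (at (g x)) w) S" for w
        using Suc.IH[OF Ck_on_frechet_derivative[OF Suc.prems(1)] Ck_on_SucD[OF Suc.prems(2)]] .
      show "Ck_on k (\<lambda>x. frechet_derivative g (at x) v) S"
        using Suc.prems(2) by simp
    qed
  qed
qed

lemma smooth_onI: "(\<And>k. Ck_on k f S) \<Longrightarrow> smooth_on f S"
  by (simp add: smooth_on_def)

lemma smooth_onD: "smooth_on f S \<Longrightarrow> Ck_on k f S"
  by (simp add: smooth_on_def)

lemma smooth_on_cong:
  assumes "open S" "\<And>x. x \<in> S \<Longrightarrow> f x = g x" "smooth_on f S"
  shows "smooth_on g S"
  using assms(3) Ck_on_cong[OF assms(1,2)] by (auto simp: smooth_on_def)

lemma smooth_on_subset: "smooth_on f S \<Longrightarrow> T \<subseteq> S \<Longrightarrow> smooth_on f T"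
  using Ck_on_subset[of _ f S T] by (auto simp: smooth_on_def)

lemma smooth_on_const [simp]: "smooth_on (\<lambda>x. c) S"
  by (simp add: smooth_on_def)

lemma smooth_on_local:
  assumes "\<And>x. x \<in> S \<Longrightarrow> \<exists>N. open N \<and> x \<in> N \<and> smooth_on f N"
  shows "smooth_on f S"
proof (rule smooth_onI, rule Ck_on_local)
  show "\<exists>N. open N \<and> x \<in> N \<and> Ck_on k f N" if "x \<in> S" for x k
    using assms[OF that] by (auto dest: smooth_onD)
qed

lemma smooth_on_differentiable: "smooth_on f S \<Longrightarrow> x \<in> S \<Longrightarrow> f differentiable (at x)"
  using smooth_onD[of f S "Suc 0"] by simp

lemma smooth_on_has_derivative:
  "smooth_on f S \<Longrightarrow> x \<in> S \<Longrightarrow> (f has_derivative frechet_derivative f (at x)) (at x)"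
  using smooth_on_differentiable frechet_derivative_works by blast

lemma smooth_on_frechet_derivative: "smooth_on f S \<Longrightarrow> smooth_on (\<lambda>x. frechet_derivative f (at x) v) S"
  using smooth_onD[of f S "Suc _"] by (auto intro!: smooth_onI)

lemma smooth_on_continuous: "smooth_on f S \<Longrightarrow> continuous_on S f"
  using smooth_onD[of f S 0] by simp

lemma smooth_on_apply_linear:
  fixes g :: "'a::real_normed_vector \<Rightarrow> 'b::euclidean_space"
    and L :: "'a \<Rightarrow> 'b \<Rightarrow> 'c::real_normed_vector"
  assumes "open S" "\<And>x. x \<in> S \<Longrightarrow> linear (L x)" "\<And>w. smooth_on (\<lambda>x. L x w) S" "smooth_on g S"
  shows "smooth_on (\<lambda>x. L x (g x)) S"
  by (rule smooth_onI, rule Ck_on_apply_linear) (use assms in \<open>auto dest: smooth_onD\<close>)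

lemma smooth_on_compose:
  fixes g :: "'a::real_normed_vector \<Rightarrow> 'b::euclidean_space"
    and f :: "'b \<Rightarrow> 'c::real_normed_vector"
  assumes "open S" "open T" "\<And>x. x \<in> S \<Longrightarrow> g x \<in> T" "smooth_on f T" "smooth_on g S"
  shows "smooth_on (\<lambda>x. f (g x)) S"
  by (rule smooth_onI, rule Ck_on_compose[OF assms(1-3)]) (use assms in \<open>auto dest: smooth_onD\<close>)

lemma smooth_on_bounded_linear:
  "open S \<Longrightarrow> bounded_linear h \<Longrightarrow> smooth_on f S \<Longrightarrow> smooth_on (\<lambda>x. h (f x)) S"
  by (rule smooth_onI, rule Ck_on_bounded_linear) (simp_all add: smooth_onD)

lemma smooth_on_scaleR:
  "open S \<Longrightarrow> smooth_on f S \<Longrightarrow> smooth_on g S \<Longrightarrow> smooth_on (\<lambda>x. f x *\<^sub>R g x) S"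
  by (rule smooth_onI, rule Ck_on_scaleR) (simp_all add: smooth_onD)

lemma smooth_on_add:
  "open S \<Longrightarrow> smooth_on f S \<Longrightarrow> smooth_on g S \<Longrightarrow> smooth_on (\<lambda>x. f x + g x) S"
  by (rule smooth_onI, rule Ck_on_add) (simp_all add: smooth_onD)

lemma smooth_on_sum:
  assumes "open S" "finite I" "\<And>i. i \<in> I \<Longrightarrow> smooth_on (f i) S"
  shows "smooth_on (\<lambda>x. \<Sum>i\<in>I. f i x) S"
  by (rule smooth_onI, rule Ck_on_sum) (use assms in \<open>simp_all add: smooth_onD\<close>)

lemma smooth_on_componentwise:
  fixes f :: "'a::real_normed_vector \<Rightarrow> 'b::euclidean_space"
  assumes "open S" "\<And>b. b \<in> Basis \<Longrightarrow> smooth_on (\<lambda>x. f x \<bullet> b) S"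
  shows "smooth_on f S"
proof (rule smooth_on_cong[OF assms(1)])
  show "(\<Sum>b\<in>Basis. (f x \<bullet> b) *\<^sub>R b) = f x" for x by (simp add: euclidean_representation)
  show "smooth_on (\<lambda>x. \<Sum>b\<in>Basis. (f x \<bullet> b) *\<^sub>R b) S"
    by (intro smooth_on_sum smooth_on_scaleR assms finite_Basis) auto
qed

section \<open>Holomorphic maps of several variables are smooth\<close>

text \<open>The Leibniz rule asks for continuity of the derivative as an operator-valued map. In
  finite dimension it suffices to check it on each fixed vector \<open>v\<close>; the
  operator-valued integral is evaluated at \<open>v\<close> again at the end.\<close>

lemma has_derivative_integral_param:
  fixes f :: "'a::euclidean_space \<Rightarrow> real \<Rightarrow> 'b::banach"
  assumes U: "open U" "convex U" "x0 \<in> U"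
    and fx: "\<And>x t. x \<in> U \<Longrightarrow> t \<in> {a..b} \<Longrightarrow> ((\<lambda>x. f x t) has_derivative Df x t) (at x)"
    and cf: "\<And>x. x \<in> U \<Longrightarrow> continuous_on {a..b} (f x)"
    and cd: "\<And>v. continuous_on (U \<times> {a..b}) (\<lambda>(x, t). Df x t v)"
  shows "((\<lambda>x. integral {a..b} (f x)) has_derivative (\<lambda>v. integral {a..b} (\<lambda>t. Df x0 t v))) (at x0)"
proof -
  have bl: "bounded_linear (Df x t)" if "x \<in> U" "t \<in> {a..b}" for x t
    using fx[OF that] has_derivative_bounded_linear by blast
  have ap: "blinfun_apply (Blinfun (Df x t)) = Df x t" if "x \<in> U" "t \<in> {a..b}" for x t
    using bl[OF that] by (rule bounded_linear_Blinfun_apply)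
  have cont: "continuous_on (U \<times> {a..b}) (\<lambda>(x, t). Blinfun (Df x t))"
  proof (rule continuous_on_blinfun_componentwise)
    fix v :: 'a
    show "continuous_on (U \<times> {a..b}) (\<lambda>p. blinfun_apply (case p of (x, t) \<Rightarrow> Blinfun (Df x t)) v)"
      by (rule continuous_on_eq[OF cd[of v]]) (auto simp: ap)
  qed
  have *: "((\<lambda>x. integral (cbox a b) (f x)) has_derivative
      blinfun_apply (integral (cbox a b) (\<lambda>t. Blinfun (Df x0 t)))) (at x0 within U)"
  proof (rule leibniz_rule)
    show "((\<lambda>x. f x t) has_derivative blinfun_apply (Blinfun (Df x t))) (at x within U)"
      if "x \<in> U" "t \<in> cbox a b" for x t
      using fx[of x t] that ap[of x t] has_derivative_at_withinI by auto
    show "f x integrable_on cbox a b" if "x \<in> U" for x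
      using cf[OF that] integrable_continuous[of a b "f x"] by simp
  qed (use U cont in auto)
  have int: "(\<lambda>t. Blinfun (Df x0 t)) integrable_on {a..b}"
  proof -
    have "continuous_on {a..b} (\<lambda>t. case (x0, t) of (x, t) \<Rightarrow> Blinfun (Df x t))"
      by (rule continuous_on_compose2[OF cont]) (use U in \<open>auto intro: continuous_intros\<close>)
    then show ?thesis by (simp add: integrable_continuous_interval)
  qed
  have "blinfun_apply (integral {a..b} (\<lambda>t. Blinfun (Df x0 t))) v = integral {a..b} (\<lambda>t. Df x0 t v)" for v
  proof -
    have "((\<lambda>t. blinfun_apply (Blinfun (Df x0 t)) v) has_integral
        blinfun_apply (integral {a..b} (\<lambda>t. Blinfun (Df x0 t))) v) {a..b}"
      using has_integral_linear[OF integrable_integral[OF int] blinfun.bounded_linear_left[of v]]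
      by (simp add: o_def)
    then have "((\<lambda>t. Df x0 t v) has_integral
        blinfun_apply (integral {a..b} (\<lambda>t. Blinfun (Df x0 t))) v) {a..b}"
      by (rule has_integral_eq[rotated]) (use ap U in auto)
    then show ?thesis by (simp add: integral_unique)
  qed
  then have "blinfun_apply (integral {a..b} (\<lambda>t. Blinfun (Df x0 t))) = (\<lambda>v. integral {a..b} (\<lambda>t. Df x0 t v))"
    by (rule ext)
  then show ?thesis using * by (simp only: at_within_open[OF U(3,1)] cbox_interval)
qed

text \<open>Complex multiplication is kept abstract so that one Cauchy argument serves both
  \<open>complex^'n\<close> and \<open>complex \<times> complex^'n\<close>. The latter carries the
  joint dependence of an action on scalar and point.\<close>

locale complex_structure =
  fixes I :: "'a::euclidean_space \<Rightarrow> 'a"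
  assumes linear_I: "linear I"
    and I_I: "I (I v) = - v"
begin

definition cscale :: "complex \<Rightarrow> 'a \<Rightarrow> 'a" where
  "cscale z v = Re z *\<^sub>R v + Im z *\<^sub>R I v"

definition chol :: "('a \<Rightarrow> complex) \<Rightarrow> 'a set \<Rightarrow> bool" where
  "chol f S \<longleftrightarrow> (\<forall>x\<in>S. \<exists>D. (f has_derivative D) (at x) \<and> (\<forall>v. D (I v) = \<i> * D v))"

lemma cholD:
  assumes "chol f S" "x \<in> S"
  shows "(f has_derivative frechet_derivative f (at x)) (at x)"
    and "frechet_derivative f (at x) (I v) = \<i> * frechet_derivative f (at x) v"
proof -
  obtain D where D: "(f has_derivative D) (at x)" "\<And>v. D (I v) = \<i> * D v"
    using assms unfolding chol_def by blast
  then have "D = frechet_derivative f (at x)" using frechet_derivative_at by blast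
  with D show "(f has_derivative frechet_derivative f (at x)) (at x)"
    and "frechet_derivative f (at x) (I v) = \<i> * frechet_derivative f (at x) v" by simp_all
qed

lemma chol_continuous_on: "chol f S \<Longrightarrow> continuous_on S f"
  using cholD(1) has_derivative_continuous continuous_at_imp_continuous_on by metis

lemma bounded_linear_cscale: "bounded_linear (\<lambda>z. cscale z v)"
  unfolding cscale_def
  by (intro bounded_linear_add bounded_linear_scaleR_const bounded_linear_Re bounded_linear_Im)

lemma continuous_cscale [continuous_intros]: "continuous_on T f \<Longrightarrow> continuous_on T (\<lambda>t. cscale (f t) v)"
  using bounded_linear.continuous_on[OF bounded_linear_cscale] .

lemma linear_cscale:
  assumes "linear D" "\<And>v. D (I v) = \<i> * D v"
  shows "D (cscale z v) = z * D v"
  using complex_eq[of z]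
  by (simp add: cscale_def linear_add[OF assms(1)] linear_scale[OF assms(1)] assms(2)
      scaleR_conv_of_real algebra_simps) (metis distrib_right mult.assoc mult.commute)

text \<open>On the complex line through \<open>x\<close> in direction \<open>v\<close> the function
  is holomorphic in one variable, and its derivative at 0 is the directional derivative. Cauchy's
  formula expresses it through values of \<open>f\<close> alone, which is the source of all higher
  regularity.\<close>

lemma frechet_derivative_Cauchy:
  assumes f: "chol f S" and r: "r > 0" and S: "\<And>z. cmod z \<le> r \<Longrightarrow> x + cscale z v \<in> S"
  shows "frechet_derivative f (at x) v = integral {0..1} (\<lambda>t.
      f (x + cscale (of_real r * exp (2 * of_real pi * \<i> * of_real t)) v) *
      (exp (- (2 * of_real pi * \<i> * of_real t)) / of_real r))"
proof -
  define g where "g z = f (x + cscale z v)" for z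
  have der: "(g has_field_derivative frechet_derivative f (at (x + cscale z v)) v) (at z)"
    if "cmod z \<le> r" for z
  proof -
    let ?D = "frechet_derivative f (at (x + cscale z v))"
    have "((\<lambda>z. x + cscale z v) has_derivative (\<lambda>z. cscale z v)) (at z)"
      using has_derivative_add[OF has_derivative_const bounded_linear_imp_has_derivative[OF bounded_linear_cscale]]
      by simp
    then have "(g has_derivative (\<lambda>h. ?D (cscale h v))) (at z)"
      unfolding g_def by (rule has_derivative_compose) (rule cholD(1)[OF f S[OF that]])
    moreover have "?D (cscale h v) = ?D v * h" for h
      using linear_cscale[of ?D h v] cholD[OF f S[OF that]] has_derivative_linear by (auto simp: mult.commute)
    ultimately show ?thesis unfolding has_field_derivative_def by simp
  qed
  have hol: "g holomorphic_on ball 0 r"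
    unfolding holomorphic_on_def
  proof
    fix z :: complex assume "z \<in> ball 0 r"
    then have "cmod z \<le> r" by simp
    from der[OF this] show "g field_differentiable at z within ball 0 r"
      unfolding field_differentiable_def using has_field_derivative_at_within by blast
  qed
  have cont: "continuous_on (cball 0 r) g"
    by (intro continuous_at_imp_continuous_on ballI DERIV_isCont[OF der]) simp
  have "(g has_field_derivative (1 / (2 * of_real pi * \<i>) *
      contour_integral (circlepath 0 r) (\<lambda>u. g u / (u - 0)\<^sup>2))) (at 0)"
    using Cauchy_derivative_integral_circlepath(2)[OF cont hol, of 0] r by simp
  moreover have "(g has_field_derivative frechet_derivative f (at x) v) (at 0)"
    using der[of 0] r by (simp add: cscale_def)
  ultimately have "frechet_derivative f (at x) v = 1 / (2 * of_real pi * \<i>) *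
      contour_integral (circlepath 0 r) (\<lambda>u. g u / u\<^sup>2)"
    using DERIV_unique by fastforce
  also have "contour_integral (circlepath 0 r) (\<lambda>u. g u / u\<^sup>2) =
      integral {0..1} (\<lambda>t. g (circlepath 0 r t) / (circlepath 0 r t)\<^sup>2 *
        vector_derivative (circlepath 0 r) (at t))"
    by (rule contour_integral_integral)
  \<comment> \<open>On the circle \<open>u = r exp (2 pi i t)\<close>, the velocity divided by the
    square of \<open>u\<close> is \<open>2 pi i\<close> times
    \<open>exp (- 2 pi i t) / r\<close>.\<close>
  also have "\<dots> = integral {0..1} (\<lambda>t. (2 * of_real pi * \<i>) *
      (g (of_real r * exp (2 * of_real pi * \<i> * of_real t)) *
      (exp (- (2 * of_real pi * \<i> * of_real t)) / of_real r)))"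
    unfolding vector_derivative_circlepath using r
    by (intro integral_cong) (simp add: circlepath exp_minus field_simps power2_eq_square)
  also have "\<dots> = (2 * of_real pi * \<i>) * integral {0..1} (\<lambda>t.
      (g (of_real r * exp (2 * of_real pi * \<i> * of_real t)) *
      (exp (- (2 * of_real pi * \<i> * of_real t)) / of_real r)))"
    by (rule integral_mult_right)
  finally show ?thesis by (simp add: g_def)
qed

text \<open>A single radius works for all centres \<open>y\<close> near \<open>x\<close>, because
  the Cauchy integral will be differentiated in its centre while the circle stays fixed.\<close>

lemma cscale_small:
  assumes "open S" "x \<in> S"
  obtains r e where "r > 0" "e > 0" "\<And>y z. dist y x < e \<Longrightarrow> cmod z \<le> r \<Longrightarrow> y + cscale z v \<in> S"
proof -
  obtain d where d: "d > 0" "ball x d \<subseteq> S" using assms open_contains_ball by blast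
  obtain K where K: "K > 0" "\<And>z. norm (cscale z v) \<le> norm z * K"
    using bounded_linear.pos_bounded[OF bounded_linear_cscale] by blast
  show thesis
  proof
    \<comment> \<open>The displacement contributes at most \<open>d / 4\<close> and the centre less
      than \<open>d / 2\<close>, so the sum stays below \<open>d\<close>.\<close>
    show "d / (4 * K) > 0" "d / 2 > 0" using d K by auto
    fix y z assume "dist y x < d / 2" and z: "cmod z \<le> d / (4 * K)"
    moreover have "norm (cscale z v) \<le> d / 4"
      using K(2)[of z] mult_right_mono[OF z, of K] K(1) by (simp add: field_simps)
    ultimately have "dist (y + cscale z v) x < d"
      using d(1) norm_triangle_ineq[of "y - x" "cscale z v"] by (simp add: dist_norm algebra_simps)
    then show "y + cscale z v \<in> S" using d by (auto simp: dist_commute)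
  qed
qed

text \<open>A bootstrap in two rounds. Cauchy's formula first makes every directional derivative
  continuous. Once this is known on all of \<open>S\<close>, the same formula can be differentiated
  under the integral sign.\<close>

lemma chol_frechet_derivative_aux:
  assumes "open S" "chol f S" "x \<in> S"
  shows "continuous (at x) (\<lambda>y. frechet_derivative f (at y) v)"
    and "(\<And>w. continuous_on S (\<lambda>y. frechet_derivative f (at y) w)) \<Longrightarrow>
      \<exists>r>0. (\<forall>z. cmod z \<le> r \<longrightarrow> x + cscale z v \<in> S) \<and>
      ((\<lambda>y. frechet_derivative f (at y) v) has_derivative
      (\<lambda>w. integral {0..1} (\<lambda>t. frechet_derivative f
          (at (x + cscale (of_real r * exp (2 * of_real pi * \<i> * of_real t)) v)) w *
        (exp (- (2 * of_real pi * \<i> * of_real t)) / of_real r)))) (at x)"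
proof -
  obtain r e where r: "r > 0" "e > 0" and in_S: "\<And>y z. dist y x < e \<Longrightarrow> cmod z \<le> r \<Longrightarrow> y + cscale z v \<in> S"
    using cscale_small[where v = v, OF assms(1,3)] by blast
  define U where "U = ball x e"
  define p where "p y t = y + cscale (of_real r * exp (2 * of_real pi * \<i> * of_real t)) v" for y t
  define k :: "real \<Rightarrow> complex" where "k t = exp (- (2 * of_real pi * \<i> * of_real t)) / of_real r" for t
  have U: "open U" "convex U" "x \<in> U" using r by (auto simp: U_def)
  have pS: "p y t \<in> S" if "y \<in> U" for y t
    unfolding p_def by (rule in_S) (use that r in \<open>auto simp: U_def dist_commute norm_mult norm_exp_eq_Re\<close>)
  have pc: "continuous_on (U \<times> {0..1}) (\<lambda>(y, t). p y t)"
    by (auto simp: p_def case_prod_beta intro!: continuous_intros)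
  have kc: "continuous_on T k" for T unfolding k_def using r by (auto intro!: continuous_intros)
  have kc2: "continuous_on (U \<times> {0..1}) (\<lambda>(y, t). k t)"
    using r by (auto simp: k_def case_prod_beta intro!: continuous_intros)
  have gc: "continuous_on (U \<times> {0..1}) (\<lambda>(y, t). g (p y t) * k t)" if "continuous_on S g" for g
  proof -
    have "(\<lambda>(y, t). p y t) ` (U \<times> {0..1}) \<subseteq> S" using pS by auto
    from continuous_on_mult[OF continuous_on_compose2[OF that pc this] kc2]
    show ?thesis by (simp add: case_prod_beta)
  qed
  have eq: "frechet_derivative f (at y) v = integral {0..1} (\<lambda>t. f (p y t) * k t)" if "y \<in> U" for y
    unfolding p_def k_def
    by (rule frechet_derivative_Cauchy[OF assms(2) r(1)]) (use in_S that in \<open>auto simp: U_def dist_commute\<close>)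
  have "continuous_on U (\<lambda>y. integral (cbox 0 1) (\<lambda>t. f (p y t) * k t))"
    by (rule integral_continuous_on_param) (use gc[OF chol_continuous_on[OF assms(2)]] in simp)
  then have "continuous_on U (\<lambda>y. frechet_derivative f (at y) v)"
    by (rule continuous_on_eq) (simp add: eq)
  then show "continuous (at x) (\<lambda>y. frechet_derivative f (at y) v)"
    using U continuous_on_eq_continuous_at by blast
  assume c: "\<And>w. continuous_on S (\<lambda>y. frechet_derivative f (at y) w)"
  have "((\<lambda>y. integral {0..1} (\<lambda>t. f (p y t) * k t)) has_derivative
      (\<lambda>w. integral {0..1} (\<lambda>t. frechet_derivative f (at (p x t)) w * k t))) (at x)"
  proof (rule has_derivative_integral_param[OF U])
    show "((\<lambda>y. f (p y t) * k t) has_derivative (\<lambda>w. frechet_derivative f (at (p y t)) w * k t)) (at y)"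
      if "y \<in> U" "t \<in> {0..1}" for y t
    proof -
      have "((\<lambda>y. p y t) has_derivative (\<lambda>w. w)) (at y)"
        unfolding p_def by (auto intro!: derivative_eq_intros)
      then have "((\<lambda>y. f (p y t)) has_derivative (\<lambda>w. frechet_derivative f (at (p y t)) w)) (at y)"
        by (rule has_derivative_compose) (rule cholD(1)[OF assms(2) pS[OF that(1)]])
      then show ?thesis by (rule has_derivative_mult_left)
    qed
    show "continuous_on {0..1} (\<lambda>t. f (p y t) * k t)" if "y \<in> U" for y
    proof -
      have "continuous_on {0..1} (\<lambda>t. case (y, t) of (y, t) \<Rightarrow> f (p y t) * k t)"
        by (rule continuous_on_compose2[OF gc[OF chol_continuous_on[OF assms(2)]]])
           (use that in \<open>auto intro: continuous_intros\<close>)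
      then show ?thesis by simp
    qed
    show "continuous_on (U \<times> {0..1}) (\<lambda>(y, t). frechet_derivative f (at (p y t)) v * k t)" for v
      by (rule gc[OF c])
  qed
  then have "((\<lambda>y. frechet_derivative f (at y) v) has_derivative
      (\<lambda>w. integral {0..1} (\<lambda>t. frechet_derivative f (at (p x t)) w * k t))) (at x)"
    by (rule has_derivative_transform_within_open[OF _ U(1,3)]) (simp add: eq)
  then show "\<exists>r>0. (\<forall>z. cmod z \<le> r \<longrightarrow> x + cscale z v \<in> S) \<and>
      ((\<lambda>y. frechet_derivative f (at y) v) has_derivative
      (\<lambda>w. integral {0..1} (\<lambda>t. frechet_derivative f
          (at (x + cscale (of_real r * exp (2 * of_real pi * \<i> * of_real t)) v)) w *
        (exp (- (2 * of_real pi * \<i> * of_real t)) / of_real r)))) (at x)"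
    using r in_S[of x] unfolding p_def k_def by auto
qed

text \<open>In the integral formula for the second derivative the integrand is complex linear in the
  new direction, hence so is the integral. The class \<open>chol\<close> is thus closed under
  directional derivatives, which yields all orders by induction.\<close>

lemma chol_frechet_derivative:
  assumes "open S" "chol f S"
  shows "chol (\<lambda>y. frechet_derivative f (at y) v) S"
  unfolding chol_def
proof
  fix x assume x: "x \<in> S"
  have c: "continuous_on S (\<lambda>y. frechet_derivative f (at y) w)" for w
    using chol_frechet_derivative_aux(1)[OF assms] by (auto intro: continuous_at_imp_continuous_on)
  obtain r where r: "r > 0" "\<And>z. cmod z \<le> r \<Longrightarrow> x + cscale z v \<in> S" and der:
    "((\<lambda>y. frechet_derivative f (at y) v) has_derivative
      (\<lambda>w. integral {0..1} (\<lambda>t. frechet_derivative f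
          (at (x + cscale (of_real r * exp (2 * of_real pi * \<i> * of_real t)) v)) w *
        (exp (- (2 * of_real pi * \<i> * of_real t)) / of_real r)))) (at x)"
    using chol_frechet_derivative_aux(2)[where v = v, OF assms x c] by blast
  have "integral {0..1} (\<lambda>t. frechet_derivative f
          (at (x + cscale (of_real r * exp (2 * of_real pi * \<i> * of_real t)) v)) (I w) *
        (exp (- (2 * of_real pi * \<i> * of_real t)) / of_real r)) =
     \<i> * integral {0..1} (\<lambda>t. frechet_derivative f
          (at (x + cscale (of_real r * exp (2 * of_real pi * \<i> * of_real t)) v)) w *
        (exp (- (2 * of_real pi * \<i> * of_real t)) / of_real r))" for w
    unfolding integral_mult_right[symmetric]
  proof (rule integral_cong)
    fix t :: real
    have "x + cscale (of_real r * exp (2 * of_real pi * \<i> * of_real t)) v \<in> S"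
      using r by (intro r(2)) (simp add: norm_mult norm_exp_eq_Re)
    from cholD(2)[OF assms(2) this, of w]
    show "frechet_derivative f (at (x + cscale (of_real r * exp (2 * of_real pi * \<i> * of_real t)) v)) (I w) *
        (exp (- (2 * of_real pi * \<i> * of_real t)) / of_real r) =
      \<i> * (frechet_derivative f (at (x + cscale (of_real r * exp (2 * of_real pi * \<i> * of_real t)) v)) w *
        (exp (- (2 * of_real pi * \<i> * of_real t)) / of_real r))" by simp
  qed
  with der show "\<exists>D. ((\<lambda>y. frechet_derivative f (at y) v) has_derivative D) (at x) \<and> (\<forall>v. D (I v) = \<i> * D v)"
    by blast
qed

text \<open>Differentiating, in direction \<open>w\<close>, Cauchy's formula for the derivative
  along \<open>v\<close> gives the integral over the \<open>v\<close>-circle of the derivative along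
  \<open>w\<close>. That integral is Cauchy's formula for the derivative along \<open>v\<close> of
  the latter.\<close>

lemma chol_second_derivative_symmetric:
  assumes "open S" "chol f S" "x \<in> S"
  shows "frechet_derivative (\<lambda>y. frechet_derivative f (at y) v) (at x) w =
    frechet_derivative (\<lambda>y. frechet_derivative f (at y) w) (at x) v"
proof -
  have c: "continuous_on S (\<lambda>y. frechet_derivative f (at y) w)" for w
    by (rule chol_continuous_on[OF chol_frechet_derivative[OF assms(1,2)]])
  obtain r where r: "r > 0" "\<And>z. cmod z \<le> r \<Longrightarrow> x + cscale z v \<in> S" and der:
    "((\<lambda>y. frechet_derivative f (at y) v) has_derivative
      (\<lambda>w. integral {0..1} (\<lambda>t. frechet_derivative f
          (at (x + cscale (of_real r * exp (2 * of_real pi * \<i> * of_real t)) v)) w *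
        (exp (- (2 * of_real pi * \<i> * of_real t)) / of_real r)))) (at x)"
    using chol_frechet_derivative_aux(2)[where v = v, OF assms c] by blast
  show ?thesis
    unfolding frechet_derivative_at[OF der, symmetric]
    by (rule frechet_derivative_Cauchy[OF chol_frechet_derivative[OF assms(1,2)] r, symmetric])
qed

lemma chol_Ck_on: "open S \<Longrightarrow> chol f S \<Longrightarrow> Ck_on k f S"
proof (induction k arbitrary: f)
  case 0
  then show ?case by (simp add: chol_continuous_on)
next
  case (Suc k)
  then show ?case
    by (intro Ck_on_Suc_intro[where f' = "\<lambda>x. frechet_derivative f (at x)"])
       (auto intro: cholD(1) chol_frechet_derivative)
qed

definition hol :: "('a \<Rightarrow> complex^'k) \<Rightarrow> 'a set \<Rightarrow> bool" where
  "hol f S \<longleftrightarrow> (\<forall>x\<in>S. \<exists>D. (f has_derivative D) (at x) \<and> (\<forall>v. D (I v) = \<i> *s D v))"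

lemma holD:
  assumes "hol f S" "x \<in> S"
  shows "(f has_derivative frechet_derivative f (at x)) (at x)"
    and "frechet_derivative f (at x) (I v) = \<i> *s frechet_derivative f (at x) v"
proof -
  obtain D where D: "(f has_derivative D) (at x)" "\<And>v. D (I v) = \<i> *s D v"
    using assms unfolding hol_def by blast
  then have "D = frechet_derivative f (at x)" using frechet_derivative_at by blast
  with D show "(f has_derivative frechet_derivative f (at x)) (at x)"
    and "frechet_derivative f (at x) (I v) = \<i> *s frechet_derivative f (at x) v" by simp_all
qed

lemma hol_component:
  assumes "hol f S"
  shows "chol (\<lambda>x. f x $ i) S"
  unfolding chol_def
proof
  fix x assume "x \<in> S"
  from has_derivative_compose[OF holD(1)[OF assms this]
      bounded_linear_imp_has_derivative[OF bounded_linear_vec_nth]] holD(2)[OF assms this]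
  show "\<exists>D. ((\<lambda>x. f x $ i) has_derivative D) (at x) \<and> (\<forall>v. D (I v) = \<i> * D v)"
    by (intro exI conjI) auto
qed

lemma frechet_derivative_component:
  assumes "hol f S" "x \<in> S"
  shows "frechet_derivative (\<lambda>x. f x $ i) (at x) v = frechet_derivative f (at x) v $ i"
  using frechet_derivative_at[OF has_derivative_compose[OF holD(1)[OF assms]
      bounded_linear_imp_has_derivative[OF bounded_linear_vec_nth[of i]]], symmetric] by (rule fun_cong)

lemma hol_smooth_on:
  fixes f :: "'a \<Rightarrow> complex^'k::finite"
  assumes "open S" "hol f S"
  shows "smooth_on f S"
proof (rule smooth_on_componentwise[OF assms(1)])
  fix b :: "complex^'k" assume "b \<in> Basis"
  then obtain i u where b: "b = axis i u" by (auto simp: Basis_vec_def)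
  have "smooth_on (\<lambda>x. f x $ i) S"
    using chol_Ck_on[OF assms(1) hol_component[OF assms(2)]] by (rule smooth_onI)
  then show "smooth_on (\<lambda>x. f x \<bullet> b) S"
    unfolding b inner_axis by (rule smooth_on_bounded_linear[OF assms(1) bounded_linear_inner_left])
qed

lemma hol_second_derivative_symmetric:
  fixes f :: "'a \<Rightarrow> complex^'k::finite"
  assumes "open S" "hol f S" "x \<in> S"
  shows "frechet_derivative (\<lambda>y. frechet_derivative f (at y) v) (at x) w =
    frechet_derivative (\<lambda>y. frechet_derivative f (at y) w) (at x) v"
proof -
  have *: "frechet_derivative (\<lambda>y. frechet_derivative f (at y) v) (at x) w $ i =
    frechet_derivative (\<lambda>y. frechet_derivative (\<lambda>x. f x $ i) (at y) v) (at x) w" for v w i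
  proof -
    have "((\<lambda>y. frechet_derivative f (at y) v) has_derivative
        frechet_derivative (\<lambda>y. frechet_derivative f (at y) v) (at x)) (at x)"
      by (rule smooth_on_has_derivative[OF smooth_on_frechet_derivative[OF hol_smooth_on[OF assms(1,2)]] assms(3)])
    from has_derivative_compose[OF this bounded_linear_imp_has_derivative[OF bounded_linear_vec_nth[of i]]]
    have "((\<lambda>y. frechet_derivative (\<lambda>x. f x $ i) (at y) v) has_derivative
        (\<lambda>w. frechet_derivative (\<lambda>y. frechet_derivative f (at y) v) (at x) w $ i)) (at x)"
      by (rule has_derivative_transform_within_open[OF _ assms(1,3)])
         (simp add: frechet_derivative_component[OF assms(2)])
    from frechet_derivative_at[OF this] show ?thesis by metis
  qed
  show ?thesis
    by (simp add: vec_eq_iff * chol_second_derivative_symmetric[OF assms(1) hol_component[OF assms(2)] assms(3)])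
qed

end

section \<open>Flat linear systems of partial differential equations\<close>

lemma geometric_tail:
  fixes a :: "nat \<Rightarrow> 'a::banach"
  assumes "\<And>i. norm (a i) \<le> M / 2 ^ i"
  shows "summable a" "norm (suminf a - (\<Sum>i<n. a i)) \<le> 2 * M / 2 ^ n"
proof -
  have M: "(\<lambda>i. M * (1/2) ^ i) sums (M * 2)"
    using sums_mult[OF geometric_sums[of "1/2::real"], of M] by simp
  have bound: "norm (a i) \<le> M * (1/2) ^ i" for i
    using assms[of i] by (simp add: power_divide)
  show sa: "summable a"
    by (rule summable_comparison_test'[OF sums_summable[OF M]]) (rule bound)
  have "(\<lambda>i. M * (1/2) ^ n * (1/2) ^ i) sums (M * (1/2) ^ n * 2)"
    using sums_mult[OF geometric_sums[of "1/2::real"], of "M * (1/2) ^ n"] by simp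
  moreover have "norm (a (i + n)) \<le> M * (1/2) ^ n * (1/2) ^ i" for i
    using bound[of "i + n"] by (simp add: power_add mult.commute mult.left_commute)
  ultimately have "norm (suminf (\<lambda>i. a (i + n))) \<le> M * (1/2) ^ n * 2"
    using norm_suminf_le[of "\<lambda>i. a (i + n)" "\<lambda>i. M * (1/2) ^ n * (1/2) ^ i"]
    by (simp add: sums_iff)
  then show "norm (suminf a - (\<Sum>i<n. a i)) \<le> 2 * M / 2 ^ n"
    using suminf_minus_initial_segment[OF sa, of n] by (simp add: power_divide mult.commute)
qed

text \<open>
  The system \<open>D\<^sub>v Z = - \<Gamma> v Z\<close> on a ball about the origin; \<open>G x w v z\<close> is the derivative of
  \<open>\<Gamma> v z\<close> at \<open>x\<close> in direction \<open>w\<close>. It is solved along rays by Picard iteration.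
\<close>

locale flat_linear_system =
  fixes \<Gamma> :: "'a::euclidean_space \<Rightarrow> 'a \<Rightarrow> 'b::euclidean_space \<Rightarrow> 'b"
    and G :: "'a \<Rightarrow> 'a \<Rightarrow> 'a \<Rightarrow> 'b \<Rightarrow> 'b"
    and C \<rho> :: real
  assumes rho: "0 < \<rho>" "\<rho> \<le> 1" "0 \<le> C" "4 * C * \<rho> \<le> 1"
    and Gam_bound: "\<And>x v z. x \<in> ball 0 \<rho> \<Longrightarrow> norm (\<Gamma> x v z) \<le> C * norm v * norm z"
    and G_bound: "\<And>x w v z. x \<in> ball 0 \<rho> \<Longrightarrow> norm (G x w v z) \<le> C * norm w * norm v * norm z"
    and Gam_linear: "\<And>x z. x \<in> ball 0 \<rho> \<Longrightarrow> linear (\<lambda>v. \<Gamma> x v z)" "\<And>x v. x \<in> ball 0 \<rho> \<Longrightarrow> linear (\<Gamma> x v)"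
    and G_linear: "\<And>x v z. x \<in> ball 0 \<rho> \<Longrightarrow> linear (\<lambda>w. G x w v z)"
    and Gam_continuous: "\<And>T :: ('a \<times> real) set. \<And>p u \<zeta>. continuous_on T p \<Longrightarrow> p ` T \<subseteq> ball 0 \<rho> \<Longrightarrow> continuous_on T u \<Longrightarrow>
      continuous_on T \<zeta> \<Longrightarrow> continuous_on T (\<lambda>q. \<Gamma> (p q) (u q) (\<zeta> q))"
    and G_continuous: "\<And>T :: ('a \<times> real) set. \<And>p w u \<zeta>. continuous_on T p \<Longrightarrow> p ` T \<subseteq> ball 0 \<rho> \<Longrightarrow> continuous_on T w \<Longrightarrow>
      continuous_on T u \<Longrightarrow> continuous_on T \<zeta> \<Longrightarrow> continuous_on T (\<lambda>q. G (p q) (w q) (u q) (\<zeta> q))"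
    and Gam_deriv: "\<And>x u \<zeta> u' \<zeta>'. \<And>p :: 'a \<Rightarrow> 'a. \<And>p'. p x \<in> ball 0 \<rho> \<Longrightarrow> (p has_derivative p') (at x) \<Longrightarrow> (u has_derivative u') (at x) \<Longrightarrow>
      (\<zeta> has_derivative \<zeta>') (at x) \<Longrightarrow> ((\<lambda>x. \<Gamma> (p x) (u x) (\<zeta> x)) has_derivative
        (\<lambda>v. G (p x) (p' v) (u x) (\<zeta> x) + \<Gamma> (p x) (u' v) (\<zeta> x) + \<Gamma> (p x) (u x) (\<zeta>' v))) (at x)"
    and Gam_flat: "\<And>x v w z. x \<in> ball 0 \<rho> \<Longrightarrow>
      G x v w z - G x w v z + \<Gamma> x v (\<Gamma> x w z) - \<Gamma> x w (\<Gamma> x v z) = 0"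
begin

abbreviation "B \<equiv> ball (0::'a) \<rho>"

lemma scale_in_B: "y \<in> B \<Longrightarrow> t \<in> {0..1} \<Longrightarrow> t *\<^sub>R y \<in> B"
  using mult_left_le_one_le[of "norm y" t] by auto

text \<open>The locale states continuity for parameters in \<open>'a \<times> real\<close>. A real
  parameter is embedded as the second coordinate, with the first one frozen at 0.\<close>

lemma Gam_continuous_real:
  fixes p u :: "real \<Rightarrow> 'a" and \<zeta> :: "real \<Rightarrow> 'b"
  assumes "continuous_on T p" "p ` T \<subseteq> B" "continuous_on T u" "continuous_on T \<zeta>"
  shows "continuous_on T (\<lambda>t. \<Gamma> (p t) (u t) (\<zeta> t))"
proof -
  have *: "continuous_on ({0::'a} \<times> T) (\<lambda>q. f (snd q))" if "continuous_on T f" for f :: "real \<Rightarrow> 'c::topological_space"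
    by (rule continuous_on_compose2[OF that]) (auto intro: continuous_intros)
  have "continuous_on ({0::'a} \<times> T) (\<lambda>q. \<Gamma> (p (snd q)) (u (snd q)) (\<zeta> (snd q)))"
    by (rule Gam_continuous) (use assms * in auto)
  moreover have "continuous_on T (\<lambda>t. (0::'a, t))" "(\<lambda>t. (0::'a, t)) ` T \<subseteq> {0} \<times> T"
    by (auto intro!: continuous_intros)
  ultimately show ?thesis
    using continuous_on_compose2[of "{0::'a} \<times> T" _ T "\<lambda>t. (0::'a, t)"] by fastforce
qed

text \<open>The derivative in \<open>y\<close>, in direction \<open>v\<close>, of the ray integrand
  \<open>\<Gamma> (t y) y (Z (t y))\<close>. Its three terms come from the three occurrences of
  \<open>y\<close>.\<close>

definition F :: "('a \<Rightarrow> 'b) \<Rightarrow> ('a \<Rightarrow> 'a \<Rightarrow> 'b) \<Rightarrow> real \<Rightarrow> 'a \<Rightarrow> 'a \<Rightarrow> 'b" where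
  "F Z Z' t y v = G (t *\<^sub>R y) (t *\<^sub>R v) y (Z (t *\<^sub>R y)) + \<Gamma> (t *\<^sub>R y) v (Z (t *\<^sub>R y))
     + \<Gamma> (t *\<^sub>R y) y (Z' (t *\<^sub>R y) (t *\<^sub>R v))"

lemma continuous_on_ray_integral:
  assumes "\<And>y. y \<in> B \<Longrightarrow> (Z has_derivative Z' y) (at y)" "\<And>v. continuous_on B (\<lambda>y. Z' y v)"
    and s: "s \<in> {0..1}"
  shows "continuous_on (B \<times> {0..s}) (\<lambda>(y, t). \<Gamma> (t *\<^sub>R y) y (Z (t *\<^sub>R y)))"
    and "continuous_on (B \<times> {0..s}) (\<lambda>(y, t). F Z Z' t y v)"
proof -
  have p: "continuous_on (B \<times> {0..s}) (\<lambda>q. snd q *\<^sub>R fst q)" "(\<lambda>q. snd q *\<^sub>R fst q) ` (B \<times> {0..s}) \<subseteq> B"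
    using s scale_in_B by (auto intro!: continuous_intros simp del: mem_ball)
  have Z: "continuous_on B Z"
    using assms(1) has_derivative_continuous by (metis continuous_at_imp_continuous_on)
  have Zc: "continuous_on (B \<times> {0..s}) (\<lambda>q. Z (snd q *\<^sub>R fst q))"
    by (rule continuous_on_compose2[OF Z p])
  have Zc': "continuous_on (B \<times> {0..s}) (\<lambda>q. Z' (snd q *\<^sub>R fst q) (snd q *\<^sub>R v))" for v
  proof -
    have "continuous_on (B \<times> {0..s}) (\<lambda>q. snd q *\<^sub>R Z' (snd q *\<^sub>R fst q) v)"
      by (intro continuous_intros continuous_on_compose2[OF assms(2) p])
    then show ?thesis
    proof (rule continuous_on_eq)
      fix q assume "q \<in> B \<times> {0..s}"
      then have "snd q *\<^sub>R fst q \<in> B" using p(2) by blast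
      from has_derivative_linear[OF assms(1)[OF this]]
      show "snd q *\<^sub>R Z' (snd q *\<^sub>R fst q) v = Z' (snd q *\<^sub>R fst q) (snd q *\<^sub>R v)"
        by (simp add: linear_scale)
    qed
  qed
  show "continuous_on (B \<times> {0..s}) (\<lambda>(y, t). \<Gamma> (t *\<^sub>R y) y (Z (t *\<^sub>R y)))"
    unfolding case_prod_beta by (intro Gam_continuous p Zc continuous_intros)
  show "continuous_on (B \<times> {0..s}) (\<lambda>(y, t). F Z Z' t y v)"
    unfolding case_prod_beta F_def by (intro continuous_on_add Gam_continuous G_continuous p Zc Zc' continuous_intros)
qed

lemma ray_integral_derivative:
  assumes "\<And>y. y \<in> B \<Longrightarrow> (Z has_derivative Z' y) (at y)" "\<And>v. continuous_on B (\<lambda>y. Z' y v)"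
    and s: "s \<in> {0..1}" and y: "y \<in> B"
  shows "((\<lambda>y. integral {0..s} (\<lambda>t. \<Gamma> (t *\<^sub>R y) y (Z (t *\<^sub>R y)))) has_derivative
      (\<lambda>v. integral {0..s} (\<lambda>t. F Z Z' t y v))) (at y)"
proof (rule has_derivative_integral_param[OF open_ball convex_ball y])
  show "((\<lambda>y. \<Gamma> (t *\<^sub>R y) y (Z (t *\<^sub>R y))) has_derivative F Z Z' t y) (at y)"
    if "y \<in> B" "t \<in> {0..s}" for y t
  proof -
    have ty: "t *\<^sub>R y \<in> B" using scale_in_B[of y t] that s by auto
    have p: "((\<lambda>y. t *\<^sub>R y) has_derivative (\<lambda>v. t *\<^sub>R v)) (at y)"
      by (auto intro!: derivative_eq_intros)
    show ?thesis
      unfolding F_def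
      by (rule Gam_deriv[OF ty p has_derivative_ident has_derivative_compose[OF p assms(1)[OF ty]]])
  qed
  show "continuous_on {0..s} (\<lambda>t. \<Gamma> (t *\<^sub>R y) y (Z (t *\<^sub>R y)))" if "y \<in> B" for y
  proof -
    have "continuous_on {0..s} (\<lambda>t. (y, t))" "(\<lambda>t. (y, t)) ` {0..s} \<subseteq> B \<times> {0..s}"
      using that by (auto intro: continuous_intros)
    from continuous_on_compose2[OF continuous_on_ray_integral(1)[OF assms(1,2) s] this]
    show ?thesis by simp
  qed
  show "continuous_on (B \<times> {0..s}) (\<lambda>(y, t). F Z Z' t y v)" for v
    by (rule continuous_on_ray_integral(2)[OF assms(1,2) s])
qed

text \<open>Rescaling the ray parameter by \<open>s\<close> produces a factor that linearity in the
  direction slot absorbs. Thus the integral operator at the point \<open>s y\<close> is an integral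
  up to \<open>s\<close> along the ray of \<open>y\<close>, ready for the fundamental theorem of
  calculus. At \<open>s = 0\<close> the substitution degenerates.\<close>

lemma ray_substitution:
  assumes "continuous_on B Z" "y \<in> B" "s \<in> {0..1}"
  shows "integral {0..1} (\<lambda>t. \<Gamma> (t *\<^sub>R (s *\<^sub>R y)) (s *\<^sub>R y) (Z (t *\<^sub>R (s *\<^sub>R y)))) =
    integral {0..s} (\<lambda>t. \<Gamma> (t *\<^sub>R y) y (Z (t *\<^sub>R y)))"
proof (cases "s = 0")
  case True
  have "\<Gamma> 0 0 (Z 0) = 0" using linear_0[OF Gam_linear(1)[of 0 "Z 0"]] rho by simp
  then show ?thesis using True by simp
next
  case False
  define f where "f t = \<Gamma> (t *\<^sub>R y) y (Z (t *\<^sub>R y))" for t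
  have s: "s > 0" using False assms by auto
  have p: "continuous_on {0..s} (\<lambda>t. t *\<^sub>R y)" "(\<lambda>t. t *\<^sub>R y) ` {0..s} \<subseteq> B"
    using assms(3) scale_in_B[OF assms(2)] by (auto intro!: continuous_intros simp del: mem_ball)
  have "continuous_on {0..s} f"
    unfolding f_def
    by (intro Gam_continuous_real p continuous_on_compose2[OF assms(1) p] continuous_intros)
  then have "(f has_integral integral {0..s} f) {0..s}"
    using integrable_continuous_interval integrable_integral by blast
  then have "((\<lambda>t. f (s * t)) has_integral (1 / s) *\<^sub>R integral {0..s} f) {0..1}"
    using has_integral_stretch_real[of f "integral {0..s} f" 0 s s] s by simp
  then have "((\<lambda>t. s *\<^sub>R f (s * t)) has_integral integral {0..s} f) {0..1}"
    using has_integral_cmul[of "\<lambda>t. f (s * t)" _ "{0..1}" s] s by fastforce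
  moreover have "s *\<^sub>R f (s * t) = \<Gamma> (t *\<^sub>R (s *\<^sub>R y)) (s *\<^sub>R y) (Z (t *\<^sub>R (s *\<^sub>R y)))" if "t \<in> {0..1}" for t
    using linear_scale[OF Gam_linear(1)[OF scale_in_B[OF assms(2), of "s * t"]]] assms(3) that
    by (simp add: f_def mult.commute mult_le_one)
  ultimately show ?thesis
    unfolding f_def[symmetric] by (metis (no_types, lifting) has_integral_eq integral_unique)
qed

subsection \<open>Picard iteration\<close>

text \<open>These are the terms of the Neumann series and not its partial sums: the solution is the
  sum of \<open>Y z0 k\<close> over all \<open>k\<close>. Each term is the image of the preceding
  one under the integral operator of the equation along rays.\<close>

primrec Y :: "'b \<Rightarrow> nat \<Rightarrow> 'a \<Rightarrow> 'b" where
  "Y z0 0 = (\<lambda>y. z0)"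
| "Y z0 (Suc k) = (\<lambda>y. - integral {0..1} (\<lambda>t. \<Gamma> (t *\<^sub>R y) y (Y z0 k (t *\<^sub>R y))))"

primrec Y' :: "'b \<Rightarrow> nat \<Rightarrow> 'a \<Rightarrow> 'a \<Rightarrow> 'b" where
  "Y' z0 0 = (\<lambda>y v. 0)"
| "Y' z0 (Suc k) = (\<lambda>y v. - integral {0..1} (\<lambda>t. F (Y z0 k) (Y' z0 k) t y v))"

text \<open>Differentiability and continuity of the derivative are proved together, since
  differentiating the next integral uses both for the preceding term.\<close>

lemma Y_deriv_aux:
  "(\<forall>y\<in>B. (Y z0 k has_derivative Y' z0 k y) (at y)) \<and> (\<forall>v. continuous_on B (\<lambda>y. Y' z0 k y v))"
proof (induction k)
  case (Suc k)
  then have IH: "\<And>y. y \<in> B \<Longrightarrow> (Y z0 k has_derivative Y' z0 k y) (at y)"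
    "\<And>v. continuous_on B (\<lambda>y. Y' z0 k y v)" by blast+
  have "(Y z0 (Suc k) has_derivative Y' z0 (Suc k) y) (at y)" if "y \<in> B" for y
    using has_derivative_minus[OF ray_integral_derivative[OF IH, of 1 y]] that by simp
  moreover have "continuous_on B (\<lambda>y. Y' z0 (Suc k) y v)" for v
  proof -
    have "continuous_on B (\<lambda>y. integral (cbox 0 1) (\<lambda>t. F (Y z0 k) (Y' z0 k) t y v))"
      by (rule integral_continuous_on_param)
         (use continuous_on_ray_integral(2)[OF IH, of 1 v] in simp)
    then show ?thesis by (simp add: continuous_on_minus)
  qed
  ultimately show ?case by blast
qed auto

lemma Y_deriv:
  "y \<in> B \<Longrightarrow> (Y z0 k has_derivative Y' z0 k y) (at y)"
  "continuous_on B (\<lambda>y. Y' z0 k y v)"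
  using Y_deriv_aux by blast+

lemma Y_continuous: "continuous_on B (Y z0 k)"
  using Y_deriv(1) has_derivative_continuous by (metis continuous_at_imp_continuous_on)

text \<open>Each integration costs a factor \<open>C * norm y\<close>, which is at most 1/4 by
  \<open>4 * C * \<rho> \<le> 1\<close>.\<close>

lemma Y_bound: "y \<in> B \<Longrightarrow> norm (Y z0 k y) \<le> norm z0 / 4 ^ k"
proof (induction k arbitrary: y)
  case (Suc k)
  have "norm (integral {0..1} (\<lambda>t. \<Gamma> (t *\<^sub>R y) y (Y z0 k (t *\<^sub>R y)))) \<le> (norm z0 / 4 ^ Suc k) * (1 - 0)"
  proof (rule integral_bound)
    have "continuous_on {0..1} (\<lambda>t. (y, t))" "(\<lambda>t. (y, t)) ` {0..1} \<subseteq> B \<times> {0..1}"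
      using Suc.prems by (auto intro: continuous_intros)
    from continuous_on_compose2[OF continuous_on_ray_integral(1)[OF Y_deriv] this]
    show "continuous_on {0..1} (\<lambda>t. \<Gamma> (t *\<^sub>R y) y (Y z0 k (t *\<^sub>R y)))" by simp
    fix t :: real assume t: "t \<in> {0..1}"
    have ty: "t *\<^sub>R y \<in> B" by (rule scale_in_B[OF Suc.prems t])
    have "norm (\<Gamma> (t *\<^sub>R y) y (Y z0 k (t *\<^sub>R y))) \<le> C * norm y * norm (Y z0 k (t *\<^sub>R y))"
      by (rule Gam_bound[OF ty])
    also have "\<dots> \<le> (1/4) * (norm z0 / 4 ^ k)"
    proof (rule mult_mono)
      have "C * norm y \<le> C * \<rho>" using Suc.prems rho by (intro mult_left_mono) auto
      then show "C * norm y \<le> 1/4" using rho by simp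
    qed (use Suc.IH[OF ty] in auto)
    finally show "norm (\<Gamma> (t *\<^sub>R y) y (Y z0 k (t *\<^sub>R y))) \<le> norm z0 / 4 ^ Suc k" by simp
  qed simp
  then show ?case by simp
qed auto

text \<open>The constant 8 reproduces itself. The first two terms of \<open>F\<close> contribute
  \<open>C\<close> each and the third a quarter of the previous bound, so 8 over
  \<open>2 ^ k\<close> becomes \<open>1 + 1 + 8/4 = 4\<close> over \<open>2 ^ k\<close>, which is 8
  over \<open>2 ^ Suc k\<close>.\<close>

lemma Y'_bound: "y \<in> B \<Longrightarrow> norm (Y' z0 k y v) \<le> 8 * C * norm z0 * norm v / 2 ^ k"
proof (induction k arbitrary: y v)
  case 0
  show ?case using rho by simp
next
  case (Suc k)
  have "norm (integral {0..1} (\<lambda>t. F (Y z0 k) (Y' z0 k) t y v)) \<le> (8 * C * norm z0 * norm v / 2 ^ Suc k) * (1 - 0)"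
  proof (rule integral_bound)
    have "continuous_on {0..1} (\<lambda>t. (y, t))" "(\<lambda>t. (y, t)) ` {0..1} \<subseteq> B \<times> {0..1}"
      using Suc.prems by (auto intro: continuous_intros)
    from continuous_on_compose2[OF continuous_on_ray_integral(2)[OF Y_deriv] this]
    show "continuous_on {0..1} (\<lambda>t. F (Y z0 k) (Y' z0 k) t y v)" by simp
    fix t :: real assume t: "t \<in> {0..1}"
    have ty: "t *\<^sub>R y \<in> B" by (rule scale_in_B[OF Suc.prems t])
    have ny: "norm y \<le> \<rho>" "norm y \<le> 1" "C * norm y \<le> 1/4"
    proof -
      show "norm y \<le> \<rho>" "norm y \<le> 1" using Suc.prems rho by auto
      then have "C * norm y \<le> C * \<rho>" using rho by (intro mult_left_mono) auto
      then show "C * norm y \<le> 1/4" using rho by simp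
    qed
    have tv: "norm (t *\<^sub>R v) \<le> norm v" using t by (simp add: mult_left_le_one_le)
    have pow: "norm z0 / 4 ^ k \<le> norm z0 / 2 ^ k"
      by (intro divide_left_mono power_mono mult_pos_pos) auto
    have 1: "norm (G (t *\<^sub>R y) (t *\<^sub>R v) y (Y z0 k (t *\<^sub>R y))) \<le> C * norm v * 1 * (norm z0 / 2 ^ k)"
      using ny tv rho Y_bound[OF ty, of z0 k] pow
      by (intro order_trans[OF G_bound[OF ty]] mult_mono mult_nonneg_nonneg) auto
    have 2: "norm (\<Gamma> (t *\<^sub>R y) v (Y z0 k (t *\<^sub>R y))) \<le> C * norm v * (norm z0 / 2 ^ k)"
      using rho Y_bound[OF ty, of z0 k] pow
      by (intro order_trans[OF Gam_bound[OF ty]] mult_mono mult_nonneg_nonneg) auto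
    have "norm (Y' z0 k (t *\<^sub>R y) (t *\<^sub>R v)) \<le> 8 * C * norm z0 * norm v / 2 ^ k"
      using tv rho by (intro order_trans[OF Suc.IH[OF ty]] divide_right_mono mult_mono) auto
    then have 3: "norm (\<Gamma> (t *\<^sub>R y) y (Y' z0 k (t *\<^sub>R y) (t *\<^sub>R v))) \<le> 1/4 * (8 * C * norm z0 * norm v / 2 ^ k)"
      using ny rho by (intro order_trans[OF Gam_bound[OF ty]] mult_mono) auto
    have "norm (F (Y z0 k) (Y' z0 k) t y v) \<le> C * norm v * 1 * (norm z0 / 2 ^ k)
        + C * norm v * (norm z0 / 2 ^ k) + 1/4 * (8 * C * norm z0 * norm v / 2 ^ k)"
      unfolding F_def by (intro order_trans[OF norm_triangle_ineq] add_mono 1 2 3)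
    also have "\<dots> = 8 * C * norm z0 * norm v / 2 ^ Suc k" by (simp add: field_simps)
    finally show "norm (F (Y z0 k) (Y' z0 k) t y v) \<le> 8 * C * norm z0 * norm v / 2 ^ Suc k" .
  qed simp
  then show ?case by simp
qed

text \<open>The chain rule and the fundamental theorem of calculus both compute the derivative of
  the term along the ray of \<open>y\<close> at parameter 1. It is taken from inside, because the
  integral is controlled only up to 1.\<close>

lemma Y'_radial:
  assumes "y \<in> B"
  shows "Y' z0 (Suc k) y y = - \<Gamma> y y (Y z0 k y)"
proof -
  let ?f = "\<lambda>t. \<Gamma> (t *\<^sub>R y) y (Y z0 k (t *\<^sub>R y))"
  have p: "continuous_on {0..1} (\<lambda>t. t *\<^sub>R y)" "(\<lambda>t. t *\<^sub>R y) ` {0..1} \<subseteq> B"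
    using scale_in_B[OF assms] by (auto intro!: continuous_intros simp del: mem_ball)
  have "continuous_on {0..1} ?f"
    by (intro Gam_continuous_real p continuous_on_compose2[OF Y_continuous p] continuous_intros)
  from integral_has_vector_derivative[OF this, of 1]
  have "((\<lambda>s. - integral {0..s} ?f) has_vector_derivative - ?f 1) (at 1 within {0..1})"
    by (intro has_vector_derivative_minus) simp
  then have 1: "((\<lambda>s. Y z0 (Suc k) (s *\<^sub>R y)) has_vector_derivative - ?f 1) (at 1 within {0..1})"
    by (rule has_vector_derivative_transform[rotated 2])
       (use ray_substitution[OF Y_continuous assms] in auto)
  have "((\<lambda>s. s *\<^sub>R y) has_vector_derivative y) (at 1 within {0..1})"
    by (auto intro!: derivative_eq_intros)
  moreover have "(Y z0 (Suc k) has_derivative Y' z0 (Suc k) y) (at ((\<lambda>s. s *\<^sub>R y) 1) within (\<lambda>s. s *\<^sub>R y) ` {0..1})"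
    using Y_deriv(1)[OF assms] has_derivative_at_withinI by (metis scaleR_one)
  ultimately have 2: "((\<lambda>s. Y z0 (Suc k) (s *\<^sub>R y)) has_vector_derivative Y' z0 (Suc k) y y) (at 1 within {0..1})"
    using vector_derivative_diff_chain_within[of "\<lambda>s. s *\<^sub>R y" y 1 "{0..1}" "Y z0 (Suc k)" "Y' z0 (Suc k) y"]
    by (simp add: o_def)
  have "at (1::real) within {0..1} \<noteq> bot" by (simp add: at_within_Icc_at_left)
  from vector_derivative_unique_within[OF this 2 1] show ?thesis by simp
qed

subsection \<open>The limit solves the system in all directions\<close>

text \<open>Summation shifts the index: the radial derivative of term \<open>Suc k\<close> is
  \<open>- \<Gamma> y y\<close> of term \<open>k\<close>, and term 0 is constant. The sum therefore
  solves the equation along rays; transverse directions are left to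
  \<open>radial_solution_total\<close>.\<close>

lemma radial_solution:
  "\<exists>Z Z'. Z 0 = z0 \<and> (\<forall>y\<in>B. (Z has_derivative Z' y) (at y)) \<and> (\<forall>v. continuous_on B (\<lambda>y. Z' y v)) \<and>
     (\<forall>y\<in>B. Z' y y = - \<Gamma> y y (Z y))"
proof -
  define Z' where "Z' y v = (\<Sum>k. Y' z0 k y v)" for y v
  define M where "M = 8 * C * norm z0"
  have M: "norm (Y' z0 k y v) \<le> M * norm v / 2 ^ k" if "y \<in> B" for k y v
    using Y'_bound[OF that] by (simp add: M_def)
  have M0: "M \<ge> 0" using rho by (simp add: M_def)
  have tail: "norm ((\<Sum>i<n. Y' z0 i y v) - Z' y v) \<le> 2 * M / 2 ^ n * norm v" if "y \<in> B" for n y v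
    using geometric_tail(2)[of "\<lambda>k. Y' z0 k y v" "M * norm v" n] M[OF that]
    by (simp add: Z'_def norm_minus_commute)
  have small: "\<forall>\<^sub>F n in sequentially. 2 * M / 2 ^ n \<le> e" if "e > 0" for e
  proof -
    have "(\<lambda>n. 2 * M * (1/2) ^ n) \<longlonglongrightarrow> 0" by (intro tendsto_mult_right_zero LIMSEQ_power_zero) simp
    from order_tendstoD(2)[OF this that] show ?thesis
      by (rule eventually_mono) (simp add: power_divide)
  qed
  have Ys: "summable (\<lambda>k. Y z0 k y)" if "y \<in> B" for y
  proof (rule geometric_tail(1))
    show "norm (Y z0 k y) \<le> norm z0 / 2 ^ k" for k
      using Y_bound[OF that, of z0 k] by (rule order_trans) (auto intro!: divide_left_mono power_mono)
  qed
  obtain Z where Z: "\<And>y. y \<in> B \<Longrightarrow> (\<lambda>k. Y z0 k y) sums Z y"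
      "\<And>y. y \<in> B \<Longrightarrow> (Z has_derivative Z' y) (at y within B)"
  proof -
    have 0: "0 \<in> B" using rho by simp
    have "\<exists>g. \<forall>x\<in>B. (\<lambda>n. Y z0 n x) sums g x \<and> (g has_derivative Z' x) (at x within B)"
    proof (rule has_derivative_series[where f = "Y z0" and f' = "Y' z0" and g' = Z',
          OF convex_ball _ _ 0 summable_sums[OF Ys[OF 0]]])
      show "(Y z0 n has_derivative Y' z0 n x) (at x within B)" if "x \<in> B" for n x
        using Y_deriv(1)[OF that] has_derivative_at_withinI by blast
      show "\<forall>\<^sub>F n in sequentially. \<forall>x\<in>B. \<forall>h. norm ((\<Sum>i<n. Y' z0 i x h) - Z' x h) \<le> e * norm h"
        if "e > 0" for e
        using small[OF that]
      proof eventually_elim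
        case (elim n)
        show ?case
        proof (intro ballI allI)
          fix x h assume "x \<in> B"
          from tail[OF this, where n = n and v = h] mult_right_mono[OF elim norm_ge_zero[of h]]
          show "norm ((\<Sum>i<n. Y' z0 i x h) - Z' x h) \<le> e * norm h" by (rule order_trans)
        qed
      qed
    qed
    with that show thesis by blast
  qed
  show ?thesis
  proof (intro exI conjI ballI allI)
    \<comment> \<open>At the centre the direction is 0, so every term but the constant one vanishes
      there.\<close>
    have "\<Gamma> 0 0 z = 0" for z using linear_0[OF Gam_linear(1)[of 0 z]] rho by simp
    then have "Y z0 (Suc k) 0 = 0" for k by simp
    then have "(\<lambda>k. Y z0 k 0) sums z0"
      using sums_If_finite[of "\<lambda>k. k = 0" "\<lambda>k. z0"] by (auto elim!: sums_cong[THEN iffD1, rotated] split: nat.splits simp: not0_implies_Suc gr0_conv_Suc dest!: not0_implies_Suc)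
    then show "Z 0 = z0" using Z(1)[of 0] rho sums_unique2 by auto
    show "(Z has_derivative Z' y) (at y)" if "y \<in> B" for y
      using Z(2)[OF that] at_within_open[OF that open_ball] by simp
    show "continuous_on B (\<lambda>y. Z' y v)" for v
    proof (rule uniform_limit_theorem)
      show "\<forall>\<^sub>F n in sequentially. continuous_on B (\<lambda>y. \<Sum>i<n. Y' z0 i y v)"
        by (intro always_eventually allI continuous_on_sum Y_deriv(2))
      show "uniform_limit B (\<lambda>n y. \<Sum>i<n. Y' z0 i y v) (\<lambda>y. Z' y v) sequentially"
        unfolding Z'_def by (rule Weierstrass_m_test[where M = "\<lambda>k. M * norm v / 2 ^ k"])
          (use M geometric_tail(1)[of "\<lambda>k. M * norm v / 2 ^ k" "M * norm v"] M0 in auto)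
    qed simp
    show "Z' y y = - \<Gamma> y y (Z y)" if "y \<in> B" for y
    proof -
      have "(\<lambda>k. - \<Gamma> y y (Y z0 k y)) sums - \<Gamma> y y (Z y)"
        by (intro sums_minus bounded_linear.sums[OF _ Z(1)[OF that]])
           (use Gam_linear(2)[OF that] linear_conv_bounded_linear in blast)
      then have "(\<lambda>k. Y' z0 (Suc k) y y) sums - \<Gamma> y y (Z y)" using Y'_radial[OF that] by simp
      then have "(\<lambda>k. Y' z0 k y y) sums - \<Gamma> y y (Z y)" using sums_Suc[of "\<lambda>k. Y' z0 k y y"] by simp
      then show ?thesis unfolding Z'_def by (simp add: sums_iff)
    qed
  qed
qed

text \<open>
  Along a ray, the defect \<open>Z' v + \<Gamma> v Z\<close> times the radius satisfies a homogeneous linear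
  differential equation by flatness, and it vanishes at the centre.
\<close>

lemma radial_solution_total:
  assumes Z: "\<And>y. y \<in> B \<Longrightarrow> (Z has_derivative Z' y) (at y)" "\<And>v. continuous_on B (\<lambda>y. Z' y v)"
    and radial: "\<And>y. y \<in> B \<Longrightarrow> Z' y y = - \<Gamma> y y (Z y)" and y: "y \<in> B"
  shows "Z' y v = - \<Gamma> y v (Z y)"
proof -
  have Zc: "continuous_on B Z"
    using Z(1) has_derivative_continuous by (metis continuous_at_imp_continuous_on)
  have ray_deriv: "((\<lambda>s. Z (s *\<^sub>R y)) has_vector_derivative Z' (s *\<^sub>R y) y) (at s)"
    if "s \<in> {0..1}" "y \<in> B" for s y
  proof -
    have "((\<lambda>s. s *\<^sub>R y) has_vector_derivative y) (at s)" by (auto intro!: derivative_eq_intros)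
    from vector_derivative_diff_chain_within[of _ _ _ UNIV, OF this] show ?thesis
      using Z(1)[OF scale_in_B[OF that(2,1)]] has_derivative_at_withinI by (fastforce simp: o_def)
  qed
  have rad: "Z' (s *\<^sub>R y) y = - \<Gamma> (s *\<^sub>R y) y (Z (s *\<^sub>R y))" if "s \<in> {0<..1}" "y \<in> B" for s y
  proof -
    have sy: "s *\<^sub>R y \<in> B" using scale_in_B[OF that(2)] that(1) by auto
    have "s *\<^sub>R Z' (s *\<^sub>R y) y = s *\<^sub>R (- \<Gamma> (s *\<^sub>R y) y (Z (s *\<^sub>R y)))"
      using radial[OF sy] linear_scale[OF has_derivative_linear[OF Z(1)[OF sy]]]
        linear_scale[OF Gam_linear(1)[OF sy]] by simp
    then show ?thesis by (rule scaleR_left_imp_eq[rotated]) (use that(1) in simp)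
  qed
  have integral_eq: "Z (t *\<^sub>R y) = Z 0 - integral {0..t} (\<lambda>s. \<Gamma> (s *\<^sub>R y) y (Z (s *\<^sub>R y)))"
    if "t \<in> {0..1}" "y \<in> B" for t y
  proof -
    have "((\<lambda>s. - \<Gamma> (s *\<^sub>R y) y (Z (s *\<^sub>R y))) has_integral (Z (t *\<^sub>R y) - Z (0 *\<^sub>R y))) {0..t}"
    proof (rule fundamental_theorem_of_calculus_interior)
      show "continuous_on {0..t} (\<lambda>s. Z (s *\<^sub>R y))"
        by (rule continuous_on_compose2[OF Zc])
           (use that scale_in_B in \<open>auto intro!: continuous_intros simp del: mem_ball\<close>)
      show "((\<lambda>s. Z (s *\<^sub>R y)) has_vector_derivative - \<Gamma> (s *\<^sub>R y) y (Z (s *\<^sub>R y))) (at s)"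
        if "s \<in> {0<..<t}" for s
        using ray_deriv[of s y] rad[of s y] that \<open>t \<in> {0..1}\<close> \<open>y \<in> B\<close> by auto
    qed (use that in auto)
    from integral_unique[OF this]
    have "Z (t *\<^sub>R y) - Z 0 = - integral {0..t} (\<lambda>s. \<Gamma> (s *\<^sub>R y) y (Z (s *\<^sub>R y)))" by simp
    then show ?thesis by (simp add: diff_eq_eq)
  qed
  \<comment> \<open>\<open>Z'\<close> is only known to be continuous. Differentiating the integral
    equation in the transverse direction shows that \<open>t *\<^sub>R Z' (t *\<^sub>R y) v\<close>
    is an integral up to \<open>t\<close>, hence differentiable in \<open>t\<close>; this is why the
    defect is multiplied by \<open>t\<close>.\<close>
  have der_eq: "t *\<^sub>R Z' (t *\<^sub>R y) v = - integral {0..t} (\<lambda>s. F Z Z' s y v)" if t: "t \<in> {0..1}" for t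
  proof -
    have ty: "t *\<^sub>R y \<in> B" by (rule scale_in_B[OF y t])
    have "((\<lambda>y. t *\<^sub>R y) has_derivative (\<lambda>v. t *\<^sub>R v)) (at y)" by (auto intro!: derivative_eq_intros)
    from has_derivative_compose[OF this Z(1)[OF ty]]
    have 1: "((\<lambda>y. Z (t *\<^sub>R y)) has_derivative (\<lambda>v. Z' (t *\<^sub>R y) (t *\<^sub>R v))) (at y)" .
    have "((\<lambda>y. Z 0 - integral {0..t} (\<lambda>s. \<Gamma> (s *\<^sub>R y) y (Z (s *\<^sub>R y)))) has_derivative
        (\<lambda>v. 0 - integral {0..t} (\<lambda>s. F Z Z' s y v))) (at y)"
      by (intro has_derivative_diff has_derivative_const ray_integral_derivative Z t y)
    then have "((\<lambda>y. Z (t *\<^sub>R y)) has_derivative (\<lambda>v. 0 - integral {0..t} (\<lambda>s. F Z Z' s y v))) (at y)"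
      by (rule has_derivative_transform_within_open[OF _ open_ball y]) (rule integral_eq[OF t, symmetric])
    from has_derivative_unique[OF 1 this]
    have "Z' (t *\<^sub>R y) (t *\<^sub>R v) = - integral {0..t} (\<lambda>s. F Z Z' s y v)" by (simp add: fun_eq_iff)
    then show ?thesis using linear_scale[OF has_derivative_linear[OF Z(1)[OF ty]]] by simp
  qed
  define h where "h t = t *\<^sub>R (Z' (t *\<^sub>R y) v + \<Gamma> (t *\<^sub>R y) v (Z (t *\<^sub>R y)))" for t
  have p: "continuous_on {0..1} (\<lambda>t. t *\<^sub>R y)" "(\<lambda>t. t *\<^sub>R y) ` {0..1} \<subseteq> B"
    using scale_in_B[OF y] by (auto intro!: continuous_intros simp del: mem_ball)
  have hc: "continuous_on {0..1} h"
    unfolding h_def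
    by (intro continuous_intros Gam_continuous_real p continuous_on_compose2[OF Zc p]
        continuous_on_compose2[OF Z(2) p])
  have Fc: "continuous_on {0..1} (\<lambda>s. F Z Z' s y v)"
  proof -
    have "continuous_on {0..1::real} (\<lambda>t. (y, t))" "(\<lambda>t. (y, t)) ` {0..1} \<subseteq> B \<times> {0..1}"
      using y by (auto intro: continuous_intros)
    from continuous_on_compose2[OF continuous_on_ray_integral(2)[OF Z] this] show ?thesis by simp
  qed
  have hd: "(h has_vector_derivative - \<Gamma> (t *\<^sub>R y) y (h t)) (at t)" if t: "t \<in> {0<..<1}" for t
  proof -
    have ty: "t *\<^sub>R y \<in> B" using scale_in_B[OF y] t by auto
    let ?x = "t *\<^sub>R y" let ?z = "Z (t *\<^sub>R y)"
    have "((\<lambda>u. integral {0..u} (\<lambda>s. F Z Z' s y v)) has_vector_derivative F Z Z' t y v) (at t within {0..1})"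
      by (rule integral_has_vector_derivative[OF Fc]) (use t in auto)
    then have 1: "((\<lambda>u. integral {0..u} (\<lambda>s. F Z Z' s y v)) has_vector_derivative F Z Z' t y v) (at t)"
      using t by (simp add: at_within_Icc_at)
    have "((\<lambda>x. \<Gamma> x v (Z x)) has_derivative
        (\<lambda>w. G ?x w v ?z + \<Gamma> ?x 0 ?z + \<Gamma> ?x v (Z' ?x w))) (at ?x)"
      by (rule Gam_deriv[OF ty has_derivative_ident has_derivative_const Z(1)[OF ty]])
    then have "((\<lambda>x. \<Gamma> x v (Z x)) has_derivative
        (\<lambda>w. G ?x w v ?z + \<Gamma> ?x 0 ?z + \<Gamma> ?x v (Z' ?x w))) (at ((\<lambda>s. s *\<^sub>R y) t) within range (\<lambda>s. s *\<^sub>R y))"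
      using has_derivative_at_withinI by blast
    moreover have "((\<lambda>s. s *\<^sub>R y) has_vector_derivative y) (at t)" by (auto intro!: derivative_eq_intros)
    ultimately have "((\<lambda>s. \<Gamma> (s *\<^sub>R y) v (Z (s *\<^sub>R y))) has_vector_derivative
        G ?x y v ?z + \<Gamma> ?x 0 ?z + \<Gamma> ?x v (Z' ?x y)) (at t)"
      using vector_derivative_diff_chain_within[of "\<lambda>s. s *\<^sub>R y" y t UNIV "\<lambda>x. \<Gamma> x v (Z x)"]
      by (simp add: o_def)
    moreover have "\<Gamma> ?x 0 ?z = 0" using linear_0[OF Gam_linear(1)[OF ty]] by simp
    ultimately have 2: "((\<lambda>s. s *\<^sub>R \<Gamma> (s *\<^sub>R y) v (Z (s *\<^sub>R y))) has_vector_derivative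
        t *\<^sub>R (G ?x y v ?z + \<Gamma> ?x v (Z' ?x y)) + 1 *\<^sub>R \<Gamma> ?x v ?z) (at t)"
      using has_vector_derivative_scaleR[OF DERIV_ident, of "\<lambda>s. \<Gamma> (s *\<^sub>R y) v (Z (s *\<^sub>R y))" _ t UNIV] by simp
    have "((\<lambda>s. - integral {0..s} (\<lambda>s. F Z Z' s y v) + s *\<^sub>R \<Gamma> (s *\<^sub>R y) v (Z (s *\<^sub>R y)))
      has_vector_derivative (- F Z Z' t y v + (t *\<^sub>R (G ?x y v ?z + \<Gamma> ?x v (Z' ?x y)) + 1 *\<^sub>R \<Gamma> ?x v ?z))) (at t)"
      by (intro has_vector_derivative_add has_vector_derivative_minus 1 2)
    then have 3: "(h has_vector_derivative (- F Z Z' t y v + (t *\<^sub>R (G ?x y v ?z + \<Gamma> ?x v (Z' ?x y)) + 1 *\<^sub>R \<Gamma> ?x v ?z))) (at t)"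
      by (rule has_vector_derivative_transform_within_open[of _ _ _ "{0<..<1}"])
         (use t der_eq in \<open>auto simp: h_def scaleR_add_right\<close>)
    have "Z' ?x y = - \<Gamma> ?x y ?z" using rad[of t y] t y by auto
    then have e1: "\<Gamma> ?x v (Z' ?x y) = - \<Gamma> ?x v (\<Gamma> ?x y ?z)"
      using linear_neg[OF Gam_linear(2)[OF ty]] by simp
    have e2: "F Z Z' t y v = t *\<^sub>R G ?x v y ?z + \<Gamma> ?x v ?z + t *\<^sub>R \<Gamma> ?x y (Z' ?x v)"
      using linear_scale[OF G_linear[OF ty]] linear_scale[OF has_derivative_linear[OF Z(1)[OF ty]]]
        linear_scale[OF Gam_linear(2)[OF ty]] by (simp add: F_def)
    have e3: "\<Gamma> ?x y (h t) = t *\<^sub>R (\<Gamma> ?x y (Z' ?x v) + \<Gamma> ?x y (\<Gamma> ?x v ?z))"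
      using linear_scale[OF Gam_linear(2)[OF ty]] linear_add[OF Gam_linear(2)[OF ty]] by (simp add: h_def)
    \<comment> \<open>Flatness enters here and exchanges the two directions in
      \<open>G\<close>.\<close>
    have e4: "G ?x y v ?z = G ?x v y ?z - \<Gamma> ?x y (\<Gamma> ?x v ?z) + \<Gamma> ?x v (\<Gamma> ?x y ?z)"
      using Gam_flat[OF ty, of y v ?z] by (simp add: algebra_simps)
    have "- F Z Z' t y v + (t *\<^sub>R (G ?x y v ?z + \<Gamma> ?x v (Z' ?x y)) + 1 *\<^sub>R \<Gamma> ?x v ?z) = - \<Gamma> ?x y (h t)"
      unfolding e1 e2 e3 e4 by (simp add: algebra_simps)
    with 3 show ?thesis by simp
  qed
  \<comment> \<open>In place of a Gronwall estimate: at a maximum \<open>s\<close> of the norm of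
    \<open>h\<close>, the mean value inequality and \<open>C * norm y \<le> 1/4\<close> give
    \<open>norm (h s) \<le> norm (h s) / 4\<close>.\<close>
  obtain s where s: "s \<in> {0..1}" "\<And>t. t \<in> {0..1} \<Longrightarrow> norm (h t) \<le> norm (h s)"
    using continuous_attains_sup[of "{0..1::real}" "\<lambda>t. norm (h t)"] continuous_on_norm[OF hc] that
    by auto
  have "h s = 0"
  proof (cases "s = 0")
    case False
    then have s0: "0 < s" using s by auto
    have "continuous_on {0..s} h" using hc s by (auto intro: continuous_on_subset)
    from mvt_general[OF s0 this, of "\<lambda>t u. u *\<^sub>R (- \<Gamma> (t *\<^sub>R y) y (h t))"]
    obtain t where t: "t \<in> {0<..<s}" "norm (h s - h 0) \<le> norm ((s - 0) *\<^sub>R (- \<Gamma> (t *\<^sub>R y) y (h t)))"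
      using hd s by (auto simp: has_vector_derivative_def)
    have t1: "t \<in> {0..1}" using t s by auto
    have "norm (h s) \<le> s * norm (\<Gamma> (t *\<^sub>R y) y (h t))"
      using t(2) s0 by (simp add: h_def)
    also have "\<dots> \<le> 1 * norm (\<Gamma> (t *\<^sub>R y) y (h t))"
      using s by (intro mult_right_mono) auto
    also have "\<dots> \<le> C * norm y * norm (h t)"
      using Gam_bound[OF scale_in_B[OF y t1]] by simp
    also have "\<dots> \<le> (1/4) * norm (h s)"
    proof (rule mult_mono[OF _ s(2)[OF t1]])
      have "C * norm y \<le> C * \<rho>" using y rho by (intro mult_left_mono) auto
      then show "C * norm y \<le> 1/4" using rho by simp
    qed auto
    finally show ?thesis by simp
  qed (simp add: h_def)
  then have "h 1 = 0" using s(2)[of 1] by simp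
  then show ?thesis by (simp add: h_def eq_neg_iff_add_eq_0)
qed

lemma solution_exists:
  "\<exists>Z. Z 0 = z0 \<and> (\<forall>y\<in>B. (Z has_derivative (\<lambda>v. - \<Gamma> y v (Z y))) (at y))"
proof -
  obtain Z Z' where Z: "Z 0 = z0" "\<And>y. y \<in> B \<Longrightarrow> (Z has_derivative Z' y) (at y)"
    "\<And>v. continuous_on B (\<lambda>y. Z' y v)" "\<And>y. y \<in> B \<Longrightarrow> Z' y y = - \<Gamma> y y (Z y)"
    using radial_solution[of z0] by blast
  have "Z' y = (\<lambda>v. - \<Gamma> y v (Z y))" if "y \<in> B" for y
    by (rule ext) (rule radial_solution_total[OF Z(2-4) that])
  with Z show ?thesis by metis
qed

end

section \<open>Flat systems on arbitrary open sets, and inverses of parameter-dependent linear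
  maps\<close>

lemma finite_family_bounded:
  fixes f :: "'i \<Rightarrow> 'a::topological_space \<Rightarrow> 'b::real_normed_vector"
  assumes "compact K" "finite I" "\<And>i. i \<in> I \<Longrightarrow> continuous_on K (f i)"
  shows "\<exists>M\<ge>0. \<forall>i\<in>I. \<forall>x\<in>K. norm (f i x) \<le> M"
proof -
  have "compact ((\<lambda>x. \<Sum>i\<in>I. norm (f i x)) ` K)"
    using assms by (intro compact_continuous_image continuous_on_sum continuous_on_norm)
  from compact_imp_bounded[OF this] obtain M where M: "\<And>x. x \<in> K \<Longrightarrow> norm (\<Sum>i\<in>I. norm (f i x)) \<le> M"
    unfolding bounded_iff by blast
  have "norm (f i x) \<le> max M 0" if "i \<in> I" "x \<in> K" for i x
    using member_le_sum[of i I "\<lambda>i. norm (f i x)"] M[OF that(2)] that assms(2) by (simp add: abs_le_iff)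
  then show ?thesis by (intro exI[of _ "max M 0"]) auto
qed

text \<open>The radius depends on \<Gamma> only and is chosen before \<open>z0\<close>: the
  solutions for a basis of initial values have to live on a common ball in order to form a
  frame.\<close>

lemma flat_system_solvable:
  fixes \<Gamma> :: "'a::euclidean_space \<Rightarrow> 'a \<Rightarrow> 'b::euclidean_space \<Rightarrow> 'b"
  assumes S: "open S" "x0 \<in> S"
    and lin1: "\<And>x z. x \<in> S \<Longrightarrow> linear (\<lambda>v. \<Gamma> x v z)" and lin2: "\<And>x v. x \<in> S \<Longrightarrow> linear (\<Gamma> x v)"
    and smooth: "\<And>v z. smooth_on (\<lambda>x. \<Gamma> x v z) S"
    and flat: "\<And>x v w z. x \<in> S \<Longrightarrow> frechet_derivative (\<lambda>x. \<Gamma> x w z) (at x) v -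
      frechet_derivative (\<lambda>x. \<Gamma> x v z) (at x) w + \<Gamma> x v (\<Gamma> x w z) - \<Gamma> x w (\<Gamma> x v z) = 0"
  shows "\<exists>r>0. ball x0 r \<subseteq> S \<and> (\<forall>z0. \<exists>Z. Z x0 = z0 \<and>
    (\<forall>x\<in>ball x0 r. (Z has_derivative (\<lambda>v. - \<Gamma> x v (Z x))) (at x)) \<and> smooth_on Z (ball x0 r))"
proof -
  define T where "T b c x = frechet_derivative (\<lambda>x. \<Gamma> x b c) (at x)" for b c x
  have Td: "((\<lambda>x. \<Gamma> x b c) has_derivative T b c x) (at x)" if "x \<in> S" for b c x
    unfolding T_def by (rule smooth_on_has_derivative[OF smooth that])
  have Tlin: "linear (T b c x)" if "x \<in> S" for b c x
    using has_derivative_linear[OF Td[OF that]] .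
  have Tcont: "continuous_on S (\<lambda>x. T b c x w)" for b c w
    unfolding T_def by (rule smooth_on_continuous[OF smooth_on_frechet_derivative[OF smooth]])
  have expand: "\<Gamma> x v z = (\<Sum>b\<in>Basis. \<Sum>c\<in>Basis. ((v \<bullet> b) * (z \<bullet> c)) *\<^sub>R \<Gamma> x b c)" if "x \<in> S" for x v z
    by (subst linear_sum_Basis[OF lin1[OF that]], rule sum.cong[OF refl],
        subst linear_sum_Basis[OF lin2[OF that]], simp add: scaleR_sum_right)
  obtain R where R: "R > 0" "cball x0 R \<subseteq> S" using S open_contains_cball by blast
  obtain M where M: "M \<ge> 0" "\<And>b c x. b \<in> Basis \<Longrightarrow> c \<in> Basis \<Longrightarrow> x \<in> cball x0 R \<Longrightarrow> norm (\<Gamma> x b c) \<le> M"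
  proof -
    have "\<exists>M\<ge>0. \<forall>i\<in>Basis \<times> Basis. \<forall>x\<in>cball x0 R. norm (case i of (b, c) \<Rightarrow> \<Gamma> x b c) \<le> M"
      by (rule finite_family_bounded)
         (use continuous_on_subset[OF smooth_on_continuous[OF smooth] R(2)] in auto)
    with that show thesis by force
  qed
  obtain N where N: "N \<ge> 0" "\<And>b c d x. b \<in> Basis \<Longrightarrow> c \<in> Basis \<Longrightarrow> d \<in> Basis \<Longrightarrow> x \<in> cball x0 R \<Longrightarrow> norm (T b c x d) \<le> N"
  proof -
    have "\<exists>M\<ge>0. \<forall>i\<in>Basis \<times> Basis \<times> Basis. \<forall>x\<in>cball x0 R. norm (case i of (b, c, d) \<Rightarrow> T b c x d) \<le> M"
      by (rule finite_family_bounded) (use continuous_on_subset[OF Tcont R(2)] in auto)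
    with that show thesis by force
  qed
  define a b where "a = real DIM('a)" and "b = real DIM('b)"
  \<comment> \<open>The two products bound \<Gamma> and its derivative after expansion in bases; the
    summand 1 keeps \<open>C\<close> positive, since \<rho> divides by it.\<close>
  define C where "C = a * b * M + a * a * b * N + 1"
  have ab: "a \<ge> 0" "b \<ge> 0" by (simp_all add: a_def b_def)
  have C: "C \<ge> 1" "a * b * M \<le> C" "a * a * b * N \<le> C"
    using M(1) N(1) ab by (simp_all add: C_def)
  define \<rho> where "\<rho> = min (min R 1) (1 / (4 * C))"
  have rho: "0 < \<rho>" "\<rho> \<le> 1" "\<rho> \<le> R" "4 * C * \<rho> \<le> 1"
  proof -
    show "0 < \<rho>" "\<rho> \<le> 1" "\<rho> \<le> R" using R C by (auto simp: \<rho>_def)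
    have "4 * C * \<rho> \<le> 4 * C * (1 / (4 * C))" using C by (intro mult_left_mono) (auto simp: \<rho>_def)
    then show "4 * C * \<rho> \<le> 1" using C by simp
  qed
  have inK: "x0 + y \<in> cball x0 R" if "y \<in> ball 0 \<rho>" for y using that rho by (auto simp: dist_norm)
  have inS: "x0 + y \<in> S" if "y \<in> ball 0 \<rho>" for y using inK[OF that] R by blast
  \<comment> \<open>A finite sum built from derivatives of the fixed entries
    \<open>\<Gamma> x b c\<close>, so that the bound and the joint continuity can be read off.
    \<open>G_eq\<close> identifies it with the derivative of \<Gamma>.\<close>
  define G where "G y w v z = (\<Sum>b\<in>Basis. \<Sum>c\<in>Basis. ((v \<bullet> b) * (z \<bullet> c)) *\<^sub>R T b c (x0 + y) w)" for y w v z
  have Gam_bound: "norm (\<Gamma> x v z) \<le> a * b * M * norm v * norm z" if "x \<in> cball x0 R" for x v z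
  proof -
    have "norm (\<Gamma> x v z) \<le> (\<Sum>b\<in>(Basis::'a set). \<Sum>c\<in>(Basis::'b set). M * norm v * norm z)"
    proof (subst expand[OF subsetD[OF R(2) that]], intro sum_norm_le)
      fix b :: 'a and c :: 'b assume bc: "b \<in> Basis" "c \<in> Basis"
      have "norm (((v \<bullet> b) * (z \<bullet> c)) *\<^sub>R \<Gamma> x b c) \<le> (norm v * norm z) * M"
        using M(2)[OF bc that] bc by (auto simp: abs_mult intro!: mult_mono Basis_le_norm)
      then show "norm (((v \<bullet> b) * (z \<bullet> c)) *\<^sub>R \<Gamma> x b c) \<le> M * norm v * norm z"
        by (simp add: mult.commute mult.left_commute)
    qed
    then show ?thesis by (simp add: a_def b_def mult.assoc)
  qed
  have T_bound: "norm (T b c x w) \<le> a * N * norm w" if "x \<in> cball x0 R" "b \<in> Basis" "c \<in> Basis" for b c x w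
  proof -
    have "norm (T b c x w) \<le> (\<Sum>d\<in>(Basis::'a set). N * norm w)"
    proof (subst linear_sum_Basis[OF Tlin[OF subsetD[OF R(2) that(1)]], of b c w], intro sum_norm_le)
      fix d :: 'a assume d: "d \<in> Basis"
      have "norm ((w \<bullet> d) *\<^sub>R T b c x d) \<le> norm w * N"
        using N(2)[OF that(2,3) d that(1)] d by (auto intro!: mult_mono Basis_le_norm)
      then show "norm ((w \<bullet> d) *\<^sub>R T b c x d) \<le> N * norm w" by (simp add: mult.commute)
    qed
    then show ?thesis by (simp add: a_def mult.assoc)
  qed
  have G_bound: "norm (G y w v z) \<le> a * a * b * N * norm w * norm v * norm z" if "y \<in> ball 0 \<rho>" for y w v z
  proof -
    have "norm (G y w v z) \<le> (\<Sum>b\<in>(Basis::'a set). \<Sum>c\<in>(Basis::'b set). a * N * norm w * norm v * norm z)"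
      unfolding G_def
    proof (intro sum_norm_le)
      fix b :: 'a and c :: 'b assume bc: "b \<in> Basis" "c \<in> Basis"
      have "norm (((v \<bullet> b) * (z \<bullet> c)) *\<^sub>R T b c (x0 + y) w) \<le> (norm v * norm z) * (a * N * norm w)"
        using T_bound[OF inK[OF that] bc, of w] bc ab N(1) by (auto simp: abs_mult intro!: mult_mono Basis_le_norm)
      then show "norm (((v \<bullet> b) * (z \<bullet> c)) *\<^sub>R T b c (x0 + y) w) \<le> a * N * norm w * norm v * norm z"
        by (simp add: mult.commute mult.left_commute)
    qed
    then show ?thesis by (simp add: a_def b_def mult.assoc mult.left_commute)
  qed
  interpret flat_linear_system "\<lambda>y. \<Gamma> (x0 + y)" G C \<rho>
  proof (rule flat_linear_system.intro)
    show "0 < \<rho>" "\<rho> \<le> 1" "4 * C * \<rho> \<le> 1" "0 \<le> C" using rho C by auto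
    fix x v w :: 'a and z :: 'b
    assume x: "x \<in> ball 0 \<rho>"
    have "norm (\<Gamma> (x0 + x) v z) \<le> a * b * M * norm v * norm z" by (rule Gam_bound[OF inK[OF x]])
    also have "\<dots> \<le> C * norm v * norm z" by (intro mult_right_mono C) auto
    finally show "norm (\<Gamma> (x0 + x) v z) \<le> C * norm v * norm z" .
    have "norm (G x w v z) \<le> a * a * b * N * norm w * norm v * norm z" by (rule G_bound[OF x])
    also have "\<dots> \<le> C * norm w * norm v * norm z" by (intro mult_right_mono C) auto
    finally show "norm (G x w v z) \<le> C * norm w * norm v * norm z" .
    show "linear (\<lambda>v. \<Gamma> (x0 + x) v z)" "linear (\<Gamma> (x0 + x) v)" using lin1 lin2 inS[OF x] by auto
    show "linear (\<lambda>w. G x w v z)"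
      unfolding G_def by (intro linear_compose_sum ballI linear_compose_scale_right Tlin inS[OF x])
    have G_eq: "G x w v z = T v z (x0 + x) w" for v w z
    proof -
      have "((\<lambda>x. \<Sum>b\<in>Basis. \<Sum>c\<in>Basis. ((v \<bullet> b) * (z \<bullet> c)) *\<^sub>R \<Gamma> x b c) has_derivative (\<lambda>w. G x w v z)) (at (x0 + x))"
        unfolding G_def by (intro has_derivative_sum has_derivative_scaleR_right Td inS[OF x])
      then have "((\<lambda>x. \<Gamma> x v z) has_derivative (\<lambda>w. G x w v z)) (at (x0 + x))"
        by (rule has_derivative_transform_within_open[OF _ S(1) inS[OF x]]) (rule expand[symmetric])
      from has_derivative_unique[OF this Td[OF inS[OF x]]] show ?thesis by (rule fun_cong)
    qed
    show "G x v w z - G x w v z + \<Gamma> (x0 + x) v (\<Gamma> (x0 + x) w z) - \<Gamma> (x0 + x) w (\<Gamma> (x0 + x) v z) = 0"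
      using flat[OF inS[OF x], of w z v] by (simp add: G_eq T_def)
  next
    fix Q :: "('a \<times> real) set" and p u w :: "'a \<times> real \<Rightarrow> 'a" and \<zeta> :: "'a \<times> real \<Rightarrow> 'b"
    assume p: "continuous_on Q p" "p ` Q \<subseteq> ball 0 \<rho>" and u: "continuous_on Q u" and z: "continuous_on Q \<zeta>"
    have p': "continuous_on Q (\<lambda>q. x0 + p q)" "(\<lambda>q. x0 + p q) ` Q \<subseteq> S"
      using p inS by (auto intro!: continuous_intros simp del: mem_ball)
    have "continuous_on Q (\<lambda>q. \<Sum>b\<in>Basis. \<Sum>c\<in>Basis. ((u q \<bullet> b) * (\<zeta> q \<bullet> c)) *\<^sub>R \<Gamma> (x0 + p q) b c)"
      by (intro continuous_intros u z continuous_on_compose2[OF smooth_on_continuous[OF smooth] p'])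
    then show "continuous_on Q (\<lambda>q. \<Gamma> (x0 + p q) (u q) (\<zeta> q))"
      by (rule continuous_on_eq) (use p' expand in force)
    assume w: "continuous_on Q w"
    have "continuous_on Q (\<lambda>q. T b c (x0 + p q) (w q))" for b c
    proof -
      have "continuous_on Q (\<lambda>q. \<Sum>d\<in>Basis. (w q \<bullet> d) *\<^sub>R T b c (x0 + p q) d)"
        by (intro continuous_intros w continuous_on_compose2[OF Tcont p'])
      then show ?thesis
        by (rule continuous_on_eq) (use p' linear_sum_Basis[OF Tlin] in force)
    qed
    then show "continuous_on Q (\<lambda>q. G (p q) (w q) (u q) (\<zeta> q))"
      unfolding G_def by (intro continuous_intros u z)
  next
    fix x :: 'a and u :: "'a \<Rightarrow> 'a" and \<zeta> :: "'a \<Rightarrow> 'b" and u' \<zeta>' and p p' :: "'a \<Rightarrow> 'a"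
    assume px: "p x \<in> ball 0 \<rho>" and d: "(p has_derivative p') (at x)" "(u has_derivative u') (at x)"
      "(\<zeta> has_derivative \<zeta>') (at x)"
    have dp: "((\<lambda>x. x0 + p x) has_derivative p') (at x)"
      using has_derivative_add[OF has_derivative_const d(1)] by simp
    have ex: "\<Gamma> (x0 + p x) v z = (\<Sum>b\<in>Basis. \<Sum>c\<in>Basis. ((v \<bullet> b) * (z \<bullet> c)) *\<^sub>R \<Gamma> (x0 + p x) b c)" for v z
      by (rule expand[OF inS[OF px]])
    have "((\<lambda>x. \<Sum>b\<in>Basis. \<Sum>c\<in>Basis. ((u x \<bullet> b) * (\<zeta> x \<bullet> c)) *\<^sub>R \<Gamma> (x0 + p x) b c) has_derivative
      (\<lambda>v. \<Sum>b\<in>Basis. \<Sum>c\<in>Basis. ((u x \<bullet> b) * (\<zeta> x \<bullet> c)) *\<^sub>R T b c (x0 + p x) (p' v) +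
        ((u x \<bullet> b) * (\<zeta>' v \<bullet> c) + (u' v \<bullet> b) * (\<zeta> x \<bullet> c)) *\<^sub>R \<Gamma> (x0 + p x) b c)) (at x)"
      by (intro has_derivative_sum has_derivative_scaleR has_derivative_mult has_derivative_inner_left d
          has_derivative_compose[OF dp Td[OF inS[OF px]]])
    moreover have "(\<Sum>b\<in>Basis. \<Sum>c\<in>Basis. ((u x \<bullet> b) * (\<zeta> x \<bullet> c)) *\<^sub>R T b c (x0 + p x) (p' v) +
        ((u x \<bullet> b) * (\<zeta>' v \<bullet> c) + (u' v \<bullet> b) * (\<zeta> x \<bullet> c)) *\<^sub>R \<Gamma> (x0 + p x) b c) =
        G (p x) (p' v) (u x) (\<zeta> x) + \<Gamma> (x0 + p x) (u' v) (\<zeta> x) + \<Gamma> (x0 + p x) (u x) (\<zeta>' v)" for v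
      unfolding G_def ex[of "u' v"] ex[of "u x" "\<zeta>' v"]
      by (simp add: sum.distrib scaleR_add_left)
    ultimately have der: "((\<lambda>x. \<Sum>b\<in>Basis. \<Sum>c\<in>Basis. ((u x \<bullet> b) * (\<zeta> x \<bullet> c)) *\<^sub>R \<Gamma> (x0 + p x) b c) has_derivative
      (\<lambda>v. G (p x) (p' v) (u x) (\<zeta> x) + \<Gamma> (x0 + p x) (u' v) (\<zeta> x) + \<Gamma> (x0 + p x) (u x) (\<zeta>' v))) (at x)"
      by simp
    have "\<forall>\<^sub>F y in at x. p y \<in> ball 0 \<rho>"
      using has_derivative_continuous[OF d(1)] px by (metis continuous_at_open eventually_at_topological open_ball isCont_def topological_tendstoD)
    then have ev: "\<forall>\<^sub>F y in at x. (\<Sum>b\<in>Basis. \<Sum>c\<in>Basis. ((u y \<bullet> b) * (\<zeta> y \<bullet> c)) *\<^sub>R \<Gamma> (x0 + p y) b c) =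
        \<Gamma> (x0 + p y) (u y) (\<zeta> y)"
      by (rule eventually_mono) (rule expand[OF inS, symmetric])
    show "((\<lambda>x. \<Gamma> (x0 + p x) (u x) (\<zeta> x)) has_derivative
      (\<lambda>v. G (p x) (p' v) (u x) (\<zeta> x) + \<Gamma> (x0 + p x) (u' v) (\<zeta> x) + \<Gamma> (x0 + p x) (u x) (\<zeta>' v))) (at x)"
      by (rule has_derivative_transform_eventually[OF der ev]) (rule ex[symmetric] UNIV_I)+
  qed
  have sub: "ball x0 \<rho> \<subseteq> S" using R(2) \<open>\<rho> \<le> R\<close> by fastforce
  show ?thesis
  proof (intro exI[of _ \<rho>] conjI allI sub)
    fix z0
    obtain Z where Z: "Z 0 = z0" "\<And>y. y \<in> ball 0 \<rho> \<Longrightarrow> (Z has_derivative (\<lambda>v. - \<Gamma> (x0 + y) v (Z y))) (at y)"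
      using solution_exists[of z0] by blast
    define Z1 where "Z1 = (\<lambda>x. Z (x - x0))"
    have d: "(Z1 has_derivative (\<lambda>v. - \<Gamma> x v (Z1 x))) (at x)" if "x \<in> ball x0 \<rho>" for x
    proof -
      have "x - x0 \<in> ball 0 \<rho>" using that by (simp add: dist_norm norm_minus_commute)
      note d = Z(2)[OF this]
      have "((\<lambda>x. x - x0) has_derivative (\<lambda>v. v)) (at x)" by (auto intro!: derivative_eq_intros)
      from has_derivative_compose[OF this d] show ?thesis by (simp add: Z1_def)
    qed
    \<comment> \<open>If \<open>Z1\<close> has class \<open>k\<close>, then so has the right-hand
      side of its equation, which is the derivative of \<open>Z1\<close>.\<close>
    have "Ck_on k Z1 (ball x0 \<rho>)" for k
    proof (induction k)
      case 0
      then show ?case using d has_derivative_continuous by (metis Ck_on.simps(1) continuous_at_imp_continuous_on)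
    next
      case (Suc k)
      show ?case
      proof (rule Ck_on_Suc_intro[OF open_ball d])
        fix v
        have "Ck_on k (\<lambda>x. \<Gamma> x v (Z1 x)) (ball x0 \<rho>)"
          by (rule Ck_on_apply_linear[OF open_ball lin2 Ck_on_subset[OF smooth_onD[OF smooth] sub] Suc])
             (use sub in auto)
        from Ck_on_bounded_linear[OF open_ball bounded_linear_minus[OF bounded_linear_ident] this]
        show "Ck_on k (\<lambda>x. - \<Gamma> x v (Z1 x)) (ball x0 \<rho>)" by simp
      qed
    qed
    then have "smooth_on Z1 (ball x0 \<rho>)" by (rule smooth_onI)
    with d Z(1) show "\<exists>Z. Z x0 = z0 \<and> (\<forall>x\<in>ball x0 \<rho>. (Z has_derivative (\<lambda>v. - \<Gamma> x v (Z x))) (at x)) \<and>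
        smooth_on Z (ball x0 \<rho>)"
      by (intro exI[of _ Z1]) (auto simp: Z1_def)
  qed (use rho in auto)
qed

text \<open>Applies the inverse function theorem to \<open>(x, u) \<mapsto> (x, P x u)\<close>.\<close>

lemma has_derivative_apply_inverse:
  fixes P \<theta> :: "'a::euclidean_space \<Rightarrow> 'b::euclidean_space \<Rightarrow> 'b"
  assumes S: "open S" "x \<in> S"
    and lin: "\<And>x. x \<in> S \<Longrightarrow> linear (P x)"
    and inv: "\<And>x u. x \<in> S \<Longrightarrow> \<theta> x (P x u) = u" "\<And>x u. x \<in> S \<Longrightarrow> P x (\<theta> x u) = u"
    and P: "\<And>x u. x \<in> S \<Longrightarrow> ((\<lambda>x. P x u) has_derivative P' x u) (at x)"
    and Y: "(Y has_derivative Y') (at x)"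
  shows "((\<lambda>x. \<theta> x (Y x)) has_derivative (\<lambda>v. \<theta> x (Y' v - P' x (\<theta> x (Y x)) v))) (at x)"
proof -
  define h where "h = (\<lambda>(x, u). (x, \<Sum>b\<in>Basis. (u \<bullet> b) *\<^sub>R P x b))"
  define g where "g = (\<lambda>(x, w). (x, \<theta> x w))"
  define h' where "h' = (\<lambda>y u (dx, du). (dx, \<Sum>b\<in>Basis. (u \<bullet> b) *\<^sub>R P' y b dx + (du \<bullet> b) *\<^sub>R P y b))"
  let ?u = "\<theta> x (Y x)"
  define g' where "g' = (\<lambda>(dx, dw). (dx, \<theta> x (dw - P' x ?u dx)))"
  have h_eq: "h (y, u) = (y, P y u)" if "y \<in> S" for y u
    using linear_sum_Basis[OF lin[OF that], of u] by (simp add: h_def)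
  have P'_eq: "P' y u v = (\<Sum>b\<in>Basis. (u \<bullet> b) *\<^sub>R P' y b v)" if "y \<in> S" for y u v
  proof -
    have "((\<lambda>x. \<Sum>b\<in>Basis. (u \<bullet> b) *\<^sub>R P x b) has_derivative (\<lambda>v. \<Sum>b\<in>Basis. (u \<bullet> b) *\<^sub>R P' y b v)) (at y)"
      by (intro has_derivative_sum has_derivative_scaleR_right P that)
    then have "((\<lambda>x. P x u) has_derivative (\<lambda>v. \<Sum>b\<in>Basis. (u \<bullet> b) *\<^sub>R P' y b v)) (at y)"
      by (rule has_derivative_transform_within_open[OF _ S(1) that]) (metis linear_sum_Basis lin)
    from has_derivative_unique[OF P[OF that] this] show ?thesis by (rule fun_cong)
  qed
  have hd: "(h has_derivative h' y u) (at (y, u))" if "y \<in> S" for y u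
  proof -
    have "((\<lambda>q. P (fst q) b) has_derivative (\<lambda>d. P' y b (fst d))) (at (y, u))" for b
      by (rule has_derivative_compose[of fst fst]) (auto intro: derivative_intros P[OF that])
    then have "((\<lambda>q. (fst q, \<Sum>b\<in>Basis. (snd q \<bullet> b) *\<^sub>R P (fst q) b)) has_derivative
      (\<lambda>d. (fst d, \<Sum>b\<in>Basis. (snd (y, u) \<bullet> b) *\<^sub>R P' y b (fst d) + (snd d \<bullet> b) *\<^sub>R P (fst (y, u)) b))) (at (y, u))"
      by (intro has_derivative_Pair has_derivative_sum has_derivative_scaleR derivative_intros) auto
    then show ?thesis by (simp add: h_def h'_def case_prod_unfold)
  qed
  \<comment> \<open>No regularity of \<open>\<theta> x\<close> in \<open>x\<close> is assumed. It
    follows because \<open>g\<close> is a left inverse of the continuous map \<open>h\<close> and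
    \<open>g'\<close> is a right inverse of the derivative of \<open>h\<close>.\<close>
  have "(g has_derivative g') (at (h (x, ?u)))"
  proof (rule has_derivative_inverse_strong[where f = h and x = "(x, ?u)" and f' = "h' x ?u" and S = "S \<times> UNIV"])
    show "open (S \<times> (UNIV::'b set))" using S by (intro open_Times) auto
    show "(x, ?u) \<in> S \<times> UNIV" using S by simp
    show "continuous_on (S \<times> UNIV) h"
      using hd has_derivative_continuous by (fastforce intro: continuous_at_imp_continuous_on)
    show "g (h q) = q" if "q \<in> S \<times> UNIV" for q
      using that by (auto simp: h_eq g_def inv)
    show "(h has_derivative h' x ?u) (at (x, ?u))" by (rule hd[OF S(2)])
    have "h' x ?u (g' (dx, dw)) = (dx, dw)" for dx dw
    proof -
      have "(\<Sum>b\<in>Basis. (?u \<bullet> b) *\<^sub>R P' x b dx + (\<theta> x (dw - P' x ?u dx) \<bullet> b) *\<^sub>R P x b) =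
          P' x ?u dx + P x (\<theta> x (dw - P' x ?u dx))"
        using linear_sum_Basis[OF lin[OF S(2)], of "\<theta> x (dw - P' x ?u dx)"] P'_eq[OF S(2), of ?u dx]
        by (simp add: sum.distrib)
      then show ?thesis by (simp add: h'_def g'_def inv S)
    qed
    then show "h' x ?u \<circ> g' = id" by (auto simp: fun_eq_iff)
  qed
  then have "(g has_derivative g') (at (x, Y x))" by (simp add: h_eq S inv)
  from has_derivative_compose[OF has_derivative_Pair[OF has_derivative_ident Y] this]
  have "((\<lambda>x. g (x, Y x)) has_derivative (\<lambda>v. g' (v, Y' v))) (at x)" .
  from has_derivative_snd[OF this] show ?thesis by (simp add: g_def g'_def)
qed

section \<open>Charts and tangent maps\<close>

interpretation J: complex_structure "cstruct :: complex^'n \<Rightarrow> complex^'n"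
proof (rule complex_structure.intro)
  show "linear (cstruct :: complex^'n \<Rightarrow> complex^'n)"
    by (rule linearI) (auto simp: cstruct_def vec_eq_iff algebra_simps)
  show "cstruct (cstruct v) = - v" for v :: "complex^'n"
    by (simp add: cstruct_def vec_eq_iff flip: mult.assoc)
qed

lemma linear_cstruct_iff:
  fixes D :: "complex^'a \<Rightarrow> complex^'b"
  shows "Vector_Spaces.linear (*s) (*s) D \<longleftrightarrow> linear D \<and> (\<forall>v. D (cstruct v) = \<i> *s D v)"
proof
  assume D: "Vector_Spaces.linear (*s) (*s) D"
  have add: "D (u + v) = D u + D v" and scale: "D (a *s v) = a *s D v" for u v a
    using Vector_Spaces.linear.axioms D module_hom.add module_hom.scale unfolding Vector_Spaces.linear_def by metis+
  have "D (r *\<^sub>R v) = r *\<^sub>R D v" for r v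
    using scale[of "of_real r" v] by (simp add: vector_scalar_mult_def scaleR_vec_def scaleR_conv_of_real[symmetric])
  with add scale show "linear D \<and> (\<forall>v. D (cstruct v) = \<i> *s D v)"
    by (auto intro: linearI simp: cstruct_def)
next
  assume D: "linear D \<and> (\<forall>v. D (cstruct v) = \<i> *s D v)"
  have ex: "a *s v = Re a *\<^sub>R v + Im a *\<^sub>R (\<i> *s v)" for a and v :: "complex^'k"
    by (simp add: vec_eq_iff complex_eq_iff)
  have "D (a *s v) = a *s D v" for a v
    using D linear_add[of D] linear_scale[of D] by (subst (1 2) ex) (simp add: cstruct_def)
  then show "Vector_Spaces.linear (*s) (*s) D"
    using D linear_add[of D] by (auto simp: Vector_Spaces.linear_iff vec.vector_space_axioms)
qed

lemma holomorphic_map_on_iff: "holomorphic_map_on f S \<longleftrightarrow> J.hol f S"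
  unfolding holomorphic_map_on_def J.hol_def linear_cstruct_iff
  using has_derivative_linear by blast

lemma smooth_on_holomorphic: "open S \<Longrightarrow> holomorphic_map_on f S \<Longrightarrow> smooth_on f S"
  using J.hol_smooth_on holomorphic_map_on_iff by blast

locale atlas =
  fixes A :: "('m::topological_space, 'n::finite) chart set"
  assumes complex_atlas: "complex_atlas A"
begin

lemma chart_at: "chart_at A p \<in> A" "p \<in> chart_dom (chart_at A p)"
proof -
  have "\<exists>c. c \<in> A \<and> p \<in> chart_dom c" using complex_atlas unfolding complex_atlas_def by blast
  from someI_ex[OF this] show "chart_at A p \<in> A" "p \<in> chart_dom (chart_at A p)"
    unfolding chart_at_def by auto
qed

abbreviation "img c \<equiv> chart_map c ` chart_dom c"

lemma chart:
  assumes "c \<in> A"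
  shows "open (chart_dom c)" "open (img c)"
    and "continuous_on (chart_dom c) (chart_map c)" "continuous_on (img c) (chart_inv c)"
  using complex_atlas assms unfolding complex_atlas_def homeomorphism_def by auto

lemma chart_inv_map [simp]: "c \<in> A \<Longrightarrow> p \<in> chart_dom c \<Longrightarrow> chart_inv c (chart_map c p) = p"
  using complex_atlas unfolding complex_atlas_def homeomorphism_def by auto

lemma chart_map_inv [simp]: "c \<in> A \<Longrightarrow> x \<in> img c \<Longrightarrow> chart_map c (chart_inv c x) = x"
  using complex_atlas unfolding complex_atlas_def homeomorphism_def by auto

lemma in_chart_image: "c \<in> A \<Longrightarrow> x \<in> chart_map c ` (U \<inter> chart_dom c) \<longleftrightarrow> x \<in> img c \<and> chart_inv c x \<in> U"
  by (auto simp: image_iff)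

lemma open_chart_image:
  assumes "c \<in> A" "open U"
  shows "open (chart_map c ` (U \<inter> chart_dom c))"
proof -
  have "chart_map c ` (U \<inter> chart_dom c) = img c \<inter> chart_inv c -` U"
    using in_chart_image[OF assms(1), of _ U] by blast
  then show ?thesis
    using continuous_open_preimage[OF chart(4)[OF assms(1)] chart(2)[OF assms(1)] assms(2)] by simp
qed

lemma open_chart_preimage:
  assumes "c \<in> A" "open V"
  shows "open (chart_dom c \<inter> chart_map c -` V)"
  using continuous_open_preimage[OF chart(3)[OF assms(1)] chart(1)[OF assms(1)] assms(2)] .

text \<open>The Jacobian by which the coordinates of a tangent vector at \<open>p\<close> change
  from \<open>c\<close> to \<open>c'\<close>. With \<open>chart_at A p\<close> as \<open>c\<close>
  it passes from the stored form of a tangent vector to its coordinates in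
  \<open>c'\<close>.\<close>

definition Tr :: "('m, 'n) chart \<Rightarrow> ('m, 'n) chart \<Rightarrow> 'm \<Rightarrow> complex^'n \<Rightarrow> complex^'n" where
  "Tr c c' p = frechet_derivative (chart_map c' \<circ> chart_inv c) (at (chart_map c p))"

lemma hol_transition:
  assumes "c \<in> A" "c' \<in> A"
  shows "J.hol (chart_map c' \<circ> chart_inv c) (chart_map c ` (chart_dom c' \<inter> chart_dom c))"
  using complex_atlas assms holomorphic_map_on_iff unfolding complex_atlas_def by (metis inf_commute)

lemma smooth_transition:
  assumes "c \<in> A" "c' \<in> A"
  shows "smooth_on (chart_map c' \<circ> chart_inv c) (chart_map c ` (chart_dom c' \<inter> chart_dom c))"
  using J.hol_smooth_on[OF open_chart_image[OF assms(1) chart(1)[OF assms(2)]] hol_transition[OF assms]] .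

lemma Tr_deriv:
  assumes "c \<in> A" "c' \<in> A" "p \<in> chart_dom c" "p \<in> chart_dom c'"
  shows "((chart_map c' \<circ> chart_inv c) has_derivative Tr c c' p) (at (chart_map c p))"
    and "Tr c c' p (cstruct v) = cstruct (Tr c c' p v)"
proof -
  have "chart_map c p \<in> chart_map c ` (chart_dom c' \<inter> chart_dom c)" using assms by auto
  from J.holD[OF hol_transition[OF assms(1,2)] this]
  show "((chart_map c' \<circ> chart_inv c) has_derivative Tr c c' p) (at (chart_map c p))"
    and "Tr c c' p (cstruct v) = cstruct (Tr c c' p v)" by (simp_all add: Tr_def cstruct_def)
qed

lemma Tr_linear:
  assumes "c \<in> A" "c' \<in> A" "p \<in> chart_dom c" "p \<in> chart_dom c'"
  shows "linear (Tr c c' p)"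
  using has_derivative_linear[OF Tr_deriv(1)[OF assms]] .

lemma change_chart:
  assumes c: "c \<in> A" "c' \<in> A" "p \<in> chart_dom c" "p \<in> chart_dom c'"
    and f: "((f \<circ> chart_inv c') has_derivative D) (at (chart_map c' p))"
  shows "((f \<circ> chart_inv c) has_derivative (\<lambda>v. D (Tr c c' p v))) (at (chart_map c p))"
proof -
  let ?S = "chart_map c ` (chart_dom c' \<inter> chart_dom c)"
  have "((f \<circ> chart_inv c') has_derivative D) (at ((chart_map c' \<circ> chart_inv c) (chart_map c p)))"
    using f c by simp
  from has_derivative_compose[OF Tr_deriv(1)[OF c] this]
  have "((\<lambda>x. (f \<circ> chart_inv c') ((chart_map c' \<circ> chart_inv c) x)) has_derivative (\<lambda>v. D (Tr c c' p v))) (at (chart_map c p))" .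
  then show ?thesis
    by (rule has_derivative_transform_within_open[of _ _ _ _ ?S])
       (use c open_chart_image[OF c(1) chart(1)[OF c(2)]] in auto)
qed

lemma Tr_id:
  assumes "c \<in> A" "p \<in> chart_dom c"
  shows "Tr c c p v = v"
proof -
  have "((\<lambda>x. x) has_derivative (\<lambda>v. v)) (at (chart_map c p))" by simp
  then have "((chart_map c \<circ> chart_inv c) has_derivative (\<lambda>v. v)) (at (chart_map c p))"
    by (rule has_derivative_transform_within_open[OF _ chart(2)[OF assms(1)]]) (use assms in auto)
  from has_derivative_unique[OF Tr_deriv(1)[OF assms(1,1,2,2)] this] show ?thesis by (rule fun_cong)
qed

lemma Tr_Tr:
  assumes "c \<in> A" "c' \<in> A" "c'' \<in> A" "p \<in> chart_dom c" "p \<in> chart_dom c'" "p \<in> chart_dom c''"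
  shows "Tr c' c'' p (Tr c c' p v) = Tr c c'' p v"
  using has_derivative_unique[OF change_chart[OF assms(1,2,4,5) Tr_deriv(1)[OF assms(2,3,5,6)]]
      Tr_deriv(1)[OF assms(1,3,4,6)]] by (rule fun_cong)

lemma Tr_inverse:
  assumes "c \<in> A" "c' \<in> A" "p \<in> chart_dom c" "p \<in> chart_dom c'"
  shows "Tr c' c p (Tr c c' p v) = v"
  using Tr_Tr[OF assms(1,2,1,3,4,3)] Tr_id assms by simp

text \<open>\<open>mdiff\<close> is total and by itself asserts no differentiability; this relation
  carries both the derivative and its existence.\<close>

definition has_mderiv :: "('m \<Rightarrow> 'b::real_normed_vector) \<Rightarrow> 'm \<Rightarrow> (complex^'n \<Rightarrow> 'b) \<Rightarrow> bool" where
  "has_mderiv f p D \<longleftrightarrow>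
    ((f \<circ> chart_inv (chart_at A p)) has_derivative D) (at (chart_map (chart_at A p) p))"

lemma mdiff_eq: "has_mderiv f p D \<Longrightarrow> mdiff A f p = D"
  unfolding has_mderiv_def mdiff_def[abs_def] using frechet_derivative_at by blast

lemma has_mderivI:
  assumes "c \<in> A" "p \<in> chart_dom c" "((f \<circ> chart_inv c) has_derivative D) (at (chart_map c p))"
  shows "has_mderiv f p (\<lambda>v. D (Tr (chart_at A p) c p v))"
  unfolding has_mderiv_def by (rule change_chart[OF chart_at(1) assms(1) chart_at(2) assms(2,3)])

lemma has_mderivD:
  assumes "c \<in> A" "p \<in> chart_dom c" "has_mderiv f p D"
  shows "((f \<circ> chart_inv c) has_derivative (\<lambda>v. D (Tr c (chart_at A p) p v))) (at (chart_map c p))"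
  by (rule change_chart[OF assms(1) chart_at(1) assms(2) chart_at(2) assms(3)[unfolded has_mderiv_def]])

lemma has_mderiv_linear: "has_mderiv f p D \<Longrightarrow> linear D"
  unfolding has_mderiv_def by (rule has_derivative_linear)

lemma mdiff_chart_map: "mdiff A (chart_map c) p = Tr (chart_at A p) c p"
  by (simp add: mdiff_def[abs_def] Tr_def)

lemma field_rep_eq: "field_rep A c X x = Tr (chart_at A (chart_inv c x)) c (chart_inv c x) (X (chart_inv c x))"
  by (simp add: field_rep_def mdiff_chart_map)

lemma field_rep_chart:
  assumes "c \<in> A" "p \<in> chart_dom c"
  shows "field_rep A c X (chart_map c p) = Tr (chart_at A p) c p (X p)"
  using assms by (simp add: field_rep_eq)

lemma field_rep_chart_at: "field_rep A (chart_at A p) X (chart_map (chart_at A p) p) = X p"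
  using field_rep_chart[OF chart_at] Tr_id[OF chart_at] by simp

lemma field_from_rep:
  assumes "c \<in> A" "p \<in> chart_dom c"
  shows "X p = Tr c (chart_at A p) p (field_rep A c X (chart_map c p))"
  using assms chart_at by (simp add: field_rep_chart Tr_inverse)

text \<open>Inverse to \<open>field_rep\<close> over the chart: \<open>Y\<close> gives the
  coordinates in \<open>c\<close> of the resulting field. Outside the domain of \<open>c\<close> the
  values carry no meaning.\<close>

definition lift :: "('m, 'n) chart \<Rightarrow> (complex^'n \<Rightarrow> complex^'n) \<Rightarrow> 'm \<Rightarrow> complex^'n" where
  "lift c Y p = Tr c (chart_at A p) p (Y (chart_map c p))"

lemma field_rep_lift:
  assumes "c \<in> A" "c' \<in> A" "p \<in> chart_dom c" "p \<in> chart_dom c'"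
  shows "field_rep A c' (lift c Y) (chart_map c' p) = Tr c c' p (Y (chart_map c p))"
  using assms chart_at by (simp add: field_rep_chart lift_def Tr_Tr)

lemma field_rep_lift_same:
  assumes "c \<in> A" "x \<in> img c"
  shows "field_rep A c (lift c Y) x = Y x"
  using assms field_rep_lift[of c c "chart_inv c x"] Tr_id by auto

text \<open>Smoothness has to be checked in every chart. In \<open>c'\<close> the field is the
  Jacobian of the transition applied to \<open>Y\<close>, composed with the inverse
  transition.\<close>

lemma vector_field_lift:
  assumes c: "c \<in> A" and U: "open U" "U \<subseteq> chart_dom c" and Y: "smooth_on Y (chart_map c ` U)"
  shows "vector_field A U (lift c Y)"
  unfolding vector_field_def
proof
  fix c' assume c': "c' \<in> A"
  let ?\<tau> = "chart_map c' \<circ> chart_inv c" and ?\<sigma> = "chart_map c \<circ> chart_inv c'"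
  let ?V = "U \<inter> chart_dom c'"
  have V: "open ?V" by (rule open_Int[OF U(1) chart(1)[OF c']])
  have img_c: "chart_map c ` ?V = chart_map c ` (?V \<inter> chart_dom c)" using U by (intro arg_cong2[of _ _ _ _ "(`)"]) auto
  have oc: "open (chart_map c ` ?V)" unfolding img_c by (rule open_chart_image[OF c V])
  have oc': "open (chart_map c' ` ?V)"
    using open_chart_image[OF c' V] by (simp add: Int_absorb2 Int_assoc)
  have 1: "smooth_on (\<lambda>y. frechet_derivative ?\<tau> (at y) (Y y)) (chart_map c ` ?V)"
  proof (rule smooth_on_apply_linear[where L = "\<lambda>y. frechet_derivative ?\<tau> (at y)" and g = Y, OF oc])
    show "linear (frechet_derivative ?\<tau> (at y))" if "y \<in> chart_map c ` ?V" for y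
      using that U c c' Tr_linear[unfolded Tr_def] by blast
    show "smooth_on (\<lambda>y. frechet_derivative ?\<tau> (at y) w) (chart_map c ` ?V)" for w
      by (rule smooth_on_subset[OF smooth_on_frechet_derivative[OF smooth_transition[OF c c']]])
         (use U in auto)
    show "smooth_on Y (chart_map c ` ?V)" by (rule smooth_on_subset[OF Y]) auto
  qed
  have 2: "smooth_on ?\<sigma> (chart_map c' ` ?V)"
    by (rule smooth_on_subset[OF smooth_transition[OF c' c]]) (use U in auto)
  have "smooth_on (\<lambda>x. frechet_derivative ?\<tau> (at (?\<sigma> x)) (Y (?\<sigma> x))) (chart_map c' ` ?V)"
    by (rule smooth_on_compose[OF oc' oc _ 1 2]) (use c' in auto)
  then show "smooth_on (field_rep A c' (lift c Y)) (chart_map c' ` ?V)"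
  proof (rule smooth_on_cong[OF oc', rotated])
    fix x assume "x \<in> chart_map c' ` ?V"
    then obtain p where p: "p \<in> U" "p \<in> chart_dom c'" "x = chart_map c' p" by auto
    then show "frechet_derivative ?\<tau> (at (?\<sigma> x)) (Y (?\<sigma> x)) = field_rep A c' (lift c Y) x"
      using field_rep_lift[OF c c', of p Y] U c' by (auto simp: Tr_def)
  qed
qed

section \<open>Algebra and locality of smooth fields and functions, and the bracket of coordinate
  fields\<close>

lemma vector_field_rep_smooth:
  "vector_field A U X \<Longrightarrow> c \<in> A \<Longrightarrow> smooth_on (field_rep A c X) (chart_map c ` (U \<inter> chart_dom c))"
  by (simp add: vector_field_def)

lemma vector_field_subset:
  assumes "vector_field A U X" "V \<subseteq> U"
  shows "vector_field A V X"
  unfolding vector_field_def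
proof
  fix c assume "c \<in> A"
  from vector_field_rep_smooth[OF assms(1) this] show "smooth_on (field_rep A c X) (chart_map c ` (V \<inter> chart_dom c))"
    by (rule smooth_on_subset) (use assms in auto)
qed

lemma vector_field_local:
  assumes "\<And>p. p \<in> U \<Longrightarrow> \<exists>N. open N \<and> p \<in> N \<and> vector_field A N X"
  shows "vector_field A U X"
  unfolding vector_field_def
proof
  fix c assume c: "c \<in> A"
  show "smooth_on (field_rep A c X) (chart_map c ` (U \<inter> chart_dom c))"
  proof (rule smooth_on_local)
    fix x assume "x \<in> chart_map c ` (U \<inter> chart_dom c)"
    then obtain p where p: "p \<in> U" "p \<in> chart_dom c" "x = chart_map c p" by auto
    obtain N where N: "open N" "p \<in> N" "vector_field A N X" using assms[OF p(1)] by blast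
    show "\<exists>N. open N \<and> x \<in> N \<and> smooth_on (field_rep A c X) N"
      using open_chart_image[OF c N(1)] vector_field_rep_smooth[OF N(3) c] p N(2) by blast
  qed
qed

lemma vector_field_cong:
  assumes "open U" "\<And>q. q \<in> U \<Longrightarrow> X q = Y q" "vector_field A U X"
  shows "vector_field A U Y"
  unfolding vector_field_def
proof
  fix c assume c: "c \<in> A"
  show "smooth_on (field_rep A c Y) (chart_map c ` (U \<inter> chart_dom c))"
    by (rule smooth_on_cong[OF open_chart_image[OF c assms(1)] _ vector_field_rep_smooth[OF assms(3) c]])
       (use assms(2) in_chart_image[OF c] in \<open>auto simp: field_rep_eq\<close>)
qed

lemma smooth_fun_has_mderiv:
  assumes "smooth_fun A U f" "open U" "p \<in> U"
  shows "has_mderiv f p (mdiff A f p)"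
proof -
  have "f \<circ> chart_inv (chart_at A p) differentiable (at (chart_map (chart_at A p) p))"
    using assms(1,3) chart_at[of p] unfolding smooth_fun_def by (blast intro: smooth_on_differentiable)
  then show ?thesis
    unfolding has_mderiv_def mdiff_def[abs_def] using frechet_derivative_works by blast
qed

lemma smooth_fun_mdiff_field:
  assumes f: "smooth_fun A U f" and U: "open U" and X: "vector_field A U X"
  shows "smooth_fun A U (\<lambda>q. mdiff A f q (X q))"
  unfolding smooth_fun_def
proof
  fix c assume c: "c \<in> A"
  let ?S = "chart_map c ` (U \<inter> chart_dom c)"
  have S: "open ?S" by (rule open_chart_image[OF c U])
  have fs: "smooth_on (f \<circ> chart_inv c) ?S" using f c by (simp add: smooth_fun_def)
  have "smooth_on (\<lambda>x. frechet_derivative (f \<circ> chart_inv c) (at x) (field_rep A c X x)) ?S"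
    by (rule smooth_on_apply_linear[OF S _ smooth_on_frechet_derivative[OF fs] vector_field_rep_smooth[OF X c]])
       (rule linear_frechet_derivative[OF smooth_on_differentiable[OF fs]])
  then show "smooth_on ((\<lambda>q. mdiff A f q (X q)) \<circ> chart_inv c) ?S"
  proof (rule smooth_on_cong[OF S, rotated])
    fix x assume "x \<in> ?S"
    then obtain p where p: "p \<in> U" "p \<in> chart_dom c" "x = chart_map c p" by auto
    have "((f \<circ> chart_inv c) has_derivative (\<lambda>v. mdiff A f p (Tr c (chart_at A p) p v))) (at x)"
      unfolding p(3) by (rule has_mderivD[OF c p(2) smooth_fun_has_mderiv[OF f U p(1)]])
    from frechet_derivative_at[OF this, symmetric]
    show "frechet_derivative (f \<circ> chart_inv c) (at x) (field_rep A c X x) = ((\<lambda>q. mdiff A f q (X q)) \<circ> chart_inv c) x"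
      using p c field_from_rep[OF c p(2), of X] by simp
  qed
qed

text \<open>The fields are constant in \<open>c\<close>, but the bracket is computed in the
  preferred chart at \<open>p\<close>. There the two terms are second derivatives of a transition
  map in the two possible orders, which agree for holomorphic maps.\<close>

lemma lie_bracket_lift_const:
  assumes c: "c \<in> A" and p: "p \<in> chart_dom c"
  shows "lie_bracket A (lift c (\<lambda>_. v)) (lift c (\<lambda>_. w)) p = 0"
proof -
  let ?c = "chart_at A p"
  let ?\<tau> = "chart_map ?c \<circ> chart_inv c" and ?\<sigma> = "chart_map c \<circ> chart_inv ?c"
  let ?S = "chart_map ?c ` (chart_dom c \<inter> chart_dom ?c)" and ?T = "chart_map c ` (chart_dom ?c \<inter> chart_dom c)"
  have c': "?c \<in> A" "p \<in> chart_dom ?c" by (rule chart_at)+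
  have S: "open ?S" "chart_map ?c p \<in> ?S" using open_chart_image c c' chart p by auto
  have T: "open ?T" "chart_map c p \<in> ?T" using open_chart_image c c' chart p by auto
  have \<sigma>p: "?\<sigma> (chart_map ?c p) = chart_map c p" using c' by simp
  have *: "frechet_derivative (field_rep A ?c (lift c (\<lambda>_. w))) (at (chart_map ?c p)) (lift c (\<lambda>_. v) p) =
      frechet_derivative (\<lambda>y. frechet_derivative ?\<tau> (at y) w) (at (chart_map c p)) v" for v w
  proof -
    have "((\<lambda>y. frechet_derivative ?\<tau> (at y) w) has_derivative
        frechet_derivative (\<lambda>y. frechet_derivative ?\<tau> (at y) w) (at (chart_map c p))) (at (?\<sigma> (chart_map ?c p)))"
      unfolding \<sigma>p
      by (rule smooth_on_has_derivative[OF smooth_on_frechet_derivative[OF smooth_transition[OF c c'(1)]] T(2)])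
    from has_derivative_compose[OF Tr_deriv(1)[OF c'(1) c c'(2) p] this]
    have "((\<lambda>x. frechet_derivative ?\<tau> (at (?\<sigma> x)) w) has_derivative
      (\<lambda>u. frechet_derivative (\<lambda>y. frechet_derivative ?\<tau> (at y) w) (at (chart_map c p)) (Tr ?c c p u))) (at (chart_map ?c p))" .
    then have "(field_rep A ?c (lift c (\<lambda>_. w)) has_derivative
      (\<lambda>u. frechet_derivative (\<lambda>y. frechet_derivative ?\<tau> (at y) w) (at (chart_map c p)) (Tr ?c c p u))) (at (chart_map ?c p))"
    proof (rule has_derivative_transform_within_open[OF _ S])
      fix x assume "x \<in> ?S"
      then obtain q where q: "q \<in> chart_dom c" "q \<in> chart_dom ?c" "x = chart_map ?c q" by auto
      then show "frechet_derivative ?\<tau> (at (?\<sigma> x)) w = field_rep A ?c (lift c (\<lambda>_. w)) x"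
        using field_rep_lift[OF c c'(1) q(1,2)] c' by (simp add: Tr_def)
    qed
    from frechet_derivative_at[OF this, symmetric]
    show ?thesis using Tr_inverse[OF c c'(1) p c'(2)] by (simp add: lift_def)
  qed
  show ?thesis
    unfolding lie_bracket_def Let_def *
    using J.hol_second_derivative_symmetric[OF T(1) hol_transition[OF c c'(1)] T(2)] by simp
qed

lemma has_mderiv_zero_imp_constant:
  fixes f :: "'m \<Rightarrow> 'b::real_normed_vector"
  assumes "\<And>p. p \<in> U \<Longrightarrow> has_mderiv f p (\<lambda>v. 0)" "open U" "connected U" "p \<in> U" "q \<in> U"
  shows "f p = f q"
proof (rule connected_local_const[OF assms(3,4,5)], intro ballI)
  fix p assume p: "p \<in> U"
  let ?c = "chart_at A p"
  have c: "?c \<in> A" "p \<in> chart_dom ?c" by (rule chart_at)+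
  have "open (chart_map ?c ` (U \<inter> chart_dom ?c))" "chart_map ?c p \<in> chart_map ?c ` (U \<inter> chart_dom ?c)"
    using open_chart_image[OF c(1) assms(2)] c p by auto
  then obtain r where r: "r > 0" "ball (chart_map ?c p) r \<subseteq> chart_map ?c ` (U \<inter> chart_dom ?c)"
    using open_contains_ball by blast
  let ?B = "ball (chart_map ?c p) r" let ?N = "chart_dom ?c \<inter> chart_map ?c -` ?B"
  have "f q = f p" if q: "q \<in> ?N" for q
  proof -
    have "(f \<circ> chart_inv ?c) (chart_map ?c q) = (f \<circ> chart_inv ?c) (chart_map ?c p)"
    proof (rule has_derivative_zero_unique[of ?B "f \<circ> chart_inv ?c"])
      fix x assume x: "x \<in> ?B"
      then obtain y where y: "y \<in> U" "y \<in> chart_dom ?c" "x = chart_map ?c y" using r(2) by blast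
      have "((f \<circ> chart_inv ?c) has_derivative (\<lambda>h. 0)) (at (chart_map ?c y))"
        using has_mderivD[OF c(1) y(2) assms(1)[OF y(1)]] .
      then show "((f \<circ> chart_inv ?c) has_derivative (\<lambda>h. 0)) (at x within ?B)"
        unfolding y(3) by (rule has_derivative_at_withinI)
    qed (use q r(1) in auto)
    then show ?thesis using q c by simp
  qed
  moreover have "open ?N" "p \<in> ?N" using open_chart_preimage[OF c(1)] c r(1) by auto
  ultimately show "\<forall>\<^sub>F q in at p within U. f p = f q"
    unfolding eventually_at_topological by metis
qed

lemma connected_neighbourhood:
  fixes p :: 'm
  assumes "open U" "p \<in> U"
  obtains N where "open N" "path_connected N" "p \<in> N" "N \<subseteq> U"
proof -
  let ?c = "chart_at A p"
  have c: "?c \<in> A" "p \<in> chart_dom ?c" by (rule chart_at)+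
  have "open (chart_map ?c ` (U \<inter> chart_dom ?c))" "chart_map ?c p \<in> chart_map ?c ` (U \<inter> chart_dom ?c)"
    using open_chart_image[OF c(1) assms(1)] c assms by auto
  then obtain r where r: "r > 0" "ball (chart_map ?c p) r \<subseteq> chart_map ?c ` (U \<inter> chart_dom ?c)"
    using open_contains_ball by blast
  let ?B = "ball (chart_map ?c p) r"
  have eq: "chart_inv ?c ` ?B = chart_dom ?c \<inter> chart_map ?c -` ?B"
  proof
    show "chart_inv ?c ` ?B \<subseteq> chart_dom ?c \<inter> chart_map ?c -` ?B" using r(2) c by fastforce
    show "chart_dom ?c \<inter> chart_map ?c -` ?B \<subseteq> chart_inv ?c ` ?B"
    proof
      fix q assume "q \<in> chart_dom ?c \<inter> chart_map ?c -` ?B"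
      then show "q \<in> chart_inv ?c ` ?B" using c by (intro image_eqI[of _ _ "chart_map ?c q"]) auto
    qed
  qed
  show thesis
  proof
    show "open (chart_inv ?c ` ?B)" unfolding eq by (rule open_chart_preimage[OF c(1)]) simp
    show "path_connected (chart_inv ?c ` ?B)"
      by (rule path_connected_continuous_image[OF continuous_on_subset[OF chart(4)[OF c(1)]]])
         (use r(2) in \<open>auto intro: convex_imp_path_connected\<close>)
    show "p \<in> chart_inv ?c ` ?B" unfolding eq using c r(1) by simp
    show "chart_inv ?c ` ?B \<subseteq> U" using r(2) c by fastforce
  qed
qed

lemma vector_field_add:
  assumes "open U" "vector_field A U X" "vector_field A U Y"
  shows "vector_field A U (\<lambda>q. X q + Y q)"
  unfolding vector_field_def
proof
  fix c assume c: "c \<in> A"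
  have S: "open (chart_map c ` (U \<inter> chart_dom c))" by (rule open_chart_image[OF c assms(1)])
  show "smooth_on (field_rep A c (\<lambda>q. X q + Y q)) (chart_map c ` (U \<inter> chart_dom c))"
  proof (rule smooth_on_cong[OF S _ smooth_on_add[OF S vector_field_rep_smooth[OF assms(2) c] vector_field_rep_smooth[OF assms(3) c]]])
    fix x assume "x \<in> chart_map c ` (U \<inter> chart_dom c)"
    then obtain p where p: "p \<in> U" "p \<in> chart_dom c" "x = chart_map c p" by auto
    show "field_rep A c X x + field_rep A c Y x = field_rep A c (\<lambda>q. X q + Y q) x"
      using linear_add[OF Tr_linear[OF chart_at(1) c chart_at(2) p(2)]] p c by (simp add: field_rep_chart)
  qed
qed

lemma vector_field_scale:
  fixes f :: "'m \<Rightarrow> real"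
  assumes "open U" "smooth_fun A U f" "vector_field A U Y"
  shows "vector_field A U (\<lambda>q. f q *\<^sub>R Y q)"
  unfolding vector_field_def
proof
  fix c assume c: "c \<in> A"
  have S: "open (chart_map c ` (U \<inter> chart_dom c))" by (rule open_chart_image[OF c assms(1)])
  have f: "smooth_on (f \<circ> chart_inv c) (chart_map c ` (U \<inter> chart_dom c))" using assms(2) c by (simp add: smooth_fun_def)
  show "smooth_on (field_rep A c (\<lambda>q. f q *\<^sub>R Y q)) (chart_map c ` (U \<inter> chart_dom c))"
  proof (rule smooth_on_cong[OF S _ smooth_on_scaleR[OF S f vector_field_rep_smooth[OF assms(3) c]]])
    fix x assume "x \<in> chart_map c ` (U \<inter> chart_dom c)"
    then obtain p where p: "p \<in> U" "p \<in> chart_dom c" "x = chart_map c p" by auto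
    show "(f \<circ> chart_inv c) x *\<^sub>R field_rep A c Y x = field_rep A c (\<lambda>q. f q *\<^sub>R Y q) x"
      using linear_scale[OF Tr_linear[OF chart_at(1) c chart_at(2) p(2)]] p c by (simp add: field_rep_chart)
  qed
qed

lemma smooth_fun_const [simp]: "smooth_fun A U (\<lambda>q. k)"
  by (simp add: smooth_fun_def o_def)

lemma has_mderiv_const: "has_mderiv (\<lambda>q. k) p (\<lambda>v. 0)"
  by (simp add: has_mderiv_def o_def)

lemma vector_field_zero:
  shows "vector_field A U (\<lambda>q. 0)"
  unfolding vector_field_def
proof
  fix c assume c: "c \<in> A"
  have "smooth_on (field_rep A c (\<lambda>q. 0)) (img c)"
  proof (rule smooth_on_cong[OF chart(2)[OF c] _ smooth_on_const[of 0]])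
    show "0 = field_rep A c (\<lambda>q. 0) x" if "x \<in> img c" for x
      using that linear_0[OF Tr_linear[OF chart_at(1) c chart_at(2)]] c by (auto simp: field_rep_chart)
  qed
  then show "smooth_on (field_rep A c (\<lambda>q. 0)) (chart_map c ` (U \<inter> chart_dom c))"
    by (rule smooth_on_subset) auto
qed

end

section \<open>Flat torsionfree connections\<close>

locale flat_manifold = atlas A for A :: "('m::topological_space, 'n::finite) chart set" +
  fixes nabla :: "('m, 'n) conn"
  assumes connection: "connection A nabla" and flat: "flat A nabla" and torsion_free: "torsion_free A nabla"
begin

lemmas connectionD = connection[unfolded connection_def, rule_format]

lemma nabla_linear: "open U \<Longrightarrow> vector_field A U Y \<Longrightarrow> p \<in> U \<Longrightarrow> linear (\<lambda>v. nabla p v Y)"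
  using connectionD by simp

lemma nabla_smooth:
  "open U \<Longrightarrow> vector_field A U Y \<Longrightarrow> vector_field A U X \<Longrightarrow> vector_field A U (\<lambda>q. nabla q (X q) Y)"
  using connectionD by simp

lemma nabla_add: "open U \<Longrightarrow> vector_field A U Y \<Longrightarrow> vector_field A U Z \<Longrightarrow> p \<in> U \<Longrightarrow>
    nabla p v (\<lambda>q. Y q + Z q) = nabla p v Y + nabla p v Z"
  using connectionD by simp

lemma nabla_scale:
  fixes f :: "'m \<Rightarrow> real"
  shows "open U \<Longrightarrow> vector_field A U Y \<Longrightarrow> smooth_fun A U f \<Longrightarrow> p \<in> U \<Longrightarrow>
    nabla p v (\<lambda>q. f q *\<^sub>R Y q) = mdiff A f p v *\<^sub>R Y p + f p *\<^sub>R nabla p v Y"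
  using connectionD by simp

lemma nabla_cong: "open U \<Longrightarrow> vector_field A U Y \<Longrightarrow> (\<And>q. q \<in> U \<Longrightarrow> Y q = Z q) \<Longrightarrow> p \<in> U \<Longrightarrow>
    nabla p v Y = nabla p v Z"
  using connectionD by simp

lemma nabla_zero: "nabla p v (\<lambda>q. 0) = 0"
  using nabla_add[OF open_UNIV vector_field_zero vector_field_zero UNIV_I, of p v] by simp

lemma nabla_scale_const:
  "open U \<Longrightarrow> vector_field A U Y \<Longrightarrow> p \<in> U \<Longrightarrow> nabla p v (\<lambda>q. r *\<^sub>R Y q) = r *\<^sub>R nabla p v Y"
  using nabla_scale[of U Y "\<lambda>_. r" p v] mdiff_eq[OF has_mderiv_const[of r p]] by simp

text \<open>Smoothness of the partial sums belongs to the claim because additivity of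
  \<open>nabla\<close> presupposes it in the induction.\<close>

lemma nabla_sum:
  fixes f :: "'i \<Rightarrow> 'm \<Rightarrow> real"
  assumes U: "open U" "p \<in> U" and "finite I"
    and "\<And>i. i \<in> I \<Longrightarrow> smooth_fun A U (f i)" "\<And>i. i \<in> I \<Longrightarrow> vector_field A U (Y i)"
  shows "vector_field A U (\<lambda>q. \<Sum>i\<in>I. f i q *\<^sub>R Y i q) \<and> nabla p v (\<lambda>q. \<Sum>i\<in>I. f i q *\<^sub>R Y i q) =
    (\<Sum>i\<in>I. mdiff A (f i) p v *\<^sub>R Y i p + f i p *\<^sub>R nabla p v (Y i))"
  using assms(3-5)
proof (induction I rule: finite_induct)
  case empty
  then show ?case by (simp add: vector_field_zero nabla_zero)
next
  case (insert i I)
  have 1: "vector_field A U (\<lambda>q. f i q *\<^sub>R Y i q)"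
    by (rule vector_field_scale[OF U(1)]) (use insert in auto)
  have 2: "nabla p v (\<lambda>q. f i q *\<^sub>R Y i q) = mdiff A (f i) p v *\<^sub>R Y i p + f i p *\<^sub>R nabla p v (Y i)"
    by (rule nabla_scale[OF U(1)]) (use insert U in auto)
  have 3: "vector_field A U (\<lambda>q. \<Sum>i\<in>I. f i q *\<^sub>R Y i q)" "nabla p v (\<lambda>q. \<Sum>i\<in>I. f i q *\<^sub>R Y i q) =
    (\<Sum>i\<in>I. mdiff A (f i) p v *\<^sub>R Y i p + f i p *\<^sub>R nabla p v (Y i))"
    using insert by auto
  show ?case
    using vector_field_add[OF U(1) 1 3(1)] nabla_add[OF U(1) 1 3(1) U(2), of v] insert(1,2)
    by (simp add: 2 3(2))
qed

subsection \<open>The connection in a chart\<close>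

abbreviation cfield :: "('m, 'n) chart \<Rightarrow> complex^'n \<Rightarrow> 'm \<Rightarrow> complex^'n" where
  "cfield c v \<equiv> lift c (\<lambda>_. v)"

lemma vector_field_cfield: "c \<in> A \<Longrightarrow> vector_field A (chart_dom c) (cfield c v)"
  by (rule vector_field_lift) (auto intro: chart)

text \<open>The Christoffel symbols in the chart \<open>c\<close>, with \<open>v\<close> as
  direction and \<open>w\<close> as the differentiated coordinate field.\<close>

definition \<Gamma> :: "('m, 'n) chart \<Rightarrow> complex^'n \<Rightarrow> complex^'n \<Rightarrow> complex^'n \<Rightarrow> complex^'n" where
  "\<Gamma> c x v w = field_rep A c (\<lambda>q. nabla q (cfield c v q) (cfield c w)) x"

lemma Gam_eq:
  assumes "c \<in> A" "p \<in> chart_dom c"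
  shows "\<Gamma> c (chart_map c p) v w = Tr (chart_at A p) c p (nabla p (Tr c (chart_at A p) p v) (cfield c w))"
  using assms by (simp add: \<Gamma>_def field_rep_chart lift_def)

lemma Gam_linear:
  assumes c: "c \<in> A" and x: "x \<in> img c"
  shows "linear (\<lambda>v. \<Gamma> c x v w)" "linear (\<Gamma> c x v)"
proof -
  obtain p where p: "p \<in> chart_dom c" "x = chart_map c p" using x by auto
  have T: "linear (Tr (chart_at A p) c p)" "linear (Tr c (chart_at A p) p)"
    using Tr_linear c chart_at p by auto
  have n: "linear (\<lambda>v. nabla p v (cfield c w))"
    by (rule nabla_linear[OF chart(1)[OF c] vector_field_cfield[OF c] p(1)])
  show "linear (\<lambda>v. \<Gamma> c x v w)"
    unfolding p(2) Gam_eq[OF c p(1)]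
    using linear_compose[OF linear_compose[OF T(2) n] T(1)] by (simp add: o_def)
  let ?v = "Tr c (chart_at A p) p v"
  have U: "open (chart_dom c)" by (rule chart(1)[OF c])
  note V = vector_field_cfield[OF c]
  have add: "nabla p ?v (cfield c (w + w')) = nabla p ?v (cfield c w) + nabla p ?v (cfield c w')" for w w'
  proof -
    have "nabla p ?v (\<lambda>q. cfield c w q + cfield c w' q) = nabla p ?v (cfield c w) + nabla p ?v (cfield c w')"
      by (rule nabla_add[OF U V V p(1)])
    \<comment> \<open>\<open>lift\<close> is additive only over the chart domain, so the locality of
      the connection is needed.\<close>
    moreover have "nabla p ?v (cfield c (w + w')) = nabla p ?v (\<lambda>q. cfield c w q + cfield c w' q)"
      by (rule nabla_cong[OF U V _ p(1)]) (simp add: lift_def linear_add[OF Tr_linear[OF c chart_at(1) _ chart_at(2)]])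
    ultimately show ?thesis by simp
  qed
  have scale: "nabla p ?v (cfield c (r *\<^sub>R w)) = r *\<^sub>R nabla p ?v (cfield c w)" for r w
  proof -
    have "nabla p ?v (\<lambda>q. r *\<^sub>R cfield c w q) = r *\<^sub>R nabla p ?v (cfield c w)"
      by (rule nabla_scale_const[OF U V p(1)])
    moreover have "nabla p ?v (cfield c (r *\<^sub>R w)) = nabla p ?v (\<lambda>q. r *\<^sub>R cfield c w q)"
      by (rule nabla_cong[OF U V _ p(1)]) (simp add: lift_def linear_scale[OF Tr_linear[OF c chart_at(1) _ chart_at(2)]])
    ultimately show ?thesis by simp
  qed
  show "linear (\<Gamma> c x v)"
    unfolding p(2)
    by (rule linearI) (simp_all add: Gam_eq[OF c p(1)] add scale linear_add[OF T(1)] linear_scale[OF T(1)])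
qed

lemma Gam_smooth:
  assumes c: "c \<in> A"
  shows "smooth_on (\<lambda>x. \<Gamma> c x v w) (img c)"
  using vector_field_rep_smooth[OF nabla_smooth[OF chart(1)[OF c] vector_field_cfield[OF c] vector_field_cfield[OF c]] c, of v w]
  by (simp add: \<Gamma>_def)

text \<open>Expanding the field in coordinate fields with smooth real coefficients reduces the
  formula to the Leibniz rule; locality of \<open>nabla\<close> restricts everything to the part of
  \<open>U\<close> inside the chart.\<close>

lemma nabla_in_chart:
  assumes c: "c \<in> A" and U: "open U" "p \<in> U" "p \<in> chart_dom c" and Y: "vector_field A U Y"
  shows "Tr (chart_at A p) c p (nabla p v Y) =
    frechet_derivative (field_rep A c Y) (at (chart_map c p)) (Tr (chart_at A p) c p v) +
    \<Gamma> c (chart_map c p) (Tr (chart_at A p) c p v) (field_rep A c Y (chart_map c p))"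
proof -
  let ?T = "Tr (chart_at A p) c p" and ?x = "chart_map c p" and ?U = "U \<inter> chart_dom c"
  have T: "linear ?T" using Tr_linear c chart_at U by auto
  have oU: "open ?U" "p \<in> ?U" using open_Int[OF U(1) chart(1)[OF c]] U by auto
  have S: "open (chart_map c ` ?U)" "?x \<in> chart_map c ` ?U"
    using open_chart_image[OF c U(1)] U by auto
  define f where "f b q = field_rep A c Y (chart_map c q) \<bullet> b" for b q
  have rep: "smooth_on (field_rep A c Y) (chart_map c ` ?U)" by (rule vector_field_rep_smooth[OF Y c])
  have rd: "(field_rep A c Y has_derivative frechet_derivative (field_rep A c Y) (at ?x)) (at ?x)"
    by (rule smooth_on_has_derivative[OF rep S(2)])
  have f_smooth: "smooth_fun A ?U (f b)" for b
    unfolding smooth_fun_def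
  proof
    fix c' assume c': "c' \<in> A"
    have "smooth_on (\<lambda>x. field_rep A c Y ((chart_map c \<circ> chart_inv c') x)) (chart_map c' ` (?U \<inter> chart_dom c'))"
      by (rule smooth_on_compose[OF open_chart_image[OF c' oU(1)] S(1) _ rep smooth_on_subset[OF smooth_transition[OF c' c]]])
         (use c' in auto)
    from smooth_on_bounded_linear[OF open_chart_image[OF c' oU(1)] bounded_linear_inner_left this, of b]
    show "smooth_on (f b \<circ> chart_inv c') (chart_map c' ` (?U \<inter> chart_dom c'))"
      by (simp add: f_def o_def)
  qed
  have df: "mdiff A (f b) p v = frechet_derivative (field_rep A c Y) (at ?x) (?T v) \<bullet> b" for b
  proof -
    have "((\<lambda>x. field_rep A c Y x \<bullet> b) has_derivative (\<lambda>v. frechet_derivative (field_rep A c Y) (at ?x) v \<bullet> b)) (at ?x)"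
      by (rule has_derivative_inner_left[OF rd])
    then have "(f b \<circ> chart_inv c has_derivative (\<lambda>v. frechet_derivative (field_rep A c Y) (at ?x) v \<bullet> b)) (at ?x)"
      by (rule has_derivative_transform_within_open[OF _ S]) (use c in \<open>auto simp: f_def\<close>)
    from mdiff_eq[OF has_mderivI[OF c U(3) this]] show ?thesis by simp
  qed
  have Ycong: "Y q = (\<Sum>b\<in>Basis. f b q *\<^sub>R cfield c b q)" if "q \<in> ?U" for q
    using linear_sum_Basis[OF Tr_linear[OF c chart_at(1) _ chart_at(2)], of q "field_rep A c Y (chart_map c q)"]
      field_from_rep[OF c, of q Y] that by (simp add: f_def lift_def)
  have VF: "vector_field A ?U (cfield c b)" for b
    by (rule vector_field_subset[OF vector_field_cfield[OF c]]) simp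
  have "nabla p v Y = nabla p v (\<lambda>q. \<Sum>b\<in>Basis. f b q *\<^sub>R cfield c b q)"
    by (rule nabla_cong[OF oU(1) vector_field_subset[OF Y] Ycong oU(2)]) auto
  also have "\<dots> = (\<Sum>b\<in>Basis. mdiff A (f b) p v *\<^sub>R cfield c b p + f b p *\<^sub>R nabla p v (cfield c b))"
    using nabla_sum[OF oU finite_Basis, of f "cfield c" v] f_smooth VF by simp
  finally have "?T (nabla p v Y) = (\<Sum>b\<in>Basis. mdiff A (f b) p v *\<^sub>R ?T (cfield c b p) + f b p *\<^sub>R ?T (nabla p v (cfield c b)))"
    by (simp add: linear_sum[OF T] linear_add[OF T] linear_scale[OF T])
  moreover have "?T (cfield c b p) = b" for b
    using Tr_inverse[OF c chart_at(1) U(3) chart_at(2)] by (simp add: lift_def)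
  moreover have "?T (nabla p v (cfield c b)) = \<Gamma> c ?x (?T v) b" for b
    using Tr_inverse[OF chart_at(1) c chart_at(2) U(3)] by (simp add: Gam_eq[OF c U(3)])
  ultimately have "?T (nabla p v Y) = (\<Sum>b\<in>Basis. (frechet_derivative (field_rep A c Y) (at ?x) (?T v) \<bullet> b) *\<^sub>R b) +
      (\<Sum>b\<in>Basis. (field_rep A c Y ?x \<bullet> b) *\<^sub>R \<Gamma> c ?x (?T v) b)"
    by (simp add: df f_def sum.distrib)
  then show ?thesis
    using linear_sum_Basis[OF Gam_linear(2)[OF c], of ?x "?T v" "field_rep A c Y ?x"] U(3)
    by (simp add: euclidean_representation)
qed

text \<open>Coordinate fields commute, so vanishing torsion leaves only the two covariant
  derivatives.\<close>

lemma Gam_symmetric: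
  assumes c: "c \<in> A" and x: "x \<in> img c"
  shows "\<Gamma> c x v w = \<Gamma> c x w v"
proof -
  obtain p where p: "p \<in> chart_dom c" "x = chart_map c p" using x by auto
  have "nabla p (cfield c v p) (cfield c w) - nabla p (cfield c w p) (cfield c v) - lie_bracket A (cfield c v) (cfield c w) p = 0"
    using torsion_free chart(1)[OF c] vector_field_cfield[OF c] p(1) unfolding torsion_free_def by blast
  then have "nabla p (cfield c v p) (cfield c w) = nabla p (cfield c w p) (cfield c v)"
    using lie_bracket_lift_const[OF c p(1)] by simp
  then show ?thesis unfolding p(2) Gam_eq[OF c p(1)] by (simp add: lift_def)
qed

text \<open>This is the curvature on coordinate fields. The inner covariant derivative has
  coordinates \<open>\<Gamma> c x w z\<close>, so \<open>nabla_in_chart\<close> yields its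
  derivative plus a quadratic term, and the bracket term vanishes.\<close>

lemma Gam_flat:
  assumes c: "c \<in> A" and x: "x \<in> img c"
  shows "frechet_derivative (\<lambda>x. \<Gamma> c x w z) (at x) v - frechet_derivative (\<lambda>x. \<Gamma> c x v z) (at x) w +
    \<Gamma> c x v (\<Gamma> c x w z) - \<Gamma> c x w (\<Gamma> c x v z) = 0"
proof -
  obtain p where p: "p \<in> chart_dom c" "x = chart_map c p" using x by auto
  let ?T = "Tr (chart_at A p) c p"
  have T: "linear ?T" using Tr_linear c chart_at p by auto
  have U: "open (chart_dom c)" by (rule chart(1)[OF c])
  note V = vector_field_cfield[OF c]
  define W where "W w q = nabla q (cfield c w q) (cfield c z)" for w q
  have W: "vector_field A (chart_dom c) (W w)" for w
    unfolding W_def by (rule nabla_smooth[OF U V V])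
  have repW: "field_rep A c (W w) = (\<lambda>x. \<Gamma> c x w z)" for w
    by (simp add: \<Gamma>_def W_def[abs_def])
  have TW: "?T (nabla p (cfield c v p) (W w)) =
      frechet_derivative (\<lambda>x. \<Gamma> c x w z) (at x) v + \<Gamma> c x v (\<Gamma> c x w z)" for v w
    using nabla_in_chart[OF c U p(1) p(1) W, of "cfield c v p" w] Tr_inverse[OF c chart_at(1) p(1) chart_at(2)]
    unfolding repW p(2) by (simp add: lift_def)
  have "nabla p (cfield c v p) (W w) - nabla p (cfield c w p) (W v)
      - nabla p (lie_bracket A (cfield c v) (cfield c w) p) (cfield c z) = 0"
    using flat U V p(1) unfolding flat_def W_def by blast
  moreover have "nabla p 0 (cfield c z) = 0" using linear_0[OF nabla_linear[OF U V p(1)]] .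
  ultimately have "?T (nabla p (cfield c v p) (W w)) = ?T (nabla p (cfield c w p) (W v))"
    using lie_bracket_lift_const[OF c p(1)] by simp
  then show ?thesis unfolding TW by (simp add: algebra_simps)
qed

end

section \<open>Parallel frames\<close>

context flat_manifold
begin

lemma Tr_eq_0_iff:
  assumes "c \<in> A" "c' \<in> A" "p \<in> chart_dom c" "p \<in> chart_dom c'"
  shows "Tr c c' p v = 0 \<longleftrightarrow> v = 0"
  using Tr_inverse[OF assms, of v] linear_0[OF Tr_linear[OF assms(2,1,4,3)]] linear_0[OF Tr_linear[OF assms]]
  by auto

definition parallel_frame :: "'m set \<Rightarrow> ('m \<Rightarrow> complex^'n \<Rightarrow> complex^'n) \<Rightarrow> bool" where
  "parallel_frame U Q \<longleftrightarrow> (\<forall>q\<in>U. linear (Q q) \<and> inj (Q q)) \<and> (\<forall>w. parallel_field A nabla U (\<lambda>q. Q q w))"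

lemma parallel_frame_subset: "parallel_frame U Q \<Longrightarrow> V \<subseteq> U \<Longrightarrow> parallel_frame V Q"
  unfolding parallel_frame_def parallel_field_def using vector_field_subset by (meson subsetD)

text \<open>Solving the parallel equation for each basis vector and extending linearly gives a
  matrix that is the identity at \<open>p\<close>, hence injective nearby. Precomposition with
  \<open>L\<close> allows any prescribed value, as needed for continuation along paths.\<close>

lemma parallel_frame_exists:
  assumes L: "linear L" "inj L"
  shows "\<exists>U Q. open U \<and> p \<in> U \<and> parallel_frame U Q \<and> Q p = L"
proof -
  let ?c = "chart_at A p" let ?x = "chart_map ?c p"
  have c: "?c \<in> A" "p \<in> chart_dom ?c" by (rule chart_at)+
  have x: "?x \<in> img ?c" using c by simp
  obtain r where r: "r > 0" "ball ?x r \<subseteq> img ?c" and ex: "\<forall>z0. \<exists>Z. Z ?x = z0 \<and>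
    (\<forall>x\<in>ball ?x r. (Z has_derivative (\<lambda>v. - \<Gamma> ?c x v (Z x))) (at x)) \<and> smooth_on Z (ball ?x r)"
    using flat_system_solvable[of "img ?c" ?x "\<Gamma> ?c", OF chart(2)[OF c(1)] x Gam_linear[OF c(1)] Gam_smooth[OF c(1)] Gam_flat[OF c(1)]]
    by blast
  obtain Z where Z: "\<And>z0. Z z0 ?x = z0" "\<And>z0. smooth_on (Z z0) (ball ?x r)"
    "\<And>z0 x. x \<in> ball ?x r \<Longrightarrow> (Z z0 has_derivative (\<lambda>v. - \<Gamma> ?c x v (Z z0 x))) (at x)"
    using choice[OF ex] by blast
  define P where "P x w = (\<Sum>b\<in>Basis. (w \<bullet> b) *\<^sub>R Z b x)" for x w
  have P_lin: "linear (P x)" for x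
    unfolding P_def by (rule linearI) (simp_all add: inner_add_left scaleR_add_left sum.distrib scaleR_sum_right)
  have P_x: "P ?x w = w" for w by (simp add: P_def Z(1) euclidean_representation)
  have P_smooth: "smooth_on (\<lambda>x. P x w) (ball ?x r)" for w
    unfolding P_def by (intro smooth_on_sum smooth_on_scaleR open_ball finite_Basis smooth_on_const Z(2))
  have P_deriv: "((\<lambda>x. P x w) has_derivative (\<lambda>v. - \<Gamma> ?c x v (P x w))) (at x)" if "x \<in> ball ?x r" for x w
  proof -
    have "((\<lambda>x. P x w) has_derivative (\<lambda>v. \<Sum>b\<in>Basis. (w \<bullet> b) *\<^sub>R (- \<Gamma> ?c x v (Z b x)))) (at x)"
      unfolding P_def by (intro has_derivative_sum has_derivative_scaleR_right Z(3) that)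
    moreover have G: "linear (\<Gamma> ?c x v)" for v using Gam_linear(2)[OF c(1)] r(2) that by blast
    have "(\<Sum>b\<in>Basis. (w \<bullet> b) *\<^sub>R (- \<Gamma> ?c x v (Z b x))) = - \<Gamma> ?c x v (P x w)" for v
      by (simp add: P_def linear_sum[OF G] linear_scale[OF G] sum_negf)
    ultimately show ?thesis by simp
  qed
  \<comment> \<open>Summed over the basis, errors below \<open>e\<close> move \<open>w\<close> by at
    most half its norm, so \<open>P x w\<close> cannot vanish unless \<open>w\<close> does.\<close>
  define e where "e = 1 / (2 * real DIM(complex^'n))"
  have e: "e > 0" by (simp add: e_def)
  have "\<forall>\<^sub>F x in nhds ?x. \<forall>b\<in>Basis. dist (Z b x) b < e"
  proof (rule eventually_ball_finite[OF finite_Basis], intro ballI)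
    fix b :: "complex^'n"
    have "isCont (Z b) ?x" using has_derivative_continuous[OF Z(3)] r(1) by simp
    then have "Z b \<midarrow>?x\<rightarrow> b" using Z(1)[of b] by (simp add: isCont_def)
    from tendstoD[OF this e] have "\<forall>\<^sub>F x in at ?x. dist (Z b x) b < e" .
    then show "\<forall>\<^sub>F x in nhds ?x. dist (Z b x) b < e"
      unfolding eventually_nhds_conv_at using Z(1)[of b] e by simp
  qed
  then obtain r' where r': "r' > 0" "\<And>x b. dist x ?x < r' \<Longrightarrow> b \<in> Basis \<Longrightarrow> dist (Z b x) b < e"
    unfolding eventually_nhds_metric by blast
  define s where "s = min r r'"
  have s: "s > 0" "ball ?x s \<subseteq> ball ?x r" using r r' by (auto simp: s_def)
  have P_inj: "inj (P x)" if "x \<in> ball ?x s" for x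
  proof -
    have "w = 0" if w: "P x w = 0" for w
    proof -
      have "norm (P x w - w) = norm (\<Sum>b\<in>Basis. (w \<bullet> b) *\<^sub>R (Z b x - b))"
        by (simp add: P_def scaleR_diff_right sum_subtractf euclidean_representation)
      also have "\<dots> \<le> (\<Sum>b\<in>(Basis::(complex^'n) set). norm w * e)"
      proof (rule sum_norm_le)
        fix b :: "complex^'n" assume b: "b \<in> Basis"
        have "dist x ?x < r'" using \<open>x \<in> ball ?x s\<close> by (simp add: s_def dist_commute)
        from r'(2)[OF this b] show "norm ((w \<bullet> b) *\<^sub>R (Z b x - b)) \<le> norm w * e"
          using Basis_le_norm[OF b, of w] by (auto simp: dist_norm intro!: mult_mono)
      qed
      also have "\<dots> = norm w / 2" by (simp add: e_def)
      finally show ?thesis using w by simp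
    qed
    then show ?thesis using linear_injective_0[OF P_lin] by blast
  qed
  define U where "U = chart_dom ?c \<inter> chart_map ?c -` ball ?x s"
  have U: "open U" "p \<in> U" "U \<subseteq> chart_dom ?c" "chart_map ?c ` U \<subseteq> ball ?x s"
    using open_chart_preimage[OF c(1), of "ball ?x s"] c s by (auto simp: U_def)
  define Q where "Q q w = lift ?c (\<lambda>x. P x (L w)) q" for q w
  have T: "linear (Tr ?c (chart_at A q) q)" "linear (Tr (chart_at A q) ?c q)" if "q \<in> U" for q
    using Tr_linear[OF c(1) chart_at(1) subsetD[OF U(3) that] chart_at(2)]
      Tr_linear[OF chart_at(1) c(1) chart_at(2) subsetD[OF U(3) that]] by simp_all
  have "Q p w = L w" for w
    using Tr_id[OF c] by (simp add: Q_def lift_def P_x)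
  moreover have "parallel_frame U Q"
    unfolding parallel_frame_def
  proof (intro conjI ballI allI)
    fix q assume q: "q \<in> U"
    show "linear (Q q)"
      unfolding Q_def lift_def
      using linear_compose[OF linear_compose[OF L(1) P_lin] T(1)[OF q]] by (simp add: o_def)
    show "inj (Q q)"
    proof (rule injI)
      fix v w assume "Q q v = Q q w"
      then have "P (chart_map ?c q) (L v) = P (chart_map ?c q) (L w)"
        using Tr_inverse[OF c(1) chart_at(1) _ chart_at(2)] q U unfolding Q_def lift_def by (metis subsetD)
      moreover have "chart_map ?c q \<in> ball ?x s" using U(4) q by blast
      ultimately show "v = w" using P_inj injD[OF L(2)] injD by metis
    qed
  next
    fix w
    have vf: "vector_field A U (\<lambda>q. Q q w)"
      unfolding Q_def
      by (rule vector_field_lift[OF c(1) U(1,3) smooth_on_subset[OF P_smooth]]) (use U s in blast)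
    have "nabla q v (\<lambda>q. Q q w) = 0" if q: "q \<in> U" for q v
    proof -
      have qc: "q \<in> chart_dom ?c" "chart_map ?c q \<in> ball ?x r" using U s q by blast+
      have rep: "field_rep A ?c (\<lambda>q. Q q w) x = P x (L w)" if "x \<in> img ?c" for x
        unfolding Q_def by (rule field_rep_lift_same[OF c(1) that])
      have "(field_rep A ?c (\<lambda>q. Q q w) has_derivative (\<lambda>v. - \<Gamma> ?c (chart_map ?c q) v (P (chart_map ?c q) (L w)))) (at (chart_map ?c q))"
        by (rule has_derivative_transform_within_open[OF P_deriv[OF qc(2)] chart(2)[OF c(1)]])
           (use rep qc in auto)
      from frechet_derivative_at[OF this, symmetric]
      have "Tr (chart_at A q) ?c q (nabla q v (\<lambda>q. Q q w)) = 0"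
        using nabla_in_chart[OF c(1) U(1) q qc(1) vf, of v] rep qc(1) by simp
      then show ?thesis using Tr_eq_0_iff[OF chart_at(1) c(1) chart_at(2) qc(1)] by blast
    qed
    with vf show "parallel_field A nabla U (\<lambda>q. Q q w)" by (simp add: parallel_field_def)
  qed
  ultimately show ?thesis using U by blast
qed

lemma parallel_frame_inverse:
  assumes "parallel_frame U Q" "q \<in> U"
  shows "Q q (inv (Q q) u) = u" "inv (Q q) (Q q u) = u" "linear (inv (Q q))"
proof -
  have Q: "linear (Q q)" "inj (Q q)" using assms by (auto simp: parallel_frame_def)
  show 1: "Q q (inv (Q q) u) = u" for u
    by (rule surj_f_inv_f[OF linear_injective_imp_surjective[OF Q refl]])
  show 2: "inv (Q q) (Q q u) = u" using Q by simp
  show "linear (inv (Q q))"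
    by (rule linearI; rule injD[OF Q(2)]) (simp_all add: 1 linear_add[OF Q(1)] linear_scale[OF Q(1)])
qed

lemma parallel_rep_derivative:
  assumes X: "parallel_field A nabla U X" and U: "open U" "p \<in> U" and c: "c \<in> A" "p \<in> chart_dom c"
  shows "(field_rep A c X has_derivative (\<lambda>v. - \<Gamma> c (chart_map c p) v (field_rep A c X (chart_map c p)))) (at (chart_map c p))"
proof -
  let ?P = "field_rep A c X" let ?x = "chart_map c p"
  have vf: "vector_field A U X" and par: "nabla p v X = 0" for v
    using X U(2) by (auto simp: parallel_field_def)
  have d: "(?P has_derivative frechet_derivative ?P (at ?x)) (at ?x)"
    by (rule smooth_on_has_derivative[OF vector_field_rep_smooth[OF vf c(1)]]) (use c U in auto)
  have "frechet_derivative ?P (at ?x) v = - \<Gamma> c ?x v (?P ?x)" for v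
  proof -
    have "0 = frechet_derivative ?P (at ?x) v + \<Gamma> c ?x v (?P ?x)"
      using nabla_in_chart[OF c(1) U c(2) vf, of "Tr c (chart_at A p) p v"]
        par linear_0[OF Tr_linear[OF chart_at(1) c(1) chart_at(2) c(2)]]
        Tr_inverse[OF c(1) chart_at(1) c(2) chart_at(2)] by simp
    then show ?thesis by (simp add: eq_neg_iff_add_eq_0)
  qed
  then have "frechet_derivative ?P (at ?x) = (\<lambda>v. - \<Gamma> c ?x v (?P ?x))" by (rule ext)
  with d show ?thesis by simp
qed

text \<open>Since \<open>Q\<close> has derivative \<open>- \<Gamma> Q\<close>, differentiating its
  inverse adds the term with \<open>+ \<Gamma>\<close>: in the frame, covariant differentiation is
  differentiation of components. Only differentiability of \<open>Y\<close> at \<open>q\<close> is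
  asked, so that the Euler field can be inserted directly.\<close>

lemma coframe_mderiv:
  assumes Q: "parallel_frame U Q" and U: "open U" "q \<in> U"
    and Y: "((\<lambda>x. field_rep A (chart_at A q) Y x) has_derivative Y') (at (chart_map (chart_at A q) q))"
  shows "has_mderiv (\<lambda>q. inv (Q q) (Y q)) q
    (\<lambda>v. inv (Q q) (Y' v + \<Gamma> (chart_at A q) (chart_map (chart_at A q) q) v (Y q)))"
proof -
  let ?c = "chart_at A q" let ?x = "chart_map ?c q" let ?S = "chart_map ?c ` (U \<inter> chart_dom ?c)"
  have c: "?c \<in> A" "q \<in> chart_dom ?c" by (rule chart_at)+
  have S: "open ?S" "?x \<in> ?S" using open_chart_image[OF c(1) U(1)] U c by auto
  define P where "P x w = field_rep A ?c (\<lambda>q. Q q w) x" for x w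
  define \<theta> where "\<theta> x u = inv (Q (chart_inv ?c x)) (Tr ?c (chart_at A (chart_inv ?c x)) (chart_inv ?c x) u)" for x u
  have in_S: "chart_inv ?c x \<in> U" "chart_inv ?c x \<in> chart_dom ?c" "x \<in> img ?c" if "x \<in> ?S" for x
    using that in_chart_image[OF c(1), of x U] c by auto
  have par: "parallel_field A nabla U (\<lambda>q. Q q w)" for w
    using Q by (simp add: parallel_frame_def)
  have P_eq: "P x w = Tr (chart_at A (chart_inv ?c x)) ?c (chart_inv ?c x) (Q (chart_inv ?c x) w)" for x w
    by (simp add: P_def field_rep_eq)
  have P': "((\<lambda>x. P x w) has_derivative (\<lambda>v. - \<Gamma> ?c x v (P x w))) (at x)" if x: "x \<in> ?S" for x w
    unfolding P_def
    using parallel_rep_derivative[OF par U(1) in_S(1)[OF x] c(1) in_S(2)[OF x], of w] in_S(3)[OF x] c(1) by simp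
  have "((\<lambda>x. \<theta> x (field_rep A ?c Y x)) has_derivative
    (\<lambda>v. \<theta> ?x (Y' v - (- \<Gamma> ?c ?x v (P ?x (\<theta> ?x (field_rep A ?c Y ?x))))))) (at ?x)"
  proof (rule has_derivative_apply_inverse[where P = P and P' = "\<lambda>x w v. - \<Gamma> ?c x v (P x w)", OF S _ _ _ P' Y])
    fix x assume x: "x \<in> ?S"
    let ?p = "chart_inv ?c x"
    have p: "?p \<in> U" "?p \<in> chart_dom ?c" using in_S[OF x] by auto
    have "linear (Q ?p)" using Q p by (auto simp: parallel_frame_def)
    from linear_compose[OF this Tr_linear[OF chart_at(1) c(1) chart_at(2) p(2)]]
    show "linear (P x)" unfolding P_eq by (simp add: o_def)
    show "\<theta> x (P x u) = u" for u
      using Tr_inverse[OF chart_at(1) c(1) chart_at(2) p(2)] parallel_frame_inverse(2)[OF Q p(1)]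
      by (simp add: \<theta>_def P_eq)
    show "P x (\<theta> x u) = u" for u
      using Tr_inverse[OF c(1) chart_at(1) p(2) chart_at(2)] parallel_frame_inverse(1)[OF Q p(1)]
      by (simp add: \<theta>_def P_eq)
  qed
  moreover have "P ?x (\<theta> ?x u) = u" for u
    using Tr_inverse[OF c(1) chart_at(1) c(2) chart_at(2)] parallel_frame_inverse(1)[OF Q U(2)] c
    by (simp add: \<theta>_def P_eq)
  moreover have "\<theta> ?x u = inv (Q q) u" for u
    using c Tr_id[OF c] by (simp add: \<theta>_def)
  ultimately have "((\<lambda>x. \<theta> x (field_rep A ?c Y x)) has_derivative (\<lambda>v. inv (Q q) (Y' v + \<Gamma> ?c ?x v (Y q)))) (at ?x)"
    by (simp add: field_rep_chart_at)
  then show ?thesis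
    unfolding has_mderiv_def
  proof (rule has_derivative_transform_within_open[OF _ S])
    fix x assume x: "x \<in> ?S"
    show "\<theta> x (field_rep A ?c Y x) = ((\<lambda>q. inv (Q q) (Y q)) \<circ> chart_inv ?c) x"
      using Tr_inverse[OF chart_at(1) c(1) chart_at(2) in_S(2)[OF x]] by (simp add: \<theta>_def field_rep_eq)
  qed
qed

lemma coframe_mderiv_field:
  assumes Q: "parallel_frame U Q" and U: "open U" "q \<in> U" and Y: "vector_field A U Y"
  shows "has_mderiv (\<lambda>q. inv (Q q) (Y q)) q (\<lambda>v. inv (Q q) (nabla q v Y))"
proof -
  let ?c = "chart_at A q" let ?x = "chart_map ?c q"
  have c: "?c \<in> A" "q \<in> chart_dom ?c" by (rule chart_at)+
  have "((\<lambda>x. field_rep A ?c Y x) has_derivative frechet_derivative (field_rep A ?c Y) (at ?x)) (at ?x)"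
    by (rule smooth_on_has_derivative[OF vector_field_rep_smooth[OF Y c(1)]]) (use U c in auto)
  from coframe_mderiv[OF Q U this] show ?thesis
    using nabla_in_chart[OF c(1) U c(2) Y] Tr_id[OF c] by (simp add: field_rep_chart_at)
qed

text \<open>The components of a parallel field in the frame have zero derivative and are therefore
  constant.\<close>

lemma parallel_field_eq_frame:
  assumes Q: "parallel_frame U Q" and U: "open U" "connected U" and X: "parallel_field A nabla U X"
    and pq: "p \<in> U" "q \<in> U"
  shows "X q = Q q (inv (Q p) (X p))"
proof -
  have "inv (Q q) (X q) = inv (Q p) (X p)"
  proof (rule has_mderiv_zero_imp_constant[OF _ U pq(2,1)])
    fix p assume p: "p \<in> U"
    have "has_mderiv (\<lambda>q. inv (Q q) (X q)) p (\<lambda>v. inv (Q p) (nabla p v X))"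
      by (rule coframe_mderiv_field[OF Q U(1) p]) (use X in \<open>simp add: parallel_field_def\<close>)
    moreover have "inv (Q p) (nabla p v X) = 0" for v
      using X p linear_0[OF parallel_frame_inverse(3)[OF Q p]] by (simp add: parallel_field_def)
    ultimately show "has_mderiv (\<lambda>q. inv (Q q) (X q)) p (\<lambda>v. 0)" by simp
  qed
  then show ?thesis using parallel_frame_inverse(1)[OF Q pq(2)] by metis
qed

end

section \<open>Locally constant sheaves on simply connected spaces\<close>

text \<open>Any two loops are freely homotopic here, in particular the constant loops at
  \<open>p\<close> and \<open>q\<close>; the base points of the intermediate loops trace a path from
  \<open>p\<close> to \<open>q\<close>.\<close>

lemma simply_connected_imp_path_connected_UNIV:
  assumes "simply_connected (UNIV :: 'm::topological_space set)"
  shows "path_connected (UNIV :: 'm set)"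
  unfolding path_connected_def
proof (intro ballI)
  fix p q :: 'm
  have "homotopic_loops UNIV (\<lambda>_::real. p) (\<lambda>_. q)"
    using assms unfolding simply_connected_def by (auto simp: path_def pathfinish_def pathstart_def)
  then obtain h where h: "continuous_on ({0..1::real} \<times> {0..1::real}) h" "h (0, 0) = p" "h (1, 0) = q"
    unfolding homotopic_loops by auto
  have "path (\<lambda>t. h (t, 0))"
    unfolding path_def by (rule continuous_on_compose2[OF h(1)]) (auto intro!: continuous_intros)
  with h(2,3) show "\<exists>g. path g \<and> path_image g \<subseteq> UNIV \<and> pathstart g = p \<and> pathfinish g = q"
    by (intro exI[of _ "\<lambda>t. h (t, 0)"]) (simp add: pathstart_def pathfinish_def)
qed

text \<open>
  \<open>S U f\<close> says that \<open>f\<close> is a section over \<open>U\<close>; \<open>F\<close> is the set of possible values, which is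
  the same for all stalks.
\<close>

locale local_system =
  fixes S :: "'m::topological_space set \<Rightarrow> ('m \<Rightarrow> 'b) \<Rightarrow> bool" and F :: "'b set"
  assumes restrict: "S U f \<Longrightarrow> V \<subseteq> U \<Longrightarrow> S V f"
    and val: "S U f \<Longrightarrow> p \<in> U \<Longrightarrow> f p \<in> F"
    and unique: "open U \<Longrightarrow> connected U \<Longrightarrow> S U f \<Longrightarrow> S U g \<Longrightarrow> p \<in> U \<Longrightarrow> q \<in> U \<Longrightarrow> f p = g p \<Longrightarrow> f q = g q"
    and trivial: "\<exists>U. open U \<and> p \<in> U \<and> (\<forall>q\<in>U. \<forall>b\<in>F. \<exists>f. S U f \<and> f q = b)"
    and nbhd: "open U \<Longrightarrow> p \<in> U \<Longrightarrow> \<exists>N. open N \<and> path_connected N \<and> p \<in> N \<and> N \<subseteq> U"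
begin

text \<open>Sections over \<open>R\<close> of the pullback of the system along \<open>h\<close>.
  \<open>R\<close> need not be open, so that intervals and rectangles are admissible.\<close>

definition sec :: "('x::topological_space \<Rightarrow> 'm) \<Rightarrow> 'x set \<Rightarrow> ('x \<Rightarrow> 'b) \<Rightarrow> bool" where
  "sec h R \<sigma> \<longleftrightarrow> (\<forall>x\<in>R. \<exists>N U f. open N \<and> x \<in> N \<and> open U \<and> S U f \<and> (\<forall>y\<in>N \<inter> R. h y \<in> U \<and> \<sigma> y = f (h y)))"

lemma secD:
  assumes "sec h R \<sigma>" "x \<in> R"
  obtains N U f where "open N" "x \<in> N" "open U" "S U f" "\<forall>y\<in>N \<inter> R. h y \<in> U \<and> \<sigma> y = f (h y)"
  using bspec[OF assms(1)[unfolded sec_def] assms(2)] by (elim exE conjE) (rule that)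

lemma sec_val:
  assumes "sec h R \<sigma>" "x \<in> R"
  shows "\<sigma> x \<in> F"
proof -
  obtain N U f where N: "open N" "x \<in> N" "open U" "S U f" "\<forall>y\<in>N \<inter> R. h y \<in> U \<and> \<sigma> y = f (h y)"
    by (rule secD[OF assms])
  then show ?thesis using val[OF N(4), of "h x"] assms(2) by simp
qed

lemma sec_cong:
  assumes "sec h R \<sigma>" "\<And>x. x \<in> R \<Longrightarrow> h x = h' x" "\<And>x. x \<in> R \<Longrightarrow> \<sigma> x = \<sigma>' x"
  shows "sec h' R \<sigma>'"
  unfolding sec_def
proof
  fix x assume x: "x \<in> R"
  obtain N U f where N: "open N" "x \<in> N" "open U" "S U f" "\<forall>y\<in>N \<inter> R. h y \<in> U \<and> \<sigma> y = f (h y)"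
    by (rule secD[OF assms(1) x])
  then show "\<exists>N U f. open N \<and> x \<in> N \<and> open U \<and> S U f \<and> (\<forall>y\<in>N \<inter> R. h' y \<in> U \<and> \<sigma>' y = f (h' y))"
    using assms(2,3) by (intro exI[of _ N] exI[of _ U] exI[of _ f]) auto
qed

lemma sec_compose:
  assumes "sec h R \<sigma>" "continuous_on T g" "g ` T \<subseteq> R"
  shows "sec (\<lambda>t. h (g t)) T (\<lambda>t. \<sigma> (g t))"
  unfolding sec_def
proof
  fix t assume t: "t \<in> T"
  obtain N U f where N: "open N" "g t \<in> N" "open U" "S U f" "\<forall>y\<in>N \<inter> R. h y \<in> U \<and> \<sigma> y = f (h y)"
    by (rule secD[OF assms(1) subsetD[OF assms(3) imageI[OF t]]])
  obtain N' where N': "open N'" "N' \<inter> T = g -` N \<inter> T"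
    using assms(2) N(1) unfolding continuous_on_open_invariant by blast
  show "\<exists>N U f. open N \<and> t \<in> N \<and> open U \<and> S U f \<and> (\<forall>y\<in>N \<inter> T. h (g y) \<in> U \<and> \<sigma> (g y) = f (h (g y)))"
    using N N' t assms(3) by (intro exI[of _ N'] exI[of _ U] exI[of _ f]) blast
qed

lemma sec_of_section:
  assumes "open U" "S U f" "\<And>x. x \<in> R \<Longrightarrow> h x \<in> U"
  shows "sec h R (\<lambda>x. f (h x))"
  unfolding sec_def
  by (intro ballI exI[of _ UNIV] exI[of _ U] exI[of _ f]) (use assms in auto)

lemma sec_subset: "sec h R \<sigma> \<Longrightarrow> T \<subseteq> R \<Longrightarrow> sec h T \<sigma>"
  using sec_compose[of h R \<sigma> T "\<lambda>x. x"] by simp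

text \<open>On a connected neighbourhood two sections agree everywhere or nowhere, so agreement and
  disagreement are both open conditions.\<close>

lemma local_agreement:
  assumes "S U f" "S V g" "open U" "open V" "p \<in> U" "p \<in> V"
  obtains W where "open W" "p \<in> W" "W \<subseteq> U" "W \<subseteq> V" "\<forall>q\<in>W. f q = g q \<longleftrightarrow> f p = g p"
proof -
  obtain W where W: "open W" "path_connected W" "p \<in> W" "W \<subseteq> U \<inter> V"
    using nbhd[of "U \<inter> V" p] assms by blast
  have fg: "S W f" "S W g" using restrict[OF assms(1)] restrict[OF assms(2)] W(4) by auto
  have "f q = g q \<longleftrightarrow> f p = g p" if "q \<in> W" for q
    using unique[OF W(1) path_connected_imp_connected[OF W(2)] fg] that W(3) by blast
  then have "\<forall>q\<in>W. f q = g q \<longleftrightarrow> f p = g p" by blast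
  then show thesis by (rule that[OF W(1,3), rotated 2]) (use W(4) in auto)
qed

text \<open>The same dichotomy for pulled back sections. Two sets \<open>R\<close> and
  \<open>T\<close> are allowed because gluing compares sections over different pieces; uniqueness is
  the case of equal sets.\<close>

lemma sec_agreement:
  assumes "sec h R \<sigma>" "sec h T \<sigma>'" "continuous_on (R \<union> T) h" "x \<in> R" "x \<in> T"
  obtains N U f g where "open N" "x \<in> N" "open U" "S U f" "S U g"
    "\<forall>y\<in>N \<inter> R. h y \<in> U \<and> \<sigma> y = f (h y)"
    "\<forall>y\<in>N \<inter> T. h y \<in> U \<and> \<sigma>' y = g (h y)"
    "\<forall>q\<in>U. f q = g q \<longleftrightarrow> \<sigma> x = \<sigma>' x"
proof -
  obtain N U f where N: "open N" "x \<in> N" "open U" "S U f" "\<forall>y\<in>N \<inter> R. h y \<in> U \<and> \<sigma> y = f (h y)"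
    by (rule secD[OF assms(1,4)])
  obtain M V g where M: "open M" "x \<in> M" "open V" "S V g" "\<forall>y\<in>M \<inter> T. h y \<in> V \<and> \<sigma>' y = g (h y)"
    by (rule secD[OF assms(2,5)])
  have hx: "h x \<in> U" "h x \<in> V" "\<sigma> x = f (h x)" "\<sigma>' x = g (h x)" using N M assms by auto
  obtain W where W: "open W" "h x \<in> W" "W \<subseteq> U" "W \<subseteq> V" "\<forall>q\<in>W. f q = g q \<longleftrightarrow> f (h x) = g (h x)"
    by (rule local_agreement[OF N(4) M(4) N(3) M(3) hx(1,2)])
  obtain N' where N': "open N'" "N' \<inter> (R \<union> T) = h -` W \<inter> (R \<union> T)"
    using assms(3) W(1) unfolding continuous_on_open_invariant by blast
  show thesis
  proof (rule that[of "N \<inter> M \<inter> N'" W f g])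
    show "open (N \<inter> M \<inter> N')" using N M N' by auto
    show "x \<in> N \<inter> M \<inter> N'" using N M N' W assms by blast
    show "open W" by fact
    show "S W f" "S W g" using restrict[OF N(4) W(3)] restrict[OF M(4) W(4)] by auto
    show "\<forall>y\<in>N \<inter> M \<inter> N' \<inter> R. h y \<in> W \<and> \<sigma> y = f (h y)" using N(5) N'(2) by blast
    show "\<forall>y\<in>N \<inter> M \<inter> N' \<inter> T. h y \<in> W \<and> \<sigma>' y = g (h y)" using M(5) N'(2) by blast
    show "\<forall>q\<in>W. f q = g q \<longleftrightarrow> \<sigma> x = \<sigma>' x" using W(5) hx by simp
  qed
qed

text \<open>The truth value of the agreement of \<sigma> and \<sigma>' is locally constant on a
  connected set.\<close>

lemma sec_unique:
  assumes "sec h R \<sigma>" "sec h R \<sigma>'" "continuous_on R h" "connected R" "x \<in> R" "y \<in> R" "\<sigma> x = \<sigma>' x"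
  shows "\<sigma> y = \<sigma>' y"
proof -
  have "(\<sigma> x = \<sigma>' x) = (\<sigma> y = \<sigma>' y)"
  proof (rule connected_local_const[OF assms(4-6)], intro ballI)
    fix x assume x: "x \<in> R"
    obtain N U f g where N: "open N" "x \<in> N" "open U" "S U f" "S U g"
      "\<forall>y\<in>N \<inter> R. h y \<in> U \<and> \<sigma> y = f (h y)"
      "\<forall>y\<in>N \<inter> R. h y \<in> U \<and> \<sigma>' y = g (h y)"
      "\<forall>q\<in>U. f q = g q \<longleftrightarrow> \<sigma> x = \<sigma>' x"
      by (rule sec_agreement[OF assms(1,2) _ x x, unfolded Un_absorb, OF assms(3)])
    have "(\<sigma> x = \<sigma>' x) = (\<sigma> y = \<sigma>' y)" if "y \<in> N" "y \<in> R" for y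
      using N(6-8) that by auto
    with N(1,2) show "\<forall>\<^sub>F y in at x within R. (\<sigma> x = \<sigma>' x) = (\<sigma> y = \<sigma>' y)"
      unfolding eventually_at_topological by (intro exI[of _ N]) blast
  qed
  then show ?thesis using assms(7) by simp
qed

text \<open>At a point of only one piece, the complement of the other closed piece is a
  neighbourhood. At a common point both are given by one local section, by
  \<open>sec_agreement\<close>.\<close>

lemma sec_glue:
  assumes "sec h R \<sigma>" "sec h T \<sigma>'" "continuous_on (R \<union> T) h" "closed R" "closed T"
    and eq: "\<And>x. x \<in> R \<Longrightarrow> x \<in> T \<Longrightarrow> \<sigma> x = \<sigma>' x"
  shows "sec h (R \<union> T) (\<lambda>x. if x \<in> R then \<sigma> x else \<sigma>' x)"
  unfolding sec_def
proof
  let ?s = "\<lambda>x. if x \<in> R then \<sigma> x else \<sigma>' x"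
  fix x assume "x \<in> R \<union> T"
  then consider "x \<in> R" "x \<notin> T" | "x \<notin> R" "x \<in> T" | "x \<in> R" "x \<in> T" by blast
  then show "\<exists>N U f. open N \<and> x \<in> N \<and> open U \<and> S U f \<and> (\<forall>y\<in>N \<inter> (R \<union> T). h y \<in> U \<and> ?s y = f (h y))"
  proof cases
    case 1
    obtain N U f where N: "open N" "x \<in> N" "open U" "S U f" "\<forall>y\<in>N \<inter> R. h y \<in> U \<and> \<sigma> y = f (h y)"
      by (rule secD[OF assms(1) 1(1)])
    show ?thesis
      by (intro exI[of _ "N \<inter> - T"] exI[of _ U] exI[of _ f]) (use N 1 assms(5) in auto)
  next
    case 2
    obtain N U f where N: "open N" "x \<in> N" "open U" "S U f" "\<forall>y\<in>N \<inter> T. h y \<in> U \<and> \<sigma>' y = f (h y)"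
      by (rule secD[OF assms(2) 2(2)])
    show ?thesis
      by (intro exI[of _ "N \<inter> - R"] exI[of _ U] exI[of _ f]) (use N 2 assms(4) in auto)
  next
    case 3
    obtain N U f g where N: "open N" "x \<in> N" "open U" "S U f" "S U g"
      "\<forall>y\<in>N \<inter> R. h y \<in> U \<and> \<sigma> y = f (h y)"
      "\<forall>y\<in>N \<inter> T. h y \<in> U \<and> \<sigma>' y = g (h y)"
      "\<forall>q\<in>U. f q = g q \<longleftrightarrow> \<sigma> x = \<sigma>' x"
      by (rule sec_agreement[OF assms(1-3) 3])
    have "?s y = f (h y) \<and> h y \<in> U" if "y \<in> N \<inter> (R \<union> T)" for y
      using that N(6-8) eq[OF 3] by auto
    then show ?thesis
      by (intro exI[of _ N] exI[of _ U] exI[of _ f]) (use N in auto)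
  qed
qed

text \<open>The pullback over \<open>R\<close> is trivial in the sense that every value at every
  point extends to a section over all of \<open>R\<close>.\<close>

definition good :: "('x::topological_space \<Rightarrow> 'm) \<Rightarrow> 'x set \<Rightarrow> bool" where
  "good h R \<longleftrightarrow> (\<forall>x\<in>R. \<forall>v\<in>F. \<exists>\<sigma>. sec h R \<sigma> \<and> \<sigma> x = v)"

text \<open>A section over one piece is continued into the other from its value at \<open>z\<close>;
  the two agree on the connected intersection by uniqueness and can be glued.\<close>

lemma good_union:
  assumes h: "continuous_on UNIV h" and cl: "closed R" "closed T"
    and int: "connected (R \<inter> T)" "z \<in> R" "z \<in> T" and g: "good h R" "good h T"
  shows "good h (R \<union> T)"
proof -
  have *: "\<exists>\<sigma>. sec h (R \<union> T) \<sigma> \<and> \<sigma> x = v"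
    if cl: "closed R" "closed T" and int: "connected (R \<inter> T)" "z \<in> R" "z \<in> T" and g: "good h R" "good h T"
      and x: "x \<in> R" "v \<in> F" for R T x v
  proof -
    obtain \<sigma> where \<sigma>: "sec h R \<sigma>" "\<sigma> x = v" using g(1) x unfolding good_def by blast
    obtain \<sigma>' where \<sigma>': "sec h T \<sigma>'" "\<sigma>' z = \<sigma> z"
      using g(2) int(3) sec_val[OF \<sigma>(1) int(2)] unfolding good_def by blast
    have "\<sigma> y = \<sigma>' y" if "y \<in> R" "y \<in> T" for y
      by (rule sec_unique[OF sec_subset[OF \<sigma>(1)] sec_subset[OF \<sigma>'(1)] continuous_on_subset[OF h] int(1), of z])
         (use int \<sigma>'(2) that in auto)
    from sec_glue[OF \<sigma>(1) \<sigma>'(1) continuous_on_subset[OF h] cl this]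
    show ?thesis using \<sigma>(2) x(1) by (intro exI[of _ "\<lambda>x. if x \<in> R then \<sigma> x else \<sigma>' x"]) auto
  qed
  show ?thesis
    unfolding good_def
  proof (intro ballI)
    fix x v assume "x \<in> R \<union> T" and v: "v \<in> F"
    then consider "x \<in> R" | "x \<in> T" by blast
    then show "\<exists>\<sigma>. sec h (R \<union> T) \<sigma> \<and> \<sigma> x = v"
    proof cases
      case 1
      from *[OF cl int g 1 v] show ?thesis .
    next
      case 2
      have "connected (T \<inter> R)" using int(1) by (simp add: Int_commute)
      from *[OF cl(2,1) this int(3,2) g(2,1) 2 v] show ?thesis by (simp add: Un_commute)
    qed
  qed
qed

text \<open>Bisection is applied twice. For fixed height \<open>t\<close>, horizontal subdivision
  joins small rectangles, each mapped into a trivialising set, to a thin strip around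
  \<open>t\<close>; vertical subdivision then stacks strips. Neighbouring pieces meet in a segment,
  which is connected.\<close>

lemma good_square:
  fixes h :: "real \<times> real \<Rightarrow> 'm"
  assumes h: "continuous_on UNIV h"
  shows "good h ({0..1} \<times> {0..1})"
proof -
  have conn: "connected ({a..b} \<times> {c..d})" for a b c d :: real
    by (intro connected_Times connected_Icc)
  have inner: "\<exists>\<delta>>0. \<forall>c d. c \<le> t \<and> t \<le> d \<and> d - c < \<delta> \<longrightarrow> good h ({0..1} \<times> {c..d})" for t
  proof (rule Bolzano[of "0::real" 1 "\<lambda>a b. \<exists>\<delta>>0. \<forall>c d. c \<le> t \<and> t \<le> d \<and> d - c < \<delta> \<longrightarrow> good h ({a..b} \<times> {c..d})"])
    fix a b c :: real
    assume 1: "\<exists>\<delta>>0. \<forall>c d. c \<le> t \<and> t \<le> d \<and> d - c < \<delta> \<longrightarrow> good h ({a..b} \<times> {c..d})"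
      and 2: "\<exists>\<delta>>0. \<forall>c' d. c' \<le> t \<and> t \<le> d \<and> d - c' < \<delta> \<longrightarrow> good h ({b..c} \<times> {c'..d})"
      and abc: "a \<le> b" "b \<le> c"
    obtain \<delta>1 where \<delta>1: "\<delta>1 > 0" "\<And>c d. c \<le> t \<Longrightarrow> t \<le> d \<Longrightarrow> d - c < \<delta>1 \<Longrightarrow> good h ({a..b} \<times> {c..d})"
      using 1 by blast
    obtain \<delta>2 where \<delta>2: "\<delta>2 > 0" "\<And>c' d. c' \<le> t \<Longrightarrow> t \<le> d \<Longrightarrow> d - c' < \<delta>2 \<Longrightarrow> good h ({b..c} \<times> {c'..d})"
      using 2 by blast
    have "good h ({a..c} \<times> {c'..d})" if "c' \<le> t" "t \<le> d" "d - c' < min \<delta>1 \<delta>2" for c' d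
    proof -
      have eq: "{a..c} \<times> {c'..d} = {a..b} \<times> {c'..d} \<union> {b..c} \<times> {c'..d}" using abc by auto
      have int: "{a..b} \<times> {c'..d} \<inter> {b..c} \<times> {c'..d} = {b..b} \<times> {c'..d}" using abc by auto
      show ?thesis
        unfolding eq by (rule good_union[OF h, where z = "(b, t)"])
          (use int conn abc that \<delta>1(2) \<delta>2(2) in \<open>auto intro: closed_Times\<close>)
    qed
    then show "\<exists>\<delta>>0. \<forall>c' d. c' \<le> t \<and> t \<le> d \<and> d - c' < \<delta> \<longrightarrow> good h ({a..c} \<times> {c'..d})"
      using \<delta>1(1) \<delta>2(1) by (intro exI[of _ "min \<delta>1 \<delta>2"]) auto
  next
    fix s :: real
    obtain U where U: "open U" "h (s, t) \<in> U" "\<And>q b. q \<in> U \<Longrightarrow> b \<in> F \<Longrightarrow> \<exists>f. S U f \<and> f q = b"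
      using trivial[of "h (s, t)"] by blast
    have "open (h -` U)" using h U(1) by (simp add: open_vimage)
    moreover have "(s, t) \<in> h -` U" using U(2) by simp
    ultimately have "\<exists>V W. open V \<and> open W \<and> (s, t) \<in> V \<times> W \<and> V \<times> W \<subseteq> h -` U"
      unfolding open_prod_def by (rule bspec)
    then obtain V W where VW: "open V" "open W" "s \<in> V" "t \<in> W" "V \<times> W \<subseteq> h -` U" by auto
    obtain \<delta>1 where \<delta>1: "\<delta>1 > 0" "ball s \<delta>1 \<subseteq> V" using VW(1,3) open_contains_ball by blast
    obtain \<delta>2 where \<delta>2: "\<delta>2 > 0" "ball t \<delta>2 \<subseteq> W" using VW(2,4) open_contains_ball by blast
    note \<delta> = \<delta>1(1) \<delta>2(1) \<delta>1(2) \<delta>2(2)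
    have "good h ({a..b} \<times> {c..d})" if "a \<le> s" "s \<le> b" "b - a < \<delta>1" "c \<le> t" "t \<le> d" "d - c < \<delta>2" for a b c d
    proof -
      have sub: "{a..b} \<times> {c..d} \<subseteq> h -` U"
      proof -
        have "{a..b} \<subseteq> ball s \<delta>1" "{c..d} \<subseteq> ball t \<delta>2" using that by (auto simp: dist_real_def)
        with \<delta> VW(5) show ?thesis by blast
      qed
      show ?thesis
        unfolding good_def
      proof (intro ballI)
        fix x v assume x: "x \<in> {a..b} \<times> {c..d}" and v: "v \<in> F"
        then obtain f where f: "S U f" "f (h x) = v" using U(3) sub by blast
        have "sec h ({a..b} \<times> {c..d}) (\<lambda>x. f (h x))"
          by (rule sec_of_section[OF U(1) f(1)]) (use sub in blast)
        with f(2) show "\<exists>\<sigma>. sec h ({a..b} \<times> {c..d}) \<sigma> \<and> \<sigma> x = v" by blast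
      qed
    qed
    then show "\<exists>d>0. \<forall>a b. a \<le> s \<and> s \<le> b \<and> b - a < d \<longrightarrow>
        (\<exists>\<delta>>0. \<forall>c d. c \<le> t \<and> t \<le> d \<and> d - c < \<delta> \<longrightarrow> good h ({a..b} \<times> {c..d}))"
      using \<delta> by blast
  qed simp
  show ?thesis
  proof (rule Bolzano[of "0::real" 1 "\<lambda>c d. good h ({0..1} \<times> {c..d})"])
    fix a b c :: real
    assume 1: "good h ({0..1} \<times> {a..b})" "good h ({0..1} \<times> {b..c})" and abc: "a \<le> b" "b \<le> c"
    have eq: "{0..1} \<times> {a..c} = {0..1::real} \<times> {a..b} \<union> {0..1} \<times> {b..c}" using abc by auto
    have int: "{0..1::real} \<times> {a..b} \<inter> {0..1} \<times> {b..c} = {0..1} \<times> {b..b}" using abc by auto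
    show "good h ({0..1} \<times> {a..c})"
      unfolding eq by (rule good_union[OF h, where z = "(0, b)"])
        (use int conn abc 1 in \<open>auto intro: closed_Times\<close>)
  next
    fix t :: real
    show "\<exists>\<delta>>0. \<forall>c d. c \<le> t \<and> t \<le> d \<and> d - c < \<delta> \<longrightarrow> good h ({0..1} \<times> {c..d})" by (rule inner)
  qed simp
qed

lemma sec_square_exists:
  fixes h :: "real \<times> real \<Rightarrow> 'm"
  assumes h: "continuous_on ({0..1} \<times> {0..1}) h" and x: "x \<in> {0..1} \<times> {0..1}" "v \<in> F"
  shows "\<exists>\<sigma>. sec h ({0..1} \<times> {0..1}) \<sigma> \<and> \<sigma> x = v"
proof -
  \<comment> \<open>Clamping both coordinates to the unit interval extends \<open>h\<close>
    continuously to the plane, where preimages of open sets are open.\<close>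
  define cl where "cl s = max 0 (min 1 s)" for s :: real
  define H where "H p = h (cl (fst p), cl (snd p))" for p
  have "continuous_on UNIV H"
    unfolding H_def by (rule continuous_on_compose2[OF h]) (auto simp: cl_def intro!: continuous_intros)
  from good_square[OF this] obtain \<sigma> where \<sigma>: "sec H ({0..1} \<times> {0..1}) \<sigma>" "\<sigma> x = v"
    using x unfolding good_def by blast
  have "sec h ({0..1} \<times> {0..1}) \<sigma>"
    by (rule sec_cong[OF \<sigma>(1)]) (auto simp: H_def cl_def)
  with \<sigma>(2) show ?thesis by blast
qed

lemma sec_path_exists:
  assumes g: "path g" and v: "v \<in> F"
  shows "\<exists>\<sigma>. sec g {0..1} \<sigma> \<and> \<sigma> 0 = v"
proof -
  have "continuous_on ({0..1} \<times> {0..1::real}) (\<lambda>p. g (fst p))"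
    by (rule continuous_on_compose2[OF g[unfolded path_def]]) (auto intro!: continuous_intros)
  from sec_square_exists[OF this, of "(0, 0)" v] v
  obtain \<sigma> where \<sigma>: "sec (\<lambda>p. g (fst p)) ({0..1} \<times> {0..1::real}) \<sigma>" "\<sigma> (0, 0) = v" by auto
  have "sec (\<lambda>t. g (fst (t, 0::real))) {0..1} (\<lambda>t. \<sigma> (t, 0))"
    by (rule sec_compose[OF \<sigma>(1)]) (auto intro!: continuous_intros)
  with \<sigma>(2) show ?thesis by auto
qed

lemma sec_path_unique:
  assumes "path g" "sec g {0..1} \<sigma>" "sec g {0..1} \<sigma>'" "\<sigma> s = \<sigma>' s" "s \<in> {0..1}" "t \<in> {0..1}"
  shows "\<sigma> t = \<sigma>' t"
  by (rule sec_unique[OF assms(2,3) assms(1)[unfolded path_def] connected_Icc assms(5,6,4)])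

text \<open>Extend the section over the square of a homotopy to a constant loop. On the constant
  side it is constant. The edges at loop parameters 0 and 1 follow the same path, so equality of
  their values at the constant end is transported back to the loop \<open>g\<close>.\<close>

lemma holonomy_trivial:
  assumes sc: "simply_connected (UNIV :: 'm set)" and g: "path g" "pathfinish g = pathstart g"
    and \<sigma>: "sec g {0..1} \<sigma>"
  shows "\<sigma> 1 = \<sigma> 0"
proof -
  let ?I = "{0..1::real}"
  have "homotopic_loops UNIV g (\<lambda>_. pathstart g)"
    using sc g unfolding simply_connected_def by (auto simp: path_def pathfinish_def pathstart_def)
  then obtain h where h: "continuous_on (?I \<times> ?I) h" "\<And>x. x \<in> ?I \<Longrightarrow> h (0, x) = g x"
    "\<And>x. x \<in> ?I \<Longrightarrow> h (1, x) = pathstart g" "\<And>t. t \<in> ?I \<Longrightarrow> h (t, 1) = h (t, 0)"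
    unfolding homotopic_loops by (auto simp: pathstart_def pathfinish_def o_def)
  have "\<sigma> 0 \<in> F" by (rule sec_val[OF \<sigma>]) simp
  from sec_square_exists[OF h(1), of "(0, 0)" "\<sigma> 0"] this
  obtain \<tau> where \<tau>: "sec h (?I \<times> ?I) \<tau>" "\<tau> (0, 0) = \<sigma> 0" by auto
  have left: "sec g ?I (\<lambda>x. \<tau> (0, x))"
    by (rule sec_cong[OF sec_compose[OF \<tau>(1), of ?I "\<lambda>x. (0, x)"]]) (auto intro!: continuous_intros h(2))
  have right: "sec (\<lambda>_. pathstart g) ?I (\<lambda>x. \<tau> (1, x))"
    by (rule sec_cong[OF sec_compose[OF \<tau>(1), of ?I "\<lambda>x. (1, x)"]]) (auto intro!: continuous_intros h(3))
  have bottom: "sec (\<lambda>t. h (t, 0)) ?I (\<lambda>t. \<tau> (t, 0))"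
    by (rule sec_compose[OF \<tau>(1)]) (auto intro!: continuous_intros)
  have top: "sec (\<lambda>t. h (t, 0)) ?I (\<lambda>t. \<tau> (t, 1))"
    by (rule sec_cong[OF sec_compose[OF \<tau>(1), of ?I "\<lambda>t. (t, 1)"]]) (auto intro!: continuous_intros h(4))
  have pb: "path (\<lambda>t. h (t, 0))"
    unfolding path_def by (rule continuous_on_compose2[OF h(1)]) (auto intro!: continuous_intros)
  obtain U where U: "open U" "pathstart g \<in> U" "\<And>q b. q \<in> U \<Longrightarrow> b \<in> F \<Longrightarrow> \<exists>f. S U f \<and> f q = b"
    using trivial[of "pathstart g"] by blast
  have "\<tau> (1, 0) \<in> F" by (rule sec_val[OF \<tau>(1)]) simp
  then obtain f where f: "S U f" "f (pathstart g) = \<tau> (1, 0)" using U by blast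
  have "sec (\<lambda>_. pathstart g) ?I (\<lambda>x. f (pathstart g))"
    by (rule sec_of_section[OF U(1) f(1)]) (rule U(2))
  from sec_path_unique[OF _ right this, of 0 1]
  have "\<tau> (1, 1) = \<tau> (1, 0)" using f(2) by (simp add: path_def)
  from sec_path_unique[OF pb top bottom, of 1 0] this
  have "\<tau> (0, 1) = \<tau> (0, 0)" by simp
  moreover from sec_path_unique[OF g(1) left \<sigma>, of 0 1] \<tau>(2) have "\<tau> (0, 1) = \<sigma> 1" by simp
  ultimately show ?thesis using \<tau>(2) by simp
qed

definition reach :: "'m \<Rightarrow> 'b \<Rightarrow> 'm \<Rightarrow> 'b \<Rightarrow> bool" where
  "reach p0 b0 p b \<longleftrightarrow> (\<exists>g \<sigma>. path g \<and> pathstart g = p0 \<and> pathfinish g = p \<and>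
    sec g {0..1} \<sigma> \<and> \<sigma> 0 = b0 \<and> \<sigma> 1 = b)"

text \<open>The loop along \<open>g\<close> and back along \<open>k\<close> has trivial holonomy. At
  parameter 1/2 its section equals the result of continuation along either path.\<close>

lemma reach_unique:
  assumes sc: "simply_connected (UNIV :: 'm set)" and "reach p0 b0 p b" "reach p0 b0 p b'"
  shows "b = b'"
proof -
  obtain g \<sigma> where g: "path g" "pathstart g = p0" "pathfinish g = p" "sec g {0..1} \<sigma>" "\<sigma> 0 = b0" "\<sigma> 1 = b"
    using assms(2) unfolding reach_def by blast
  obtain k \<tau> where k: "path k" "pathstart k = p0" "pathfinish k = p" "sec k {0..1} \<tau>" "\<tau> 0 = b0" "\<tau> 1 = b'"
    using assms(3) unfolding reach_def by blast
  let ?l = "g +++ reversepath k"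
  have l: "path ?l" "pathfinish ?l = pathstart ?l" using g k by auto
  have "b0 \<in> F" using sec_val[OF g(4), of 0] g(5) by simp
  from sec_path_exists[OF l(1) this] obtain \<rho> where \<rho>: "sec ?l {0..1} \<rho>" "\<rho> 0 = b0" by blast
  have "\<rho> 1 = b0" using holonomy_trivial[OF sc l \<rho>(1)] \<rho>(2) by simp
  have "sec g {0..1} (\<lambda>t. \<rho> (t / 2))"
    by (rule sec_cong[OF sec_compose[OF \<rho>(1), of "{0..1}" "\<lambda>t. t / 2"]])
       (auto intro!: continuous_intros simp: joinpaths_def)
  from sec_path_unique[OF g(1) this g(4), of 0 1] have 1: "\<rho> (1/2) = b" using \<rho>(2) g by simp
  have "sec k {0..1} (\<lambda>t. \<rho> (1 - t / 2))"
  proof (rule sec_cong[OF sec_compose[OF \<rho>(1), of "{0..1}" "\<lambda>t. 1 - t / 2"]])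
    fix t :: real assume "t \<in> {0..1}"
    then show "?l (1 - t / 2) = k t"
      using g(3) k(3) by (auto simp: joinpaths_def reversepath_def pathfinish_def field_simps)
  qed (auto intro!: continuous_intros)
  from sec_path_unique[OF k(1) this k(4), of 0 1] have "\<rho> (1/2) = b'" using \<open>\<rho> 1 = b0\<close> k by simp
  with 1 show ?thesis by simp
qed

text \<open>The section is continuation of \<open>b0\<close> along paths, independent of the path by
  \<open>reach_unique\<close>. Near \<open>p\<close> it is the local section through its value at
  \<open>p\<close>: a nearby point is reached by a path to \<open>p\<close> followed by one inside a
  small path connected set.\<close>

theorem global_section:
  assumes sc: "simply_connected (UNIV :: 'm set)" and b0: "b0 \<in> F"
  shows "\<exists>f. f p0 = b0 \<and> (\<forall>p. \<exists>N s. open N \<and> p \<in> N \<and> S N s \<and> (\<forall>q\<in>N. f q = s q))"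
proof -
  have ex: "\<exists>b. reach p0 b0 p b" for p
  proof -
    obtain g where g: "path g" "pathstart g = p0" "pathfinish g = p"
      using simply_connected_imp_path_connected_UNIV[OF sc] unfolding path_connected_def by blast
    from sec_path_exists[OF g(1) b0] g show ?thesis unfolding reach_def by blast
  qed
  define f where "f p = (SOME b. reach p0 b0 p b)" for p
  have f: "reach p0 b0 p (f p)" for p unfolding f_def by (rule someI_ex[OF ex])
  have f_eq: "f p = b" if "reach p0 b0 p b" for p b by (rule reach_unique[OF sc f that])
  have "f p0 = b0"
  proof (rule f_eq)
    have "path (\<lambda>_::real. p0)" by (simp add: path_def)
    moreover obtain U where U: "open U" "p0 \<in> U" "\<exists>s. S U s \<and> s p0 = b0"
      using trivial[of p0] b0 by blast
    then obtain s where "S U s" "s p0 = b0" by blast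
    with sec_of_section[OF U(1) this(1), of "{0..1::real}" "\<lambda>_. p0"] U(2)
    have "sec (\<lambda>_. p0) {0..1::real} (\<lambda>_. b0)" by simp
    ultimately show "reach p0 b0 p0 b0"
      unfolding reach_def by (intro exI[of _ "\<lambda>_. p0"] exI[of _ "\<lambda>_. b0"]) (auto simp: pathstart_def pathfinish_def)
  qed
  moreover have "\<exists>N s. open N \<and> p \<in> N \<and> S N s \<and> (\<forall>q\<in>N. f q = s q)" for p
  proof -
    obtain g \<sigma> where g: "path g" "pathstart g = p0" "pathfinish g = p" "sec g {0..1} \<sigma>" "\<sigma> 0 = b0" "\<sigma> 1 = f p"
      using f[of p] unfolding reach_def by blast
    have "f p \<in> F" using sec_val[OF g(4), of 1] g(6) by simp
    then obtain U s where U: "open U" "p \<in> U" "S U s" "s p = f p" using trivial[of p] by blast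
    obtain N where N: "open N" "path_connected N" "p \<in> N" "N \<subseteq> U" using nbhd[OF U(1,2)] by blast
    have "f q = s q" if q: "q \<in> N" for q
    proof (rule f_eq)
      obtain k where k: "path k" "path_image k \<subseteq> N" "pathstart k = p" "pathfinish k = q"
        using N(2,3) q unfolding path_connected_def by blast
      let ?l = "g +++ k"
      have l: "path ?l" using g k by simp
      from sec_path_exists[OF l b0] obtain \<rho> where \<rho>: "sec ?l {0..1} \<rho>" "\<rho> 0 = b0" by blast
      have "sec g {0..1} (\<lambda>t. \<rho> (t / 2))"
        by (rule sec_cong[OF sec_compose[OF \<rho>(1), of "{0..1}" "\<lambda>t. t / 2"]])
           (auto intro!: continuous_intros simp: joinpaths_def)
      from sec_path_unique[OF g(1) this g(4), of 0 1] have 1: "\<rho> (1/2) = f p" using \<rho>(2) g by simp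
      have 2: "sec k {0..1} (\<lambda>t. \<rho> (1/2 + t / 2))"
      proof (rule sec_cong[OF sec_compose[OF \<rho>(1), of "{0..1}" "\<lambda>t. 1/2 + t / 2"]])
        fix t :: real assume "t \<in> {0..1}"
        then show "?l (1/2 + t / 2) = k t"
          using g(3) k(3) by (auto simp: joinpaths_def pathfinish_def pathstart_def field_simps)
      qed (auto intro!: continuous_intros)
      have 3: "sec k {0..1} (\<lambda>t. s (k t))"
        by (rule sec_of_section[OF U(1,3)]) (use k(2) N(4) in \<open>fastforce simp: path_image_def\<close>)
      have "\<rho> 1 = s q"
        using sec_path_unique[OF k(1) 2 3, of 0 1] 1 U(4) k(3,4) by (simp add: pathstart_def pathfinish_def)
      with \<rho> l g(2) k(4) show "reach p0 b0 q (s q)"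
        unfolding reach_def by (intro exI[of _ ?l] exI[of _ \<rho>]) auto
    qed
    with N restrict[OF U(3) N(4)] show ?thesis by blast
  qed
  ultimately show ?thesis by blast
qed

end

section \<open>Global parallel frames\<close>

context flat_manifold
begin

lemma parallel_frame_compose:
  assumes Q: "parallel_frame U Q" and L: "linear L" "inj L"
  shows "parallel_frame U (\<lambda>q w. Q q (L w))"
  unfolding parallel_frame_def
proof (intro conjI ballI allI)
  show "parallel_field A nabla U (\<lambda>q. Q q (L w))" for w using Q by (simp add: parallel_frame_def)
  show "linear (\<lambda>w. Q q (L w))" if "q \<in> U" for q
    using linear_compose[OF L(1)] Q that by (auto simp: parallel_frame_def o_def)
  show "inj (\<lambda>w. Q q (L w))" if "q \<in> U" for q
    using inj_compose[OF _ L(2)] Q that by (auto simp: parallel_frame_def o_def)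
qed

text \<open>Parallel frames form a local system whose values are the injective linear maps. Any
  value \<open>L\<close> at \<open>q\<close> is attained near \<open>p\<close> by precomposing a
  local frame with \<open>inv (Q q) \<circ> L\<close>.\<close>

lemma global_parallel_frame:
  assumes sc: "simply_connected (UNIV :: 'm set)"
  shows "\<exists>Q. parallel_frame UNIV Q"
proof -
  interpret local_system parallel_frame "{L. linear L \<and> inj L}"
  proof
    fix p :: 'm
    obtain U Q where U: "open U" "p \<in> U" "parallel_frame U Q"
      using parallel_frame_exists[of "\<lambda>v. v" p] by (auto simp: linear_ident)
    have "\<exists>f. parallel_frame U f \<and> f q = L" if q: "q \<in> U" and L: "linear L" "inj L" for q L
    proof -
      note i = parallel_frame_inverse[OF U(3) q]
      have "inj (inv (Q q))" by (rule inj_on_inverseI[where g = "Q q"]) (rule i(1))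
      then have "parallel_frame U (\<lambda>r w. Q r ((inv (Q q) \<circ> L) w))"
        using parallel_frame_compose[OF U(3), of "inv (Q q) \<circ> L"] linear_compose[OF L(1) i(3)] inj_compose L by blast
      moreover have "(\<lambda>w. Q q ((inv (Q q) \<circ> L) w)) = L" by (simp add: i(1))
      ultimately show ?thesis by (intro exI[of _ "\<lambda>r w. Q r ((inv (Q q) \<circ> L) w)"]) simp
    qed
    with U show "\<exists>U. open U \<and> p \<in> U \<and> (\<forall>q\<in>U. \<forall>b\<in>{L. linear L \<and> inj L}. \<exists>f. parallel_frame U f \<and> f q = b)"
      by blast
  next
    fix U :: "'m set" and f g p q
    assume U: "open U" "connected U" and fg: "parallel_frame U f" "parallel_frame U g" and pq: "p \<in> U" "q \<in> U" "f p = g p"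
    have "f q w = g q w" for w
    proof -
      have "parallel_field A nabla U (\<lambda>q. f q w)" using fg by (simp add: parallel_frame_def)
      from parallel_field_eq_frame[OF fg(2) U this pq(1,2)] show ?thesis
        using parallel_frame_inverse(2)[OF fg(2) pq(1)] by (simp add: pq(3))
    qed
    then show "f q = g q" by (rule ext)
  next
    fix U :: "'m set" and p
    assume "open U" "p \<in> U"
    then show "\<exists>N. open N \<and> path_connected N \<and> p \<in> N \<and> N \<subseteq> U" by (rule connected_neighbourhood) blast
  qed (auto simp: parallel_frame_subset, auto simp: parallel_frame_def)
  have "(\<lambda>v. v) \<in> {L :: complex^'n \<Rightarrow> complex^'n. linear L \<and> inj L}" by (simp add: linear_ident)
  from global_section[OF sc this, of undefined] obtain Q where
    Q: "\<forall>p. \<exists>N s. open N \<and> p \<in> N \<and> parallel_frame N s \<and> (\<forall>q\<in>N. Q q = s q)"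
    by (elim exE conjE) (rule that)
  have near: thesis if "\<And>N s. open N \<Longrightarrow> p \<in> N \<Longrightarrow> parallel_frame N s \<Longrightarrow> \<forall>q\<in>N. Q q = s q \<Longrightarrow> thesis" for p thesis
    using spec[OF Q, of p] by (elim exE conjE) (rule that)
  have "parallel_frame UNIV Q"
    unfolding parallel_frame_def
  proof (intro conjI ballI allI)
    show "linear (Q q)" "inj (Q q)" for q
      by (rule near[of q], simp add: parallel_frame_def)+
    fix w
    have *: "\<exists>N. open N \<and> p \<in> N \<and> parallel_field A nabla N (\<lambda>q. Q q w)" for p
    proof -
      obtain N s where N: "open N" "p \<in> N" "parallel_frame N s" "\<forall>q\<in>N. Q q = s q" by (rule near)
      have s: "parallel_field A nabla N (\<lambda>q. s q w)" using N(3) by (simp add: parallel_frame_def)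
      have "vector_field A N (\<lambda>q. Q q w)"
        by (rule vector_field_cong[OF N(1), of "\<lambda>q. s q w"]) (use N(4) s in \<open>auto simp: parallel_field_def\<close>)
      moreover have "nabla q v (\<lambda>q. Q q w) = 0" if "q \<in> N" for q v
        using nabla_cong[OF N(1) _ _ that, of "\<lambda>q. s q w" "\<lambda>q. Q q w" v] s N(4) that by (simp add: parallel_field_def)
      ultimately show ?thesis using N by (auto simp: parallel_field_def)
    qed
    have "vector_field A UNIV (\<lambda>q. Q q w)"
    proof (rule vector_field_local)
      fix p
      from *[of p] show "\<exists>N. open N \<and> p \<in> N \<and> vector_field A N (\<lambda>q. Q q w)"
        by (auto simp: parallel_field_def)
    qed
    moreover have "nabla p v (\<lambda>q. Q q w) = 0" for p v
      using *[of p] by (auto simp: parallel_field_def)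
    ultimately show "parallel_field A nabla UNIV (\<lambda>q. Q q w)" by (simp add: parallel_field_def)
  qed
  then show ?thesis by blast
qed

end

section \<open>Conic actions\<close>

interpretation KP: complex_structure "\<lambda>(m :: complex, v :: complex^'n). (\<i> * m, cstruct v)"
proof (rule complex_structure.intro)
  show "linear (\<lambda>(m :: complex, v :: complex^'n). (\<i> * m, cstruct v))"
    by (rule linearI) (auto simp: cstruct_def vec_eq_iff algebra_simps)
  show "(\<lambda>(m :: complex, v :: complex^'n). (\<i> * m, cstruct v)) ((\<lambda>(m, v). (\<i> * m, cstruct v)) p) = - p" for p
    by (cases p) (simp add: J.I_I flip: mult.assoc)
qed

lemma complex_scale_eq: "l *s v = Re l *\<^sub>R v + Im l *\<^sub>R cstruct v" for v :: "complex^'k"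
  by (simp add: vec_eq_iff complex_eq_iff cstruct_def)

lemma linear_complex_scale:
  fixes D :: "complex^'a \<Rightarrow> complex^'b"
  assumes "linear D" "\<And>v. D (cstruct v) = \<i> *s D v"
  shows "D (l *s v) = l *s D v"
  using assms unfolding complex_scale_eq by (simp add: linear_add linear_scale cstruct_def)

locale framed_manifold = flat_manifold A nabla for A :: "('m::topological_space, 'n::finite) chart set" and nabla +
  fixes Q :: "'m \<Rightarrow> complex^'n \<Rightarrow> complex^'n"
  assumes frame: "parallel_frame UNIV Q" and connected_UNIV: "connected (UNIV :: 'm set)"
begin

definition \<theta> :: "'m \<Rightarrow> complex^'n \<Rightarrow> complex^'n" where
  "\<theta> q = inv (Q q)"

lemma Q_\<theta> [simp]: "Q q (\<theta> q u) = u" and \<theta>_Q [simp]: "\<theta> q (Q q u) = u" and linear_\<theta>: "linear (\<theta> q)"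
  using parallel_frame_inverse[OF frame UNIV_I] by (simp_all add: \<theta>_def)

lemma linear_Q: "linear (Q q)"
  using frame by (simp add: parallel_frame_def)

lemma parallel_Q: "parallel_field A nabla UNIV (\<lambda>q. Q q w)"
  using frame by (simp add: parallel_frame_def)

lemma Tr_complex_scale:
  assumes "c \<in> A" "c' \<in> A" "p \<in> chart_dom c" "p \<in> chart_dom c'"
  shows "Tr c c' p (l *s v) = l *s Tr c c' p v"
  by (rule linear_complex_scale[OF Tr_linear[OF assms]]) (simp add: Tr_deriv(2)[OF assms], simp add: cstruct_def)

end

locale conic_manifold = framed_manifold A nabla Q for A :: "('m::topological_space, 'n::finite) chart set" and nabla Q +
  fixes W :: "(complex \<times> 'm) set" and act :: "complex \<Rightarrow> 'm \<Rightarrow> 'm"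
  assumes conic_action: "conic_action A nabla W act"
begin

lemma local_action: "local_action A W act"
  using conic_action by (simp add: conic_action_def)

lemma open_W: "open W" and W_nonzero: "(l, p) \<in> W \<Longrightarrow> l \<noteq> 0" and one_W [simp]: "(1, p) \<in> W"
  and act_continuous: "continuous_on W (\<lambda>(l, p). act l p)" and act_1 [simp]: "act 1 p = p"
  and act_act: "(m, p) \<in> W \<Longrightarrow> (l, act m p) \<in> W \<Longrightarrow> (l * m, p) \<in> W \<Longrightarrow> act l (act m p) = act (l * m) p"
  using local_action unfolding local_action_def by blast+

lemma act_derivative:
  assumes "c \<in> A" "c' \<in> A" "p \<in> chart_dom c" "(l, p) \<in> W" "act l p \<in> chart_dom c'"
  shows "\<exists>D. ((\<lambda>(m, x). chart_map c' (act m (chart_inv c x))) has_derivative D) (at (l, chart_map c p)) \<and>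
    (\<forall>a m v. D (a * m, a *s v) = a *s D (m, v))"
  using local_action assms unfolding local_action_def by blast

lemma open_act_preimage: "open V \<Longrightarrow> open {z \<in> W. act (fst z) (snd z) \<in> V}"
  using continuous_open_preimage[OF act_continuous open_W, of V]
  by (simp add: case_prod_unfold vimage_def Int_def)

lemma act_nbhd:
  assumes "open V" "p \<in> V"
  shows "\<exists>e N. e > 0 \<and> open N \<and> p \<in> N \<and> (\<forall>l\<in>ball 1 e. \<forall>q\<in>N. (l, q) \<in> W \<and> act l q \<in> V)"
proof -
  have "(1, p) \<in> {z \<in> W. act (fst z) (snd z) \<in> V}" using assms by simp
  from bspec[OF open_act_preimage[OF assms(1), unfolded open_prod_def] this]
  obtain L N where LN: "open L" "open N" "1 \<in> L" "p \<in> N" "L \<times> N \<subseteq> {z \<in> W. act (fst z) (snd z) \<in> V}" by auto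
  obtain e where e: "e > 0" "ball 1 e \<subseteq> L" using LN(1,3) open_contains_ball by blast
  have "(l, q) \<in> W \<and> act l q \<in> V" if "l \<in> ball 1 e" "q \<in> N" for l q
    using subsetD[OF LN(5), of "(l, q)"] subsetD[OF e(2) that(1)] that(2) by simp
  with LN(2,4) e(1) show ?thesis by (intro exI[of _ e] exI[of _ N]) auto
qed

lemma continuous_act:
  assumes "{l} \<times> U \<subseteq> W"
  shows "continuous_on U (act l)"
proof -
  have "continuous_on U (\<lambda>q. case (l, q) of (l, p) \<Rightarrow> act l p)"
    by (rule continuous_on_compose2[OF act_continuous]) (use assms in \<open>auto intro!: continuous_intros\<close>)
  then show ?thesis by simp
qed

lemma act_hol:
  assumes c: "c \<in> A" "c' \<in> A"
  shows "KP.hol (\<lambda>(m, x). chart_map c' (act m (chart_inv c x)))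
    {(l, x). x \<in> img c \<and> (l, chart_inv c x) \<in> W \<and> act l (chart_inv c x) \<in> chart_dom c'}"
  unfolding KP.hol_def
proof clarify
  fix l x p assume "p \<in> chart_dom c" "(l, chart_inv c (chart_map c p)) \<in> W" "act l (chart_inv c (chart_map c p)) \<in> chart_dom c'"
  then obtain D where D: "((\<lambda>(m, x). chart_map c' (act m (chart_inv c x))) has_derivative D) (at (l, chart_map c p))"
    "\<forall>a m v. D (a * m, a *s v) = a *s D (m, v)"
    using act_derivative[OF c, of p l] c by auto
  have "D (case v of (m, v) \<Rightarrow> (\<i> * m, cstruct v)) = \<i> *s D v" for v
    using D(2) by (cases v) (simp add: cstruct_def)
  with D(1) show "\<exists>D. ((\<lambda>(m, x). chart_map c' (act m (chart_inv c x))) has_derivative D) (at (l, chart_map c p)) \<and>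
      (\<forall>v. D (case v of (m, v) \<Rightarrow> (\<i> * m, cstruct v)) = \<i> *s D v)" by blast
qed

lemma act_smooth:
  assumes U: "open U" "{l} \<times> U \<subseteq> W"
  shows "smooth_map A U (act l)"
  unfolding smooth_map_def
proof (intro conjI ballI)
  show cont: "continuous_on U (act l)" by (rule continuous_act[OF U(2)])
  fix c c' assume c: "c \<in> A" "c' \<in> A"
  let ?V = "U \<inter> act l -` chart_dom c'"
  have "open ?V" by (rule continuous_open_preimage[OF cont U(1) chart(1)[OF c(2)]])
  then have V: "open (chart_map c ` (?V \<inter> chart_dom c))" by (rule open_chart_image[OF c(1)])
  have "J.hol (\<lambda>x. chart_map c' (act l (chart_inv c x))) (chart_map c ` (?V \<inter> chart_dom c))"
    unfolding J.hol_def
  proof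
    fix x assume "x \<in> chart_map c ` (?V \<inter> chart_dom c)"
    then obtain p where p: "p \<in> ?V" "p \<in> chart_dom c" "x = chart_map c p" by auto
    obtain D where D: "((\<lambda>(m, x). chart_map c' (act m (chart_inv c x))) has_derivative D) (at (l, x))"
      "\<forall>a m v. D (a * m, a *s v) = a *s D (m, v)"
      using act_derivative[OF c p(2), of l] p U(2) by auto
    have "((\<lambda>x. (l, x)) has_derivative (\<lambda>v. (0, v))) (at x)" by (auto intro!: derivative_eq_intros)
    from has_derivative_compose[OF this D(1)]
    have "((\<lambda>x. chart_map c' (act l (chart_inv c x))) has_derivative (\<lambda>v. D (0, v))) (at x)" by simp
    moreover have "D (0, cstruct v) = \<i> *s D (0, v)" for v
      using D(2)[rule_format, of \<i> 0 v] by (simp add: cstruct_def)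
    ultimately show "\<exists>D. ((\<lambda>x. chart_map c' (act l (chart_inv c x))) has_derivative D) (at x) \<and> (\<forall>v. D (cstruct v) = \<i> *s D v)"
      by blast
  qed
  from J.hol_smooth_on[OF V this]
  show "smooth_on (chart_map c' \<circ> act l \<circ> chart_inv c) (chart_map c ` (U \<inter> chart_dom c \<inter> act l -` chart_dom c'))"
    by (simp add: o_def Int_ac)
qed

text \<open>The derivative formula in \<open>conic_action\<close> is available only where the action
  is a diffeomorphism onto its image. Near scalar 1 the inverse is the action of
  \<open>1 / l\<close>.\<close>

lemma act_diffeo:
  "\<exists>e N. e > 0 \<and> open N \<and> p \<in> N \<and> (\<forall>l\<in>ball 1 e. {l} \<times> N \<subseteq> W \<and> diffeo_onto_image A N (act l))"
proof -
  obtain e1 N1 where 1: "e1 > 0" "open N1" "p \<in> N1" "\<And>l q. l \<in> ball 1 e1 \<Longrightarrow> q \<in> N1 \<Longrightarrow> (l, q) \<in> W"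
    using act_nbhd[OF open_UNIV UNIV_I, of p] by blast
  obtain e2 N2 where 2: "e2 > 0" "open N2" "p \<in> N2"
    "\<And>l q. l \<in> ball 1 e2 \<Longrightarrow> q \<in> N2 \<Longrightarrow> (l, q) \<in> W \<and> act l q \<in> N1"
    using act_nbhd[OF 1(2,3)] by blast
  have "isCont (\<lambda>l::complex. 1 / l) 1" by (auto intro!: continuous_intros)
  from continuous_at_ball[THEN iffD1, rule_format, OF this 1(1)]
  obtain e3 where e3: "e3 > 0" "(\<lambda>l. 1 / l) ` ball (1::complex) e3 \<subseteq> ball (1 / 1) e1" by auto
  have 3: "e3 > 0" "\<And>l::complex. l \<in> ball 1 e3 \<Longrightarrow> 1 / l \<in> ball 1 e1"
    using e3(1) subsetD[OF e3(2) imageI] by auto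
  \<comment> \<open>\<open>N2\<close> is carried into \<open>N1\<close>, and on \<open>N1\<close>
    the scalar \<open>1 / l\<close> acts. The composites have scalar 1, which is always admissible,
    so \<open>act_act\<close> makes the two maps mutually inverse.\<close>
  define N where "N = N1 \<inter> N2"
  have N: "open N" "p \<in> N" using 1 2 by (auto simp: N_def)
  have "{l} \<times> N \<subseteq> W \<and> diffeo_onto_image A N (act l)" if l: "l \<in> ball 1 (min e2 e3)" for l
  proof -
    have l2: "l \<in> ball 1 e2" and l3: "1 / l \<in> ball 1 e1" using l 3 by auto
    have lN: "{l} \<times> N \<subseteq> W" using 2(4)[OF l2] by (auto simp: N_def)
    have l0: "l \<noteq> 0" using W_nonzero[of l p] lN N by auto
    have inv: "act (1 / l) (act l q) = q" "act l q \<in> N1" if "q \<in> N" for q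
    proof -
      show 4: "act l q \<in> N1" using 2(4)[OF l2] that by (simp add: N_def)
      show "act (1 / l) (act l q) = q"
        using act_act[of l q "1 / l"] 2(4)[OF l2, of q] 1(4)[OF l3 4] that l0 by (simp add: N_def)
    qed
    have inv': "act l (act (1 / l) q) = q" if "q \<in> N1" "act (1 / l) q \<in> N" for q
      using act_act[of "1 / l" q l] 1(4)[OF l3 that(1)] 2(4)[OF l2, of "act (1 / l) q"] that l0 by (simp add: N_def)
    have im: "act l ` N = N1 \<inter> act (1 / l) -` N"
    proof
      show "act l ` N \<subseteq> N1 \<inter> act (1 / l) -` N" using inv by auto
      show "N1 \<inter> act (1 / l) -` N \<subseteq> act l ` N"
      proof
        fix q assume "q \<in> N1 \<inter> act (1 / l) -` N"
        then have "q = act l (act (1 / l) q)" "act (1 / l) q \<in> N" using inv'[of q] by simp_all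
        then show "q \<in> act l ` N" by (rule image_eqI)
      qed
    qed
    have lW: "{1 / l} \<times> N1 \<subseteq> W" using 1(4)[OF l3] by auto
    have op: "open (act l ` N)"
      unfolding im by (rule continuous_open_preimage[OF continuous_act[OF lW] 1(2) N(1)])
    have inj: "inj_on (act l) N" by (rule inj_on_inverseI[where g = "act (1 / l)"]) (rule inv(1))
    have s: "smooth_map A (act l ` N) (act (1 / l))"
      by (rule act_smooth[OF op]) (use lW im in auto)
    have ii: "inv_into N (act l) q = act (1 / l) q" if "q \<in> act l ` N" for q
      using that inv_into_f_f[OF inj] inv(1) by auto
    have "smooth_map A (act l ` N) (inv_into N (act l))"
      unfolding smooth_map_def
    proof (intro conjI ballI)
      show "continuous_on (act l ` N) (inv_into N (act l))"
        by (rule continuous_on_eq[of _ "act (1 / l)"]) (use s ii in \<open>simp_all add: smooth_map_def\<close>)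
      fix c c' assume c: "c \<in> A" "c' \<in> A"
      have eq: "act l ` N \<inter> chart_dom c \<inter> inv_into N (act l) -` chart_dom c' =
          act l ` N \<inter> chart_dom c \<inter> act (1 / l) -` chart_dom c'" using ii by auto
      have cont: "continuous_on (act l ` N) (act (1 / l))" using s by (simp add: smooth_map_def)
      have "open (act l ` N \<inter> act (1 / l) -` chart_dom c')"
        by (rule continuous_open_preimage[OF cont op chart(1)[OF c(2)]])
      from open_chart_image[OF c(1) this]
      have o: "open (chart_map c ` (act l ` N \<inter> chart_dom c \<inter> act (1 / l) -` chart_dom c'))"
        by (simp add: Int_ac)
      show "smooth_on (chart_map c' \<circ> inv_into N (act l) \<circ> chart_inv c)
          (chart_map c ` (act l ` N \<inter> chart_dom c \<inter> inv_into N (act l) -` chart_dom c'))"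
        unfolding eq
      proof (rule smooth_on_cong[OF o])
        show "smooth_on (chart_map c' \<circ> act (1 / l) \<circ> chart_inv c)
          (chart_map c ` (act l ` N \<inter> chart_dom c \<inter> act (1 / l) -` chart_dom c'))"
          using s c by (simp add: smooth_map_def)
        fix x assume "x \<in> chart_map c ` (act l ` N \<inter> chart_dom c \<inter> act (1 / l) -` chart_dom c')"
        then obtain q where "q \<in> act l ` N" "q \<in> chart_dom c" "x = chart_map c q" by blast
        then show "(chart_map c' \<circ> act (1 / l) \<circ> chart_inv c) x = (chart_map c' \<circ> inv_into N (act l) \<circ> chart_inv c) x"
          using ii c by simp
      qed
    qed
    moreover have "smooth_map A N (act l)" by (rule act_smooth[OF N(1) lN])
    ultimately show ?thesis using lN op inj by (simp add: diffeo_onto_image_def)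
  qed
  with N 2(1) 3(1) show ?thesis by (intro exI[of _ "min e2 e3"] exI[of _ N]) auto
qed

text \<open>The frame is parallel on the whole connected manifold, so \<open>UNIV\<close> can serve
  as the set \<open>D\<close> of \<open>conic_action\<close>.\<close>

lemma conic_formula:
  "\<exists>e N. e > 0 \<and> open N \<and> p \<in> N \<and> (\<forall>l\<in>ball 1 e. \<forall>q\<in>N. (l, q) \<in> W \<and>
     (\<forall>w. mdiff_map A (act l) q (Q q w) = l *s Q (act l q) w))"
proof -
  obtain e N where eN: "e > 0" "open N" "p \<in> N" "\<forall>l\<in>ball 1 e. {l} \<times> N \<subseteq> W \<and> diffeo_onto_image A N (act l)"
    using act_diffeo[of p] by (elim exE conjE) (rule that)
  have rule: "mdiff_map A (act l) q (X q) = Re l *\<^sub>R X (act l q) + Im l *\<^sub>R cstruct (X (act l q))"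
    if "open U" "{l} \<times> U \<subseteq> W" "diffeo_onto_image A U (act l)" "open D" "connected D" "U \<subseteq> D" "act l ` U \<subseteq> D"
      "parallel_field A nabla D X" "q \<in> U" for l U D X q
    using conic_action[unfolded conic_action_def, THEN conjunct2, THEN spec[of _ l], THEN spec[of _ U],
        THEN spec[of _ D], THEN spec[of _ X]] that by simp
  have "mdiff_map A (act l) q (Q q w) = l *s Q (act l q) w" if "l \<in> ball 1 e" "q \<in> N" for l q w
    using rule[OF eN(2) _ _ open_UNIV connected_UNIV subset_UNIV subset_UNIV parallel_Q that(2)] bspec[OF eN(4) that(1)]
    by (simp add: complex_scale_eq)
  moreover have "(l, q) \<in> W" if "l \<in> ball 1 e" "q \<in> N" for l q
    using bspec[OF eN(4) that(1)] that(2) by auto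
  ultimately show ?thesis using eN(1-3) by (intro exI[of _ e] exI[of _ N]) simp
qed

end

lemma cstruct_eq_0_iff [simp]: "cstruct v = 0 \<longleftrightarrow> v = 0"
  by (simp add: cstruct_def vec_eq_iff)

context atlas
begin

lemma has_mderiv_bounded_linear:
  assumes "bounded_linear h" "has_mderiv f p D"
  shows "has_mderiv (\<lambda>q. h (f q)) p (\<lambda>v. h (D v))"
  using bounded_linear.has_derivative[OF assms(1) assms(2)[unfolded has_mderiv_def]]
  unfolding has_mderiv_def by (simp add: o_def)

lemma has_mderiv_Pair:
  assumes "has_mderiv f p D" "has_mderiv g p E"
  shows "has_mderiv (\<lambda>q. (f q, g q)) p (\<lambda>v. (D v, E v))"
  using has_derivative_Pair[OF assms[unfolded has_mderiv_def]] unfolding has_mderiv_def by (simp add: o_def)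

end

text \<open>The minus sign turns the values of \<alpha> on \<open>v\<close> and on J\<open>v\<close>
  into \<alpha>(v) - i \<alpha>(Jv), which is complex linear in \<open>v\<close>.\<close>

definition cvec :: "(real^'k) \<times> (real^'k) \<Rightarrow> complex^'k" where
  "cvec p = (\<chi> k. Complex (fst p $ k) (- (snd p $ k)))"

lemma bounded_linear_cvec: "bounded_linear (cvec :: (real^'k) \<times> (real^'k) \<Rightarrow> complex^'k)"
  unfolding linear_conv_bounded_linear[symmetric]
  by (rule linearI) (simp_all add: cvec_def vec_eq_iff complex_eq_iff)

section \<open>Complexified parallel one-forms and maps having them as differential\<close>

context framed_manifold
begin

text \<open>
  The complex linear extension \<open>\<alpha> - \<i> \<alpha> \<circ> J\<close> of the parallel one-form \<open>\<alpha> = L \<circ> \<theta>\<close>.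
\<close>

definition Phi :: "(complex^'n \<Rightarrow> real^'k) \<Rightarrow> 'm \<Rightarrow> complex^'n \<Rightarrow> complex^'k" where
  "Phi L q v = cvec (L (\<theta> q v), L (\<theta> q (cstruct v)))"

lemma Phi_component:
  "Re (Phi L q v $ k) = L (\<theta> q v) $ k" "Im (Phi L q v $ k) = - (L (\<theta> q (cstruct v)) $ k)"
  by (simp_all add: Phi_def cvec_def)

lemma linear_Phi:
  assumes "linear L"
  shows "linear (Phi L q)"
  by (rule linearI)
     (simp_all add: vec_eq_iff complex_eq_iff Phi_component linear_add[OF assms] linear_scale[OF assms]
       linear_add[OF linear_\<theta>] linear_scale[OF linear_\<theta>] linear_add[OF J.linear_I] linear_scale[OF J.linear_I])

lemma Phi_cstruct:
  assumes "linear L"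
  shows "Phi L q (cstruct v) = \<i> *s Phi L q v"
  by (simp add: vec_eq_iff complex_eq_iff Phi_component J.I_I linear_neg[OF linear_\<theta>] linear_neg[OF assms])

lemma Phi_real_eq_0:
  assumes "linear L" "inj L" "\<And>k. Re (Phi L q v $ k) = 0"
  shows "v = 0"
proof -
  have "L (\<theta> q v) = 0" using assms(3) by (simp add: vec_eq_iff Phi_component)
  then have "\<theta> q v = 0" using linear_injective_0[OF assms(1)] assms(2) by blast
  then show ?thesis using Q_\<theta>[of q v] linear_0[OF linear_Q] by simp
qed

lemma holomorphic_immersionI:
  assumes L: "linear L" "inj L" and \<phi>: "\<And>q. has_mderiv \<phi> q (Phi L q)"
  shows "holomorphic_immersion A \<phi>"
  unfolding holomorphic_immersion_def holomorphic_map_on_iff J.hol_def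
proof (intro conjI ballI allI)
  fix c x assume c: "c \<in> A" and "x \<in> img c"
  then obtain p where p: "p \<in> chart_dom c" "x = chart_map c p" by auto
  show "\<exists>D. ((\<phi> \<circ> chart_inv c) has_derivative D) (at x) \<and> (\<forall>v. D (cstruct v) = \<i> *s D v)"
    using has_mderivD[OF c p(1) \<phi>] Tr_deriv(2)[OF c chart_at(1) p(1) chart_at(2)] Phi_cstruct[OF L(1)]
    unfolding p(2) by (intro exI conjI) auto
next
  fix p
  have "v = 0" if "Phi L p v = 0" for v
    by (rule Phi_real_eq_0[OF L, of p]) (simp add: that)
  then show "inj (mdiff A \<phi> p)"
    unfolding mdiff_eq[OF \<phi>] using linear_injective_0[OF linear_Phi[OF L(1)]] by blast
qed

text \<open>A real vector in the image has vanishing imaginary part, and up to sign this is the real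
  part of the image of \<open>cstruct v\<close>. Real parts already determine a tangent
  vector.\<close>

lemma totally_complexI:
  fixes \<phi> :: "'m \<Rightarrow> 'n cotangent"
  assumes L: "linear L" "inj L" and \<phi>: "\<And>q. has_mderiv \<phi> q (Phi L q)"
  shows "totally_complex A \<phi>"
  unfolding totally_complex_def
proof
  fix p
  have "v = 0" if "tau (Phi L p v) = Phi L p v" for v
  proof -
    have "Im (Phi L p v $ k) = 0" for k
      using arg_cong[OF that, of "\<lambda>z. z $ k"] by (simp add: tau_def complex_eq_iff)
    then have "cstruct v = 0"
      by (intro Phi_real_eq_0[OF L, of p]) (simp add: Phi_cstruct[OF L(1)])
    then show "v = 0" by simp
  qed
  moreover have "Phi L p 0 = 0" by (rule linear_0[OF linear_Phi[OF L(1)]])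
  moreover have "tau (0 :: 'n cotangent) = 0" by (simp add: tau_def vec_eq_iff)
  ultimately show "{v. tau v = v} \<inter> range (mdiff A \<phi> p) = {0}"
    unfolding mdiff_eq[OF \<phi>] by (auto simp: image_iff intro!: exI[of _ 0])
qed

lemma smooth_fun_of_hol:
  assumes "holomorphic_immersion A \<phi>" "bounded_linear h"
  shows "smooth_fun A UNIV (\<lambda>q. h (\<phi> q))"
  unfolding smooth_fun_def
proof
  fix c assume c: "c \<in> A"
  have "smooth_on (\<phi> \<circ> chart_inv c) (img c)"
    using smooth_on_holomorphic[OF chart(2)[OF c]] assms(1) c unfolding holomorphic_immersion_def by blast
  from smooth_on_bounded_linear[OF chart(2)[OF c] assms(2) this]
  show "smooth_on ((\<lambda>q. h (\<phi> q)) \<circ> chart_inv c) (chart_map c ` (UNIV \<inter> chart_dom c))"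
    by (simp add: o_def)
qed

lemma bounded_linear_Re_component: "bounded_linear (\<lambda>z :: complex^'k. Re (z $ k))"
  by (rule bounded_linear_compose[OF bounded_linear_Re bounded_linear_vec_nth])

text \<open>The real part of the differential is a constant linear function of the parallel coframe,
  hence commutes with covariant differentiation.\<close>

lemma affine_functionI:
  fixes \<phi> :: "'m \<Rightarrow> 'n cotangent"
  assumes L: "linear L" "inj L" and \<phi>: "\<And>q. has_mderiv \<phi> q (Phi L q)"
  shows "affine_function A nabla (\<lambda>p. Re (\<phi> p $ k))"
  unfolding affine_function_def
proof (intro conjI allI impI ballI)
  show "smooth_fun A UNIV (\<lambda>p. Re (\<phi> p $ k))"
    by (rule smooth_fun_of_hol[OF holomorphic_immersionI[OF L \<phi>] bounded_linear_Re_component])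
  have d: "mdiff A (\<lambda>p. Re (\<phi> p $ k)) q = (\<lambda>v. L (\<theta> q v) $ k)" for q
    using mdiff_eq[OF has_mderiv_bounded_linear[OF bounded_linear_Re_component \<phi>]] by (simp add: Phi_component)
  fix U Y p v assume UY: "open U \<and> vector_field A U Y" and p: "p \<in> U"
  have "bounded_linear (\<lambda>u. L u $ k)"
    using bounded_linear_compose[OF bounded_linear_vec_nth] L(1) linear_conv_bounded_linear by blast
  from has_mderiv_bounded_linear[OF this coframe_mderiv_field[OF parallel_frame_subset[OF frame] _ p]] UY
  have "has_mderiv (\<lambda>q. L (\<theta> q (Y q)) $ k) p (\<lambda>v. L (\<theta> p (nabla p v Y)) $ k)"
    by (simp add: \<theta>_def)
  from mdiff_eq[OF this] show "mdiff A (\<lambda>q. mdiff A (\<lambda>p. Re (\<phi> p $ k)) q (Y q)) p v =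
      mdiff A (\<lambda>p. Re (\<phi> p $ k)) p (nabla p v Y)"
    unfolding d by simp
qed

end

section \<open>The Euler field of the action and its homogeneous holomorphic functions\<close>

context conic_manifold
begin

definition DF :: "('m, 'n) chart \<Rightarrow> complex \<times> (complex^'n) \<Rightarrow> complex \<times> (complex^'n) \<Rightarrow> complex^'n" where
  "DF c z = frechet_derivative (\<lambda>(m, x). chart_map c (act m (chart_inv c x))) (at z)"

definition Dom :: "('m, 'n) chart \<Rightarrow> (complex \<times> (complex^'n)) set" where
  "Dom c = {(l, x). x \<in> img c \<and> (l, chart_inv c x) \<in> W \<and> act l (chart_inv c x) \<in> chart_dom c}"

lemma open_Dom:
  assumes c: "c \<in> A"
  shows "open (Dom c)"
proof -
  have "continuous_on (UNIV \<times> img c) (\<lambda>z. (fst z, chart_inv c (snd z)))"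
    by (intro continuous_intros continuous_on_compose2[OF chart(4)[OF c]]) auto
  from continuous_open_preimage[OF this open_Times[OF open_UNIV chart(2)[OF c]] open_act_preimage[OF chart(1)[OF c]]]
  show ?thesis by (rule back_subst[of "open"]) (auto simp: Dom_def)
qed

lemma hol_act: "c \<in> A \<Longrightarrow> KP.hol (\<lambda>(m, x). chart_map c (act m (chart_inv c x))) (Dom c)"
  unfolding Dom_def by (rule act_hol)

lemma DF_deriv:
  assumes "c \<in> A" "z \<in> Dom c"
  shows "((\<lambda>(m, x). chart_map c (act m (chart_inv c x))) has_derivative DF c z) (at z)"
    and "DF c z (\<i> * m, cstruct v) = \<i> *s DF c z (m, v)"
  using KP.holD[OF hol_act[OF assms(1)] assms(2)] KP.holD(2)[OF hol_act[OF assms(1)] assms(2), of "(m, v)"]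
  unfolding DF_def by simp_all

lemma one_Dom: "c \<in> A \<Longrightarrow> p \<in> chart_dom c \<Longrightarrow> (1, chart_map c p) \<in> Dom c"
  by (simp add: Dom_def)

lemma act_velocity:
  assumes c: "c \<in> A" "p \<in> chart_dom c"
  shows "((\<lambda>l. chart_map c (act l p)) has_derivative (\<lambda>m. DF c (1, chart_map c p) (m, 0))) (at 1)"
proof -
  have "((\<lambda>l. (l, chart_map c p)) has_derivative (\<lambda>m. (m, 0))) (at 1)"
    by (auto intro!: derivative_eq_intros)
  from has_derivative_compose[OF this DF_deriv(1)[OF c(1) one_Dom[OF c]]]
  show ?thesis using c by simp
qed

text \<open>The velocity of the orbit of \<open>q\<close> at scalar 1 in direction \<open>m\<close>:
  \<open>euler 1\<close> is the Euler field \<xi> and \<open>euler \<i>\<close> is J\<xi>. Keeping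
  \<open>m\<close> free lets one computation cover both.\<close>

definition euler :: "complex \<Rightarrow> 'm \<Rightarrow> complex^'n" where
  "euler m q = DF (chart_at A q) (1, chart_map (chart_at A q) q) (m, 0)"

text \<open>The chart in the definition of \<open>euler\<close> changes with \<open>q\<close>; to be
  differentiated near a point the field must be read in one fixed chart.\<close>

lemma euler_rep:
  assumes c: "c \<in> A" "q \<in> chart_dom c"
  shows "field_rep A c (euler m) (chart_map c q) = DF c (1, chart_map c q) (m, 0)"
proof -
  let ?c = "chart_at A q"
  have c': "?c \<in> A" "q \<in> chart_dom ?c" by (rule chart_at)+
  obtain e N where eN: "e > 0" "q \<in> N" "\<forall>l\<in>ball 1 e. \<forall>q\<in>N. (l, q) \<in> W \<and> act l q \<in> chart_dom ?c"
    using act_nbhd[OF chart(1)[OF c'(1)] c'(2)] by blast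
  have "((\<lambda>l. (chart_map c \<circ> chart_inv ?c) (chart_map ?c (act l q))) has_derivative
      (\<lambda>m. Tr ?c c q (DF ?c (1, chart_map ?c q) (m, 0)))) (at 1)"
    by (rule has_derivative_compose[OF act_velocity[OF c']]) (use Tr_deriv(1)[OF c'(1) c(1) c'(2) c(2)] in \<open>simp add: o_def\<close>)
  then have "((\<lambda>l. chart_map c (act l q)) has_derivative
      (\<lambda>m. Tr ?c c q (DF ?c (1, chart_map ?c q) (m, 0)))) (at 1)"
    by (rule has_derivative_transform_within_open[of _ _ _ _ "ball 1 e"]) (use eN c' in auto)
  from has_derivative_unique[OF this act_velocity[OF c]]
  show ?thesis unfolding field_rep_chart[OF c] euler_def by (rule fun_cong)
qed

lemma euler_scale: "euler m q = m *s euler 1 q"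
proof -
  let ?c = "chart_at A q" let ?D = "DF ?c (1, chart_map ?c q)"
  have z: "(1, chart_map ?c q) \<in> Dom ?c" by (rule one_Dom[OF chart_at])
  have lin: "linear ?D" by (rule has_derivative_linear[OF DF_deriv(1)[OF chart_at(1) z]])
  have "(m, 0 :: complex^'n) = Re m *\<^sub>R (1, 0) + Im m *\<^sub>R (\<i> * 1, cstruct 0)"
    using linear_0[OF J.linear_I] by (simp add: complex_eq_iff)
  then have "?D (m, 0) = ?D (Re m *\<^sub>R (1, 0) + Im m *\<^sub>R (\<i> * 1, cstruct 0))" by (rule arg_cong)
  also have "\<dots> = Re m *\<^sub>R ?D (1, 0) + Im m *\<^sub>R (\<i> *s ?D (1, 0))"
    unfolding linear_add[OF lin] linear_scale[OF lin] DF_deriv(2)[OF chart_at(1) z] ..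
  finally show ?thesis by (simp add: euler_def complex_scale_eq[of m] cstruct_def)
qed

text \<open>For scalars near 1 the point and its image stay in one chart, so the conic identity
  becomes an equation between functions of the scalar with values in a fixed vector space, ready to
  be differentiated.\<close>

lemma conic_formula_in_chart:
  fixes p :: 'm
  defines "c \<equiv> chart_at A p"
  shows "\<exists>e>0. \<forall>l\<in>ball 1 e. (l, chart_map c p) \<in> Dom c \<and>
    (\<forall>w. DF c (l, chart_map c p) (0, Q p w) = l *s field_rep A c (\<lambda>q. Q q w) (chart_map c (act l p)))"
proof -
  have c: "c \<in> A" "p \<in> chart_dom c" unfolding c_def by (rule chart_at)+
  obtain e1 N1 where 1: "e1 > 0" "p \<in> N1" "\<forall>l\<in>ball 1 e1. \<forall>q\<in>N1. (l, q) \<in> W \<and> act l q \<in> chart_dom c"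
    using act_nbhd[OF chart(1)[OF c(1)] c(2)] by blast
  obtain e2 N2 where 2: "e2 > 0" "p \<in> N2" "\<forall>l\<in>ball 1 e2. \<forall>q\<in>N2. (l, q) \<in> W \<and>
     (\<forall>w. mdiff_map A (act l) q (Q q w) = l *s Q (act l q) w)"
    using conic_formula[of p] by blast
  have "(l, chart_map c p) \<in> Dom c \<and>
    (\<forall>w. DF c (l, chart_map c p) (0, Q p w) = l *s field_rep A c (\<lambda>q. Q q w) (chart_map c (act l p)))"
    if l: "l \<in> ball 1 (min e1 e2)" for l
  proof (intro conjI allI)
    let ?x = "chart_map c p" let ?q = "act l p" let ?c' = "chart_at A ?q"
    have lq: "(l, p) \<in> W" "?q \<in> chart_dom c" using 1 l by auto
    then show z: "(l, ?x) \<in> Dom c" using c by (simp add: Dom_def)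
    fix w
    have c': "?c' \<in> A" "?q \<in> chart_dom ?c'" by (rule chart_at)+
    have "((\<lambda>x. (l, x)) has_derivative (\<lambda>v. (0, v))) (at ?x)" by (auto intro!: derivative_eq_intros)
    from has_derivative_compose[OF this DF_deriv(1)[OF c(1) z]]
    have d: "((\<lambda>x. chart_map c (act l (chart_inv c x))) has_derivative (\<lambda>v. DF c (l, ?x) (0, v))) (at ?x)" by simp
    have "((\<lambda>x. (chart_map ?c' \<circ> chart_inv c) (chart_map c (act l (chart_inv c x)))) has_derivative
        (\<lambda>v. Tr c ?c' ?q (DF c (l, ?x) (0, v)))) (at ?x)"
      by (rule has_derivative_compose[OF d]) (use Tr_deriv(1)[OF c(1) c'(1) lq(2) c'(2)] c in \<open>simp add: o_def\<close>)
    then have "((chart_map ?c' \<circ> act l) \<circ> chart_inv c has_derivative (\<lambda>v. Tr c ?c' ?q (DF c (l, ?x) (0, v)))) (at ?x)"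
    proof (rule has_derivative_transform_within_open)
      show "open ((\<lambda>x. (l, x)) -` Dom c)"
        by (rule open_vimage[OF open_Dom[OF c(1)]]) (auto intro!: continuous_intros)
      show "?x \<in> (\<lambda>x. (l, x)) -` Dom c" using z by simp
    qed (use c in \<open>auto simp: Dom_def\<close>)
    then have "has_mderiv (chart_map ?c' \<circ> act l) p (\<lambda>v. Tr c ?c' ?q (DF c (l, ?x) (0, v)))"
      unfolding has_mderiv_def c_def .
    note dm = mdiff_eq[OF this]
    have "mdiff_map A (act l) p (Q p w) = l *s Q ?q w" using bspec[OF bspec[OF 2(3), of l] 2(2)] l by simp
    then have "Tr c ?c' ?q (DF c (l, ?x) (0, Q p w)) = l *s Q ?q w" unfolding mdiff_map_def dm .
    then have "Tr ?c' c ?q (Tr c ?c' ?q (DF c (l, ?x) (0, Q p w))) = Tr ?c' c ?q (l *s Q ?q w)" by simp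
    then show "DF c (l, ?x) (0, Q p w) = l *s field_rep A c (\<lambda>q. Q q w) (chart_map c ?q)"
      unfolding Tr_inverse[OF c(1) c'(1) lq(2) c'(2)] Tr_complex_scale[OF c'(1) c(1) c'(2) lq(2)]
        field_rep_chart[OF c(1) lq(2)] .
  qed
  with 1(1) 2(1) show ?thesis by (intro exI[of _ "min e1 e2"]) simp
qed

text \<open>
  In terms of the Euler field \<open>\<xi>\<close>, this says \<open>\<nabla>\<xi> = id\<close> for \<open>m = 1\<close> and
  \<open>\<nabla>(J\<xi>) = J\<close> for \<open>m = \<i>\<close>. It is obtained by differentiating \<open>d\<phi>\<^sub>\<lambda> X = \<lambda> X\<close>
  with respect to \<open>\<lambda>\<close> at \<open>1\<close>.
\<close>

lemma euler_mderiv: "has_mderiv (\<lambda>q. \<theta> q (euler m q)) p (\<lambda>v. \<theta> p (m *s v))"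
proof -
  let ?c = "chart_at A p" let ?x = "chart_map ?c p"
  have c: "?c \<in> A" "p \<in> chart_dom ?c" by (rule chart_at)+
  have z: "(1, ?x) \<in> Dom ?c" by (rule one_Dom[OF c])
  note hol = hol_act[OF c(1)] note O = open_Dom[OF c(1)]
  \<comment> \<open>\<open>S (m, 0) (0, u)\<close> is the mixed second derivative of the action. In
    this order it differentiates the Euler field in the point; in the other order it differentiates
    the conic identity in the scalar.\<close>
  define S where "S u = frechet_derivative (\<lambda>z. DF ?c z u) (at (1, ?x))" for u
  have S: "((\<lambda>z. DF ?c z u) has_derivative S u) (at (1, ?x))" for u
    unfolding S_def DF_def
    by (rule smooth_on_has_derivative[OF smooth_on_frechet_derivative[OF KP.hol_smooth_on[OF O hol]] z])
  have S_sym: "S u v = S v u" for u v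
    unfolding S_def DF_def by (rule KP.hol_second_derivative_symmetric[OF O hol z])
  have S_eq: "S (m, 0) (0, u) = m *s u - \<Gamma> ?c ?x (euler m p) u" for u
  proof -
    define w where "w = \<theta> p u"
    have u: "u = Q p w" by (simp add: w_def)
    have Px: "field_rep A ?c (\<lambda>q. Q q w) ?x = u" unfolding field_rep_chart_at u ..
    define g where "g l = field_rep A ?c (\<lambda>q. Q q w) (chart_map ?c (act l p))" for l
    have g1: "g 1 = u" by (simp add: g_def Px)
    have "(g has_derivative (\<lambda>m. - \<Gamma> ?c ?x (DF ?c (1, ?x) (m, 0)) u)) (at 1)"
      unfolding g_def
      by (rule has_derivative_compose[OF act_velocity[OF c]])
         (use parallel_rep_derivative[OF parallel_Q open_UNIV UNIV_I c, of w] Px in simp)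
    then have g': "(g has_derivative (\<lambda>m. - \<Gamma> ?c ?x (euler m p) u)) (at 1)" by (simp add: euler_def)
    \<comment> \<open>The scalar multiplication is split into its real and imaginary part to apply
      the real product rule; at scalar 1 the derivative of \<open>g\<close> enters only through the
      real part.\<close>
    have "((\<lambda>l. Re l *\<^sub>R g l + Im l *\<^sub>R cstruct (g l)) has_derivative
        (\<lambda>m. (Re 1 *\<^sub>R - \<Gamma> ?c ?x (euler m p) u + Re m *\<^sub>R g 1) +
          (Im 1 *\<^sub>R cstruct (- \<Gamma> ?c ?x (euler m p) u) + Im m *\<^sub>R cstruct (g 1)))) (at 1)"
      by (intro has_derivative_add has_derivative_scaleR g' bounded_linear_imp_has_derivative bounded_linear_Re bounded_linear_Im
          bounded_linear.has_derivative[OF J.linear_I[unfolded linear_conv_bounded_linear]])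
    then have R: "((\<lambda>l. l *s g l) has_derivative (\<lambda>m. - \<Gamma> ?c ?x (euler m p) u + m *s u)) (at 1)"
      unfolding complex_scale_eq[symmetric] g1 by (simp add: complex_scale_eq[of m for m] algebra_simps)
    obtain e where e: "e > 0" "\<forall>l\<in>ball 1 e. (l, ?x) \<in> Dom ?c \<and>
      (\<forall>w. DF ?c (l, ?x) (0, Q p w) = l *s field_rep A ?c (\<lambda>q. Q q w) (chart_map ?c (act l p)))"
      using conic_formula_in_chart[of p] by blast
    have "((\<lambda>l. (l, ?x)) has_derivative (\<lambda>m. (m, 0))) (at 1)" by (auto intro!: derivative_eq_intros)
    from has_derivative_compose[OF this S]
    have "((\<lambda>l. DF ?c (l, ?x) (0, u)) has_derivative (\<lambda>m. S (0, u) (m, 0))) (at 1)" .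
    then have "((\<lambda>l. l *s g l) has_derivative (\<lambda>m. S (0, u) (m, 0))) (at 1)"
      by (rule has_derivative_transform_within_open[of _ _ _ _ "ball 1 e"]) (use e in \<open>auto simp: g_def u\<close>)
    from has_derivative_unique[OF this R] have "S (0, u) (m, 0) = - \<Gamma> ?c ?x (euler m p) u + m *s u"
      by (rule fun_cong)
    then show ?thesis by (simp add: S_sym)
  qed
  have "((\<lambda>x. (1, x)) has_derivative (\<lambda>v. (0, v))) (at ?x)" by (auto intro!: derivative_eq_intros)
  from has_derivative_compose[OF this S]
  have "((\<lambda>x. DF ?c (1, x) (m, 0)) has_derivative (\<lambda>u. S (m, 0) (0, u))) (at ?x)" .
  then have "(field_rep A ?c (euler m) has_derivative (\<lambda>u. S (m, 0) (0, u))) (at ?x)"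
    by (rule has_derivative_transform_within_open[OF _ chart(2)[OF c(1)]])
       (use c euler_rep[OF c(1)] in auto)
  \<comment> \<open>\<open>S_eq\<close> contributes \<open>- \<Gamma>\<close> of the Euler vector
    and \<open>v\<close>, the frame contributes \<open>+ \<Gamma>\<close> with these two exchanged.
    Symmetry, that is vanishing torsion, cancels them.\<close>
  from coframe_mderiv[OF frame open_UNIV UNIV_I this]
  show ?thesis
    unfolding S_eq \<theta>_def using Gam_symmetric[OF c(1), of ?x] c by simp
qed

definition phi :: "(complex^'n \<Rightarrow> real^'k) \<Rightarrow> 'm \<Rightarrow> complex^'k" where
  "phi L q = Phi L q (euler 1 q)"

lemma phi_mderiv:
  assumes "linear L"
  shows "has_mderiv (phi L) p (Phi L p)"
proof -
  have "bounded_linear L" using assms linear_conv_bounded_linear by blast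
  then have "has_mderiv (\<lambda>q. L (\<theta> q (euler m q))) p (\<lambda>v. L (\<theta> p (m *s v)))" for m
    by (rule has_mderiv_bounded_linear[OF _ euler_mderiv])
  from has_mderiv_bounded_linear[OF bounded_linear_cvec has_mderiv_Pair[OF this[of 1] this[of \<i>]]]
  show ?thesis by (simp add: phi_def[abs_def] Phi_def[abs_def] cstruct_def euler_scale[of \<i>])
qed

text \<open>The orbit leaves \<open>q\<close> with velocity \<open>euler m q\<close>. The complex
  linear differential of \<open>phi L\<close> sends it to \<open>m\<close> times its value on the
  Euler field, which is \<open>phi L q\<close>: Euler's relation for degree one.\<close>

lemma phi_act_derivative_at_1:
  assumes "linear L"
  shows "((\<lambda>l. phi L (act l q)) has_derivative (\<lambda>m. m *s phi L q)) (at 1)"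
proof -
  let ?c = "chart_at A q"
  have c: "?c \<in> A" "q \<in> chart_dom ?c" by (rule chart_at)+
  obtain e N where eN: "e > 0" "q \<in> N" "\<forall>l\<in>ball 1 e. \<forall>q\<in>N. (l, q) \<in> W \<and> act l q \<in> chart_dom ?c"
    using act_nbhd[OF chart(1)[OF c(1)] c(2)] by blast
  have "((\<lambda>l. (phi L \<circ> chart_inv ?c) (chart_map ?c (act l q))) has_derivative
      (\<lambda>m. Phi L q (DF ?c (1, chart_map ?c q) (m, 0)))) (at 1)"
    by (rule has_derivative_compose[OF act_velocity[OF c]])
       (use phi_mderiv[OF assms, of q] in \<open>simp add: has_mderiv_def o_def\<close>)
  then have "((\<lambda>l. phi L (act l q)) has_derivative (\<lambda>m. Phi L q (DF ?c (1, chart_map ?c q) (m, 0)))) (at 1)"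
    by (rule has_derivative_transform_within_open[of _ _ _ _ "ball 1 e"]) (use eN c in auto)
  moreover have "Phi L q (DF ?c (1, chart_map ?c q) (m, 0)) = m *s phi L q" for m
    using linear_complex_scale[OF linear_Phi[OF assms] Phi_cstruct[OF assms], of q m "euler 1 q"] euler_scale[of m q]
    by (simp add: euler_def phi_def)
  ultimately show ?thesis by simp
qed

text \<open>Near \<open>l\<close> the group law gives
  \<open>act m q = act (m / l) (act l q)\<close>, which transports the derivative at scalar 1 to
  \<open>l\<close>. The open set in the proof collects the \<open>m\<close> for which this law
  applies.\<close>

lemma phi_act_component_derivative:
  assumes L: "linear L" and l: "(l, q) \<in> W"
  shows "((\<lambda>l. phi L (act l q) $ k) has_field_derivative (phi L (act l q) $ k / l)) (at l)"
proof -
  have l0: "l \<noteq> 0" using W_nonzero[OF l] .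
  let ?q = "act l q"
  have "open ((\<lambda>m. (m, q)) -` W)" by (rule open_vimage[OF open_W]) (auto intro!: continuous_intros)
  moreover have "open ((- {0}) \<inter> (\<lambda>m. m / l) -` ((\<lambda>m. (m, ?q)) -` W))"
    by (intro open_Int open_vimage open_W continuous_intros) (use l0 in auto)
  ultimately have op: "open ((\<lambda>m. (m, q)) -` W \<inter> ((- {0}) \<inter> (\<lambda>m. m / l) -` ((\<lambda>m. (m, ?q)) -` W)))"
    (is "open ?O") by (rule open_Int)
  have lO: "l \<in> ?O" using l l0 one_W[of ?q] by simp
  have eq: "act (m / l) ?q = act m q" if "m \<in> ?O" for m
    using act_act[of l q "m / l"] that l l0 by simp
  have "((\<lambda>m. m / l) has_derivative (\<lambda>m. m / l)) (at l)"
    by (rule bounded_linear_imp_has_derivative[OF bounded_linear_divide])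
  moreover have "((\<lambda>l. phi L (act l ?q)) has_derivative (\<lambda>m. m *s phi L ?q)) (at (l / l))"
    using phi_act_derivative_at_1[OF L] l0 by simp
  ultimately have "((\<lambda>m. phi L (act (m / l) ?q)) has_derivative (\<lambda>m. (m / l) *s phi L ?q)) (at l)"
    by (rule has_derivative_compose)
  then have "((\<lambda>m. phi L (act m q)) has_derivative (\<lambda>m. (m / l) *s phi L ?q)) (at l)"
    by (rule has_derivative_transform_within_open[OF _ op lO]) (simp only: eq)
  from bounded_linear.has_derivative[OF bounded_linear_vec_nth[of k] this]
  have "((\<lambda>m. phi L (act m q) $ k) has_derivative (\<lambda>m. (m / l) * phi L ?q $ k)) (at l)" by simp
  then show ?thesis
    unfolding has_field_derivative_def by (rule has_derivative_eq_rhs) (simp add: fun_eq_iff)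
qed

text \<open>By the preceding derivative the quotient of \<open>phi L (act l q)\<close> by
  \<open>l\<close> has derivative zero on a ball about 1, so it keeps its value at
  \<open>l = 1\<close>.\<close>

lemma phi_equivariant:
  assumes L: "linear L"
  shows "\<exists>e N. e > 0 \<and> open N \<and> p \<in> N \<and> (\<forall>l\<in>ball 1 e. \<forall>q\<in>N. (l, q) \<in> W \<and> phi L (act l q) = l *s phi L q)"
proof -
  obtain e N where eN: "e > 0" "open N" "p \<in> N" "\<forall>l\<in>ball 1 e. \<forall>q\<in>N. (l, q) \<in> W \<and> act l q \<in> UNIV"
    using act_nbhd[OF open_UNIV UNIV_I, of p] by blast
  have "phi L (act l q) = l *s phi L q" if l: "l \<in> ball 1 e" and q: "q \<in> N" for l q
  proof -
    have "phi L (act l q) $ k = l * phi L q $ k" for k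
    proof -
      have "phi L (act l q) $ k / l = phi L (act 1 q) $ k / 1"
      proof (rule has_derivative_zero_unique[of "ball 1 e" "\<lambda>l. phi L (act l q) $ k / l"])
        fix m :: complex assume m: "m \<in> ball 1 e"
        have mW: "(m, q) \<in> W" using eN(4) m q by blast
        have m0: "m \<noteq> 0" using W_nonzero[OF mW] .
        have "((\<lambda>l. phi L (act l q) $ k / l) has_field_derivative
          ((phi L (act m q) $ k / m) * m - phi L (act m q) $ k * 1) / (m * m)) (at m)"
          by (rule DERIV_divide[OF phi_act_component_derivative[OF L mW] DERIV_ident m0])
        then have "((\<lambda>l. phi L (act l q) $ k / l) has_field_derivative 0) (at m)" using m0 by simp
        then have "((\<lambda>l. phi L (act l q) $ k / l) has_derivative (\<lambda>h. 0)) (at m)"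
          by (simp add: has_field_derivative_def lambda_zero)
        then show "((\<lambda>l. phi L (act l q) $ k / l) has_derivative (\<lambda>h. 0)) (at m within ball 1 e)"
          by (rule has_derivative_at_withinI)
      qed (use l eN(1) in auto)
      moreover have "l \<noteq> 0" using W_nonzero[of l q] eN(4) l q by blast
      ultimately show ?thesis by (simp add: field_simps)
    qed
    then show ?thesis by (simp add: vec_eq_iff)
  qed
  with eN show ?thesis by (intro exI[of _ e] exI[of _ N]) simp
qed

lemma equivariant_phi:
  fixes L :: "complex^'n \<Rightarrow> real^('n + 'n)"
  assumes "linear L"
  shows "equivariant W act (phi L)"
  unfolding equivariant_def
proof
  fix p
  obtain e N where "e > 0" "open N" "p \<in> N" "\<forall>l\<in>ball 1 e. \<forall>q\<in>N. (l, q) \<in> W \<and> phi L (act l q) = l *s phi L q"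
    using phi_equivariant[OF assms, of p] by (elim exE conjE) (rule that)
  then show "\<exists>N. open N \<and> (1, p) \<in> N \<and> N \<subseteq> W \<and> (\<forall>(l, q)\<in>N. phi L (act l q) = l *s phi L q)"
    by (intro exI[of _ "ball 1 e \<times> N"]) (auto intro: open_Times)
qed

lemma conic_phi:
  fixes L :: "complex^'n \<Rightarrow> real^('n + 'n)"
  assumes "linear L"
  shows "conic_immersion (phi L)"
  unfolding conic_immersion_def
proof (intro allI impI)
  fix p :: 'm and U assume U: "open U \<and> p \<in> U"
  obtain e1 N1 where 1: "e1 > 0" "open N1" "p \<in> N1" "\<forall>l\<in>ball 1 e1. \<forall>q\<in>N1. (l, q) \<in> W \<and> phi L (act l q) = l *s phi L q"
    using phi_equivariant[OF assms, of p] by (elim exE conjE) (rule that)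
  obtain e2 N2 where 2: "e2 > 0" "open N2" "p \<in> N2" "\<forall>l\<in>ball 1 e2. \<forall>q\<in>N2. (l, q) \<in> W \<and> act l q \<in> U"
    using act_nbhd[of U p] U by (elim exE conjE) (use that in blast)
  show "\<exists>U1 Up. open U1 \<and> 1 \<in> U1 \<and> U1 \<subseteq> - {0} \<and> open Up \<and> p \<in> Up \<and>
           (\<forall>l\<in>U1. (\<lambda>q. l *s phi L q) ` Up \<subseteq> phi L ` U)"
  proof (intro exI conjI ballI)
    show "open (ball (1::complex) (min e1 e2))" "open (N1 \<inter> N2)" "1 \<in> ball (1::complex) (min e1 e2)" "p \<in> N1 \<inter> N2"
      using 1 2 by auto
    have "l \<noteq> 0" if "l \<in> ball 1 (min e1 e2)" for l :: complex
      using W_nonzero[of l p] bspec[OF bspec[OF 1(4), of l] 1(3)] that by simp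
    then show "ball (1::complex) (min e1 e2) \<subseteq> - {0}" by blast
    show "(\<lambda>q. l *s phi L q) ` (N1 \<inter> N2) \<subseteq> phi L ` U" if l: "l \<in> ball 1 (min e1 e2)" for l
    proof clarify
      fix q assume q: "q \<in> N1" "q \<in> N2"
      have "l *s phi L q = phi L (act l q)" "act l q \<in> U"
        using bspec[OF bspec[OF 1(4), of l] q(1)] bspec[OF bspec[OF 2(4), of l] q(2)] l by simp_all
      then show "l *s phi L q \<in> phi L ` U" by (rule image_eqI)
    qed
  qed
qed

end

section \<open>Symplectic linear algebra\<close>

definition sympl :: "real^('n::finite + 'n) \<Rightarrow> real^('n + 'n) \<Rightarrow> real" where
  "sympl a b = (\<Sum>i\<in>UNIV. a $ Inl i * b $ Inr i - a $ Inr i * b $ Inl i)"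

lemma bilinear_sympl: "bilinear sympl"
  unfolding bilinear_def
  by (intro conjI allI linearI)
     (simp_all add: sympl_def algebra_simps sum.distrib sum_subtractf sum_distrib_left)

lemma sympl_self: "sympl a a = 0"
  by (simp add: sympl_def mult.commute)

lemma linear_bij_dim:
  fixes L :: "'a::euclidean_space \<Rightarrow> 'b::euclidean_space"
  assumes "linear L" "DIM('a) = DIM('b)"
  shows "inj L \<longleftrightarrow> surj L"
  using linear_injective_imp_surjective[OF assms(1)] linear_surjective_imp_injective[OF assms(1)] assms(2)
  by (auto simp: dim_UNIV)

lemma sympl_nondegenerate:
  fixes L :: "'a::euclidean_space \<Rightarrow> real^('n::finite + 'n)"
  assumes L: "linear L" "inj L" "DIM('a) = 2 * CARD('n)" and zero: "\<And>v. sympl (L u) (L v) = 0"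
  shows "u = 0"
proof -
  have "surj L" using linear_bij_dim[OF L(1)] L(2,3) by simp
  then have z: "sympl (L u) b = 0" for b using zero by (metis surjD)
  have "L u $ k = 0" for k
  proof (cases k)
    case (Inl i)
    have "sympl (L u) (axis (Inr i) 1) = L u $ Inl i"
      by (simp add: sympl_def axis_def if_distrib[of "\<lambda>x. _ * x"] cong: if_cong)
    with z Inl show ?thesis by simp
  next
    case (Inr i)
    have "sympl (L u) (axis (Inl i) 1) = - (L u $ Inr i)"
      by (simp add: sympl_def axis_def if_distrib[of "\<lambda>x. _ * x"] sum_negf cong: if_cong)
    with z Inr show ?thesis by simp
  qed
  then have "L u = 0" by (simp add: vec_eq_iff)
  then show ?thesis using linear_injective_0[OF L(1)] L(2) by blast
qed

context
  fixes \<omega> :: "'a::euclidean_space \<Rightarrow> 'a \<Rightarrow> real"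
  assumes bil: "bilinear \<omega>" and alt: "\<And>v. \<omega> v v = 0" and nondeg: "\<And>u. (\<And>v. \<omega> u v = 0) \<Longrightarrow> u = 0"
begin

lemma form_linear_left: "linear (\<lambda>u. \<omega> u v)" and form_linear_right: "linear (\<omega> u)"
  using bil by (auto simp: bilinear_def)

lemma form_skew: "\<omega> v u = - \<omega> u v"
  using alt[of "u + v"] alt[of u] alt[of v] linear_add[OF form_linear_left] linear_add[OF form_linear_right] by simp

text \<open>Symplectic Gram-Schmidt, one hyperbolic pair for each index inserted into
  \<open>I\<close>.\<close>

lemma symplectic_family:
  fixes I :: "'n::finite set"
  assumes dim: "DIM('a) = 2 * CARD('n)"
  shows "\<exists>e f :: 'n \<Rightarrow> 'a. \<forall>i\<in>I. \<forall>j\<in>I. \<omega> (e i) (e j) = 0 \<and> \<omega> (f i) (f j) = 0 \<and>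
    \<omega> (e i) (f j) = (if i = j then 1 else 0)"
  using finite[of I]
proof (induction I rule: finite_induct)
  case empty
  then show ?case by simp
next
  case (insert j I)
  obtain e f :: "'n \<Rightarrow> 'a" where ef: "\<And>i j. i \<in> I \<Longrightarrow> j \<in> I \<Longrightarrow> \<omega> (e i) (e j) = 0"
    "\<And>i j. i \<in> I \<Longrightarrow> j \<in> I \<Longrightarrow> \<omega> (f i) (f j) = 0"
    "\<And>i j. i \<in> I \<Longrightarrow> j \<in> I \<Longrightarrow> \<omega> (e i) (f j) = (if i = j then 1 else 0)"
    using insert.IH by blast
  let ?S = "e ` I \<union> f ` I"
  \<comment> \<open>Projection onto the symplectic complement of the pairs found so far.\<close>
  define pr where "pr x = x - (\<Sum>i\<in>I. \<omega> x (f i) *\<^sub>R e i - \<omega> x (e i) *\<^sub>R f i)" for x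
  have pr_f: "\<omega> (pr x) (f k) = 0" if "k \<in> I" for x k
  proof -
    have "\<omega> (pr x) (f k) = \<omega> x (f k) - (\<Sum>i\<in>I. \<omega> x (f i) * \<omega> (e i) (f k) - \<omega> x (e i) * \<omega> (f i) (f k))"
      unfolding pr_def by (simp add: linear_diff[OF form_linear_left] linear_sum[OF form_linear_left] linear_scale[OF form_linear_left])
    also have "(\<Sum>i\<in>I. \<omega> x (f i) * \<omega> (e i) (f k) - \<omega> x (e i) * \<omega> (f i) (f k)) =
        (\<Sum>i\<in>I. if i = k then \<omega> x (f i) else 0)"
      by (rule sum.cong) (use that ef in auto)
    finally show ?thesis using that insert.hyps(1) by simp
  qed
  have pr_e: "\<omega> (pr x) (e k) = 0" if "k \<in> I" for x k
  proof -
    have "\<omega> (pr x) (e k) = \<omega> x (e k) - (\<Sum>i\<in>I. \<omega> x (f i) * \<omega> (e i) (e k) - \<omega> x (e i) * \<omega> (f i) (e k))"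
      unfolding pr_def by (simp add: linear_diff[OF form_linear_left] linear_sum[OF form_linear_left] linear_scale[OF form_linear_left])
    also have "(\<Sum>i\<in>I. \<omega> x (f i) * \<omega> (e i) (e k) - \<omega> x (e i) * \<omega> (f i) (e k)) =
        (\<Sum>i\<in>I. if i = k then \<omega> x (e i) else 0)"
    proof (rule sum.cong[OF refl])
      fix i assume i: "i \<in> I"
      have "\<omega> (f i) (e k) = - (if k = i then 1 else 0)"
        by (subst form_skew) (simp only: ef(3)[OF that i])
      then show "\<omega> x (f i) * \<omega> (e i) (e k) - \<omega> x (e i) * \<omega> (f i) (e k) = (if i = k then \<omega> x (e i) else 0)"
        using ef(1)[OF i that] by auto
    qed
    finally show ?thesis using that insert.hyps(1) by simp
  qed
  \<comment> \<open>\<open>I\<close> misses the index \<open>j\<close>, so the vectors found so far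
    cannot span; a vector outside their span has nonzero projection.\<close>
  have "dim (span ?S) < DIM('a)"
  proof -
    have "dim (span ?S) \<le> card ?S" using insert.hyps(1) by (intro dim_le_card) auto
    also have "\<dots> \<le> card (e ` I) + card (f ` I)" by (rule card_Un_le)
    also have "\<dots> \<le> card I + card I" using insert.hyps(1) by (intro add_mono card_image_le)
    also have "\<dots> < 2 * CARD('n)"
    proof -
      have "I \<subset> UNIV" using insert.hyps(2) by blast
      from psubset_card_mono[OF finite this] show ?thesis by simp
    qed
    finally show ?thesis using dim by simp
  qed
  then have "span ?S \<noteq> UNIV" by (metis dim_UNIV less_irrefl)
  then obtain v where v: "v \<notin> span ?S" by blast
  define u where "u = pr v"
  have "(\<Sum>i\<in>I. \<omega> v (f i) *\<^sub>R e i - \<omega> v (e i) *\<^sub>R f i) \<in> span ?S"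
    by (intro span_sum span_diff span_scale span_base) auto
  then have "u \<noteq> 0" using v by (auto simp: u_def pr_def)
  then obtain x where x: "\<omega> u x \<noteq> 0" using nondeg by blast
  have u_e: "\<omega> u (e i) = 0" and u_f: "\<omega> u (f i) = 0" if "i \<in> I" for i
    using pr_e pr_f that by (auto simp: u_def)
  have u_pr: "\<omega> u (pr x) = \<omega> u x"
    unfolding pr_def by (simp add: linear_diff[OF form_linear_right] linear_sum[OF form_linear_right] linear_scale[OF form_linear_right] u_e u_f)
  \<comment> \<open>Projecting \<open>x\<close> does not change its pairing with \<open>u\<close>,
    so division by this nonzero value gives a partner of \<open>u\<close>.\<close>
  define w where "w = (1 / \<omega> u x) *\<^sub>R pr x"
  have uw: "\<omega> u w = 1" using x by (simp add: w_def linear_scale[OF form_linear_right] u_pr)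
  have w_e: "\<omega> w (e i) = 0" and w_f: "\<omega> w (f i) = 0" if "i \<in> I" for i
    using pr_e pr_f that by (auto simp: w_def linear_scale[OF form_linear_left])
  have e_u: "\<omega> (e i) u = 0" and f_u: "\<omega> (f i) u = 0" and e_w: "\<omega> (e i) w = 0" and f_w: "\<omega> (f i) w = 0"
    if "i \<in> I" for i
    using form_skew[of "e i" u] form_skew[of "f i" u] form_skew[of "e i" w] form_skew[of "f i" w] u_e u_f w_e w_f that by auto
  show ?case
  proof (rule exI[of _ "e(j := u)"], rule exI[of _ "f(j := w)"], intro ballI)
    fix i k assume ik: "i \<in> insert j I" "k \<in> insert j I"
    show "\<omega> ((e(j := u)) i) ((e(j := u)) k) = 0 \<and> \<omega> ((f(j := w)) i) ((f(j := w)) k) = 0 \<and>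
      \<omega> ((e(j := u)) i) ((f(j := w)) k) = (if i = k then 1 else 0)"
      using ik insert.hyps(2) ef alt uw u_e u_f w_e w_f e_u f_u e_w f_w by (cases "i = j"; cases "k = j") auto
  qed
qed

text \<open>In a symplectic basis the coefficients of \<open>v\<close> are
  \<open>\<omega> v (f i)\<close> and \<open>\<omega> (e i) v\<close>. Rebuilding vectors from
  coefficients gives a right inverse of \<open>L\<close>, by dimension a two-sided one; so the
  family is indeed a basis.\<close>

lemma symplectic_coordinates:
  assumes dim: "DIM('a) = 2 * CARD('n::finite)"
  shows "\<exists>L :: 'a \<Rightarrow> real^('n + 'n). linear L \<and> inj L \<and> (\<forall>u v. \<omega> u v = sympl (L u) (L v))"
proof -
  obtain e f :: "'n \<Rightarrow> 'a" where ef: "\<And>i j. \<omega> (e i) (e j) = 0" "\<And>i j. \<omega> (f i) (f j) = 0"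
    "\<And>i j. \<omega> (e i) (f j) = (if i = j then 1 else 0)"
    using symplectic_family[OF dim, of UNIV] by blast
  define L :: "'a \<Rightarrow> real^('n + 'n)" where
    "L v = (\<chi> k. case k of Inl i \<Rightarrow> \<omega> v (f i) | Inr i \<Rightarrow> \<omega> (e i) v)" for v
  have L_nth: "L v $ Inl i = \<omega> v (f i)" "L v $ Inr i = \<omega> (e i) v" for v i
    by (simp_all add: L_def)
  have all_sum: "(\<forall>k :: 'n + 'n. P k) \<longleftrightarrow> (\<forall>i. P (Inl i)) \<and> (\<forall>i. P (Inr i))" for P
    by (metis sum.exhaust)
  have lin: "linear L"
    by (rule linearI) (simp_all add: vec_eq_iff all_sum L_nth linear_add[OF form_linear_left] linear_add[OF form_linear_right]
        linear_scale[OF form_linear_left] linear_scale[OF form_linear_right])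
  define M :: "real^('n + 'n) \<Rightarrow> 'a" where "M a = (\<Sum>i\<in>UNIV. a $ Inl i *\<^sub>R e i + a $ Inr i *\<^sub>R f i)" for a
  have LM: "L (M a) = a" for a
    by (simp add: vec_eq_iff all_sum L_nth M_def linear_add[OF form_linear_left] linear_add[OF form_linear_right] linear_sum[OF form_linear_left]
        linear_sum[OF form_linear_right] linear_scale[OF form_linear_left] linear_scale[OF form_linear_right] ef if_distrib[of "\<lambda>x. _ * x"] cong: if_cong)
  have surj: "surj L" by (rule surjI[of _ M]) (rule LM)
  then have inj: "inj L" using linear_bij_dim[OF lin] dim by simp
  have M_L: "M (L u) = u" for u using LM[of "L u"] injD[OF inj] by blast
  have "\<omega> u v = sympl (L u) (L v)" for u v
  proof -
    have "\<omega> u v = \<omega> (M (L u)) v" by (simp add: M_L)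
    also have "\<dots> = (\<Sum>i\<in>UNIV. \<omega> u (f i) * \<omega> (e i) v + \<omega> (e i) u * \<omega> (f i) v)"
      unfolding M_def by (simp add: linear_sum[OF form_linear_left] linear_add[OF form_linear_left] linear_scale[OF form_linear_left] L_nth)
    also have "\<dots> = sympl (L u) (L v)"
      unfolding sympl_def L_nth using form_skew[of "f _" v] by (intro sum.cong) auto
    finally show ?thesis .
  qed
  with lin inj show ?thesis by blast
qed

end

lemma coordinates_exist:
  "\<exists>L :: complex^'n \<Rightarrow> real^('n::finite + 'n). linear L \<and> inj L"
proof -
  define L :: "complex^'n \<Rightarrow> real^('n + 'n)" where
    "L v = (\<chi> k. case k of Inl i \<Rightarrow> Re (v $ i) | Inr i \<Rightarrow> Im (v $ i))" for v
  have L_nth: "L v $ Inl i = Re (v $ i)" "L v $ Inr i = Im (v $ i)" for v i by (simp_all add: L_def)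
  have all_sum: "(\<forall>k :: 'n + 'n. P k) \<longleftrightarrow> (\<forall>i. P (Inl i)) \<and> (\<forall>i. P (Inr i))" for P
    by (metis sum.exhaust)
  have "linear L"
    by (rule linearI) (simp_all add: vec_eq_iff all_sum L_nth)
  moreover have "inj L"
    by (rule injI) (simp add: vec_eq_iff all_sum L_nth complex_eq_iff)
  ultimately show ?thesis by blast
qed

subsection \<open>Complexification of real linear maps\<close>

definition re :: "complex^'k \<Rightarrow> real^'k" where "re v = (\<chi> k. Re (v $ k))"
definition im :: "complex^'k \<Rightarrow> real^'k" where "im v = (\<chi> k. Im (v $ k))"

lemma re_im_nth [simp]: "re v $ k = Re (v $ k)" "im v $ k = Im (v $ k)"
  by (simp_all add: re_def im_def)

lemma complex_vec_eqI: "re u = re v \<Longrightarrow> im u = im v \<Longrightarrow> u = v"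
  by (simp add: vec_eq_iff complex_eq_iff)

definition cext :: "(real^'k \<Rightarrow> real^'k) \<Rightarrow> complex^'k \<Rightarrow> complex^'k" where
  "cext B v = (\<chi> k. Complex (B (re v) $ k) (B (im v) $ k))"

lemma re_cext [simp]: "re (cext B v) = B (re v)" and im_cext [simp]: "im (cext B v) = B (im v)"
  by (simp_all add: cext_def vec_eq_iff)

lemma linear_re: "linear re" and linear_im: "linear im"
  by (rule linearI; simp add: vec_eq_iff)+

lemma linear_cext:
  assumes "linear B"
  shows "linear (cext B)"
  by (rule linearI; rule complex_vec_eqI)
     (simp_all add: linear_add[OF linear_re] linear_add[OF linear_im] linear_scale[OF linear_re]
       linear_scale[OF linear_im] linear_add[OF assms] linear_scale[OF assms])

lemma re_im_cstruct: "re (cstruct v) = - im v" "im (cstruct v) = re v"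
  by (simp_all add: cstruct_def vec_eq_iff)

lemma cext_cstruct:
  assumes "linear B"
  shows "cext B (cstruct v) = cstruct (cext B v)"
  by (rule complex_vec_eqI) (simp_all add: re_im_cstruct linear_neg[OF assms])

lemma re_im_tau: "re (tau v) = re v" "im (tau v) = - im v"
  by (simp_all add: tau_def vec_eq_iff)

lemma preserves_tau_cext:
  fixes B :: "real^('n::finite + 'n) \<Rightarrow> real^('n + 'n)"
  assumes "linear B" "bij B"
  shows "preserves_tau (cext B)"
  unfolding preserves_tau_def linear_cstruct_iff
proof (intro conjI allI)
  show "linear (cext B)" by (rule linear_cext[OF assms(1)])
  show "cext B (cstruct v) = \<i> *s cext B v" for v
    using cext_cstruct[OF assms(1), of v] by (simp add: cstruct_def)
  show "cext B (tau v) = tau (cext B v)" for v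
    by (rule complex_vec_eqI) (simp_all add: re_im_tau linear_neg[OF assms(1)])
  show "bij (cext B)"
    by (rule bij_betw_byWitness[where f' = "cext (inv B)"])
       (auto intro!: complex_vec_eqI simp: inv_f_f[OF bij_is_inj[OF assms(2)]] surj_f_inv_f[OF bij_is_surj[OF assms(2)]])
qed

text \<open>\<open>Omega\<close> is the complex bilinear extension of \<open>sympl\<close>.\<close>

lemma Omega_sympl:
  "Omega u v = Complex (sympl (re u) (re v) - sympl (im u) (im v)) (sympl (re u) (im v) + sympl (im u) (re v))"
  by (simp add: complex_eq_iff Omega_def sympl_def sum_subtractf sum.distrib algebra_simps)

lemma dx_dy_sympl: "dx_dy u v = sympl (re u) (re v)"
  by (simp add: dx_dy_def sympl_def)

lemma Omega_cext:
  assumes "\<And>a b. sympl (B a) (B b) = sympl a b"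
  shows "Omega (cext B u) (cext B v) = Omega u v"
  by (simp add: Omega_sympl assms)

section \<open>Immersions inducing the connection\<close>

context atlas
begin

lemma holomorphic_immersion_mderiv:
  fixes \<phi> :: "'m \<Rightarrow> 'n cotangent"
  assumes "holomorphic_immersion A \<phi>"
  shows "has_mderiv \<phi> q (mdiff A \<phi> q)" "mdiff A \<phi> q (cstruct v) = \<i> *s mdiff A \<phi> q v"
proof -
  have "J.hol (\<phi> \<circ> chart_inv (chart_at A q)) (img (chart_at A q))"
    using assms chart_at(1) unfolding holomorphic_immersion_def holomorphic_map_on_iff by blast
  from J.holD[OF this, of "chart_map (chart_at A q) q"]
  show "has_mderiv \<phi> q (mdiff A \<phi> q)" "mdiff A \<phi> q (cstruct v) = \<i> *s mdiff A \<phi> q v"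
    using chart_at(2) by (auto simp: has_mderiv_def mdiff_def[abs_def])
qed

lemma smooth_fun_subset: "smooth_fun A U f \<Longrightarrow> V \<subseteq> U \<Longrightarrow> smooth_fun A V f"
  unfolding smooth_fun_def by (meson Int_mono image_mono order_refl smooth_on_subset)

lemma smooth_fun_mult:
  fixes f g :: "'m \<Rightarrow> real"
  assumes "open U" "smooth_fun A U f" "smooth_fun A U g"
  shows "smooth_fun A U (\<lambda>q. f q * g q)"
  unfolding smooth_fun_def
proof
  fix c assume c: "c \<in> A"
  have "smooth_on (\<lambda>x. (f \<circ> chart_inv c) x *\<^sub>R (g \<circ> chart_inv c) x) (chart_map c ` (U \<inter> chart_dom c))"
    by (rule smooth_on_scaleR[OF open_chart_image[OF c assms(1)]]) (use assms c in \<open>simp_all add: smooth_fun_def o_def\<close>)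
  then show "smooth_on ((\<lambda>q. f q * g q) \<circ> chart_inv c) (chart_map c ` (U \<inter> chart_dom c))" by (simp add: o_def)
qed

lemma smooth_fun_add:
  assumes "open U" "smooth_fun A U f" "smooth_fun A U g"
  shows "smooth_fun A U (\<lambda>q. f q + g q)"
  unfolding smooth_fun_def
proof
  fix c assume c: "c \<in> A"
  have "smooth_on (\<lambda>x. (f \<circ> chart_inv c) x + (g \<circ> chart_inv c) x) (chart_map c ` (U \<inter> chart_dom c))"
    by (rule smooth_on_add[OF open_chart_image[OF c assms(1)]]) (use assms c in \<open>simp_all add: smooth_fun_def o_def\<close>)
  then show "smooth_on ((\<lambda>q. f q + g q) \<circ> chart_inv c) (chart_map c ` (U \<inter> chart_dom c))" by (simp add: o_def)
qed

lemma smooth_fun_sum: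
  assumes "open U" "finite I" "\<And>i. i \<in> I \<Longrightarrow> smooth_fun A U (f i)"
  shows "smooth_fun A U (\<lambda>q. \<Sum>i\<in>I. f i q)"
  using assms(2,3) by (induction I rule: finite_induct) (auto intro: smooth_fun_add[OF assms(1)])

text \<open>Conicity puts \<open>(1 + h) \<phi> p\<close> into the image of a small neighbourhood of
  \<open>p\<close>. Hence \<open>h \<phi> p\<close> is a difference of values of
  \<open>\<phi>\<close> and lies close to the range of \<open>D\<close>, with error a small multiple
  of \<open>h\<close>. The range is closed, so a vector outside it would have positive distance
  \<open>e\<close> from it.\<close>

lemma conic_tangent:
  fixes \<phi> :: "'m \<Rightarrow> 'n cotangent"
  assumes conic: "conic_immersion \<phi>" and D: "has_mderiv \<phi> p D" "inj D"
  shows "\<phi> p \<in> range D"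
proof (rule ccontr)
  let ?c = "chart_at A p" let ?x = "chart_map ?c p" let ?y = "\<phi> p"
  have c: "?c \<in> A" "p \<in> chart_dom ?c" by (rule chart_at)+
  have lin: "linear D" by (rule has_mderiv_linear[OF D(1)])
  have d: "((\<phi> \<circ> chart_inv ?c) has_derivative D) (at ?x)" using D(1) by (simp add: has_mderiv_def)
  assume "?y \<notin> range D"
  then have "?y \<in> - range D" by simp
  moreover have "open (- range D)"
    by (rule open_Compl[OF closed_subspace[OF linear_subspace_image[OF lin subspace_UNIV]]])
  ultimately obtain e where e: "e > 0" "ball ?y e \<subseteq> - range D"
    using open_contains_ball by blast
  have far: "norm (?y - D u) \<ge> e" for u
  proof (rule ccontr)
    assume "\<not> norm (?y - D u) \<ge> e"
    then have "D u \<in> ball ?y e" by (simp add: dist_norm)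
    then show False using e(2) by blast
  qed
  obtain B where B: "B > 0" "\<And>u. B * norm u \<le> norm (D u)"
    using linear_inj_bounded_below_pos[OF lin D(2)] by blast
  \<comment> \<open>Bounds the coordinate displacement per unit of \<open>h\<close>; the summand 1
    keeps it positive even if \<open>?y\<close> is 0.\<close>
  define k where "k = 2 * norm ?y / B + 1"
  have k: "k > 0" "2 * norm ?y / B \<le> k" using B by (auto simp: k_def intro: add_nonneg_pos)
  \<comment> \<open>With \<open>B / 2\<close> the linearisation error is absorbed in the lower bound
    for \<open>D\<close>; with \<open>e / (2 * k)\<close> the resulting error per unit of
    \<open>h\<close> stays below \<open>e\<close>.\<close>
  define s where "s = min (B / 2) (e / (2 * k))"
  have s: "s > 0" "s \<le> B / 2" "s * k < e"
  proof -
    show "s > 0" "s \<le> B / 2" using B e k by (auto simp: s_def)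
    have "s * k \<le> e / (2 * k) * k" using k by (intro mult_right_mono) (auto simp: s_def)
    then show "s * k < e" using k e by simp
  qed
  obtain r where r: "r > 0" "\<And>x. norm (x - ?x) < r \<Longrightarrow>
      norm ((\<phi> \<circ> chart_inv ?c) x - (\<phi> \<circ> chart_inv ?c) ?x - D (x - ?x)) \<le> s * norm (x - ?x)"
    using d s(1) unfolding has_derivative_at_alt by blast
  define U where "U = chart_dom ?c \<inter> chart_map ?c -` ball ?x r"
  have U: "open U" "p \<in> U" using open_chart_preimage[OF c(1)] c r(1) by (auto simp: U_def)
  from conic[unfolded conic_immersion_def, THEN spec[of _ p], THEN spec[of _ U], THEN mp, OF conjI[OF U]]
  obtain U1 Up where U1: "open U1" "1 \<in> U1" "U1 \<subseteq> - {0}" "open Up" "p \<in> Up"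
    "\<forall>l\<in>U1. (\<lambda>q. l *s \<phi> q) ` Up \<subseteq> \<phi> ` U"
    by (elim exE conjE) (rule that)
  obtain t where t: "t > 0" "ball 1 t \<subseteq> U1" using U1(1,2) open_contains_ball by blast
  define h where "h = t / 2"
  have h: "h > 0" using t by (simp add: h_def)
  have "(1 + of_real h) \<in> U1"
  proof (rule subsetD[OF t(2)])
    show "1 + complex_of_real h \<in> ball 1 t" using t(1) by (simp add: dist_norm h_def norm_divide)
  qed
  with U1(5,6) obtain q where q: "q \<in> U" "(1 + of_real h) *s ?y = \<phi> q" by blast
  define u where "u = chart_map ?c q - ?x"
  have qc: "q \<in> chart_dom ?c" "norm u < r" using q(1) by (auto simp: U_def u_def dist_norm norm_minus_commute)
  have "\<phi> q - ?y = h *\<^sub>R ?y"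
    unfolding q(2)[symmetric] by (simp add: vec_eq_iff complex_eq_iff algebra_simps)
  then have est: "norm (h *\<^sub>R ?y - D u) \<le> s * norm u"
    using r(2)[of "chart_map ?c q"] qc c by (simp add: u_def)
  have "B * norm u \<le> norm (D u)" by (rule B)
  also have "\<dots> \<le> norm (h *\<^sub>R ?y) + norm (h *\<^sub>R ?y - D u)"
    using norm_triangle_sub[of "D u" "h *\<^sub>R ?y"] by (simp add: norm_minus_commute)
  also have "\<dots> \<le> h * norm ?y + B / 2 * norm u"
    using est mult_right_mono[OF s(2), of "norm u"] h by simp
  finally have "norm u \<le> h * (2 * norm ?y / B)" using B by (simp add: field_simps)
  also have "\<dots> \<le> h * k" using k h by (intro mult_left_mono) auto
  finally have "s * norm u \<le> s * (h * k)" using s by (intro mult_left_mono) auto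
  with est have "norm (h *\<^sub>R ?y - D u) \<le> h * (s * k)" by (simp add: mult.left_commute)
  also have "\<dots> < h * e" using s h by simp
  finally have "norm (h *\<^sub>R (?y - D ((1 / h) *\<^sub>R u))) < h * e"
    using h by (simp add: scaleR_diff_right linear_scale[OF lin])
  then have "norm (?y - D ((1 / h) *\<^sub>R u)) < e" using h by simp
  with far[of "(1 / h) *\<^sub>R u"] show False by simp
qed

end

section \<open>Immersions and parallel two-forms in terms of the parallel frame\<close>

context framed_manifold
begin

lemma re_Phi [simp]: "re (Phi L q v) = L (\<theta> q v)" and im_Phi: "im (Phi L q v) = - L (\<theta> q (cstruct v))"
  by (simp_all add: vec_eq_iff Phi_component)

text \<open>The differential of an affine function is constant on parallel fields, so
  \<open>L\<close> can be read off at any one point. It fixes the real part of the differential, and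
  holomorphy then forces the imaginary part.\<close>

lemma immersion_Phi:
  fixes \<phi> :: "'m \<Rightarrow> 'n cotangent"
  assumes hol: "holomorphic_immersion A \<phi>" and tc: "totally_complex A \<phi>" and ic: "induces_connection A nabla \<phi>"
  shows "\<exists>L. linear L \<and> inj L \<and> (\<forall>q. has_mderiv \<phi> q (Phi L q))"
proof -
  define f where "f k q = Re (\<phi> q $ k)" for k q
  let ?p = "undefined :: 'm"
  define L where "L w = (\<chi> k. mdiff A (f k) ?p (Q ?p w))" for w
  note d = holomorphic_immersion_mderiv[OF hol]
  have cs: "mdiff A \<phi> q (cstruct v) = cstruct (mdiff A \<phi> q v)" for q v
    unfolding d(2) by (simp add: cstruct_def)
  have df: "has_mderiv (f k) q (\<lambda>v. Re (mdiff A \<phi> q v $ k))" for k q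
    unfolding f_def by (rule has_mderiv_bounded_linear[OF bounded_linear_Re_component d(1)])
  have mf: "mdiff A (f k) q v = Re (mdiff A \<phi> q v $ k)" for k q v
    using mdiff_eq[OF df] by simp
  have aff: "affine_function A nabla (f k)" for k
    using ic unfolding induces_connection_def f_def by (cases k) auto
  have const: "mdiff A (f k) q (Q q w) = L w $ k" for k q w
  proof -
    have vf: "vector_field A UNIV (\<lambda>q. Q q w)" and par: "nabla p v (\<lambda>q. Q q w) = 0" for p v
      using parallel_Q by (auto simp: parallel_field_def)
    have sf: "smooth_fun A UNIV (f k)" using aff by (simp add: affine_function_def)
    have "has_mderiv (\<lambda>q. mdiff A (f k) q (Q q w)) p (\<lambda>v. 0)" for p
    proof -
      have "mdiff A (\<lambda>q. mdiff A (f k) q (Q q w)) p v = mdiff A (f k) p (nabla p v (\<lambda>q. Q q w))" for v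
        using aff vf unfolding affine_function_def by blast
      moreover have "mdiff A (f k) p 0 = 0"
        using linear_0[OF has_mderiv_linear[OF smooth_fun_has_mderiv[OF sf open_UNIV UNIV_I]]] .
      ultimately have "mdiff A (\<lambda>q. mdiff A (f k) q (Q q w)) p = (\<lambda>v. 0)" using par by (simp add: fun_eq_iff)
      with smooth_fun_has_mderiv[OF smooth_fun_mdiff_field[OF sf open_UNIV vf] open_UNIV UNIV_I, of p]
      show ?thesis by simp
    qed
    from has_mderiv_zero_imp_constant[OF this open_UNIV connected_UNIV UNIV_I UNIV_I]
    show ?thesis by (simp add: L_def)
  qed
  have re: "re (mdiff A \<phi> q v) = L (\<theta> q v)" for q v
    using const[of _ q "\<theta> q v"] by (simp add: vec_eq_iff mf)
  have "mdiff A \<phi> q v = Phi L q v" for q v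
  proof (rule complex_vec_eqI)
    show "re (mdiff A \<phi> q v) = re (Phi L q v)" by (simp add: re)
    have "re (mdiff A \<phi> q (cstruct v)) = - im (mdiff A \<phi> q v)"
      by (simp add: cs re_im_cstruct)
    then show "im (mdiff A \<phi> q v) = im (Phi L q v)" by (simp add: re im_Phi)
  qed
  then have Phi: "mdiff A \<phi> q = Phi L q" for q by (rule ext)
  have lin: "linear L"
  proof -
    have "linear (\<lambda>w. re (mdiff A \<phi> ?p (Q ?p w)))"
      using linear_compose[OF linear_compose[OF linear_Q has_mderiv_linear[OF d(1)]] linear_re] by (simp add: o_def)
    then show ?thesis by (simp add: re)
  qed
  \<comment> \<open>If the real part of the differential vanishes on a vector, multiplication by i
    yields a real vector in the image, which total complexity excludes.\<close>
  have "w = 0" if "L w = 0" for w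
  proof -
    let ?v = "Q ?p w" let ?u = "mdiff A \<phi> ?p (cstruct ?v)"
    have "im ?u = 0"
      using that re[of ?p ?v] by (simp add: cs re_im_cstruct)
    then have "tau ?u = ?u" by (intro complex_vec_eqI) (simp_all add: re_im_tau)
    then have "?u = 0" using tc unfolding totally_complex_def by blast
    moreover have "inj (mdiff A \<phi> ?p)" using hol by (simp add: holomorphic_immersion_def)
    ultimately have "cstruct ?v = 0" using linear_injective_0[OF has_mderiv_linear[OF d(1)]] by blast
    then show ?thesis using \<theta>_Q[of ?p w] linear_0[OF linear_\<theta>] by simp
  qed
  then have "inj L" using linear_injective_0[OF lin] by blast
  with lin d(1) show ?thesis unfolding Phi by blast
qed

lemma induced_form_eq:
  fixes \<phi> :: "'m \<Rightarrow> 'n cotangent"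
  assumes "has_mderiv \<phi> q (Phi L q)"
  shows "induced_form A \<phi> q u v = 2 * sympl (L (\<theta> q u)) (L (\<theta> q v))"
  by (simp add: induced_form_def mdiff_eq[OF assms] dx_dy_sympl)

text \<open>Vanishing torsion turns brackets into differences of covariant derivatives, which then
  cancel the derivatives of the parallel form up to skewness.\<close>

lemma parallel_form_closed:
  assumes "two_form A \<omega>" "parallel_form A nabla \<omega>"
  shows "closed_form A \<omega>"
  unfolding closed_form_def
proof (intro allI impI ballI)
  fix U X Y Z p
  assume "open U \<and> vector_field A U X \<and> vector_field A U Y \<and> vector_field A U Z" and p: "p \<in> U"
  then have U: "open U" and X: "vector_field A U X" and Y: "vector_field A U Y" and Z: "vector_field A U Z" by auto
  have par: "mdiff A (\<lambda>q. \<omega> q (X q) (Y q)) p v = \<omega> p (nabla p v X) (Y p) + \<omega> p (X p) (nabla p v Y)"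
    if "vector_field A U X" "vector_field A U Y" for X Y v
    using assms(2) U p that unfolding parallel_form_def by blast
  have bil: "bilinear (\<omega> p)" and alt: "\<omega> p v v = 0" for v using assms(1) by (simp_all add: two_form_def)
  have skew: "\<omega> p v u = - \<omega> p u v" for u v
    using alt[of "u + v"] alt[of u] alt[of v] by (simp add: bilinear_ladd[OF bil] bilinear_radd[OF bil])
  have br: "lie_bracket A X Y p = nabla p (X p) Y - nabla p (Y p) X"
    if "vector_field A U X" "vector_field A U Y" for X Y
  proof -
    have "nabla p (X p) Y - nabla p (Y p) X - lie_bracket A X Y p = 0"
      using torsion_free U p that unfolding torsion_free_def by blast
    then show ?thesis by simp
  qed
  show "mdiff A (\<lambda>q. \<omega> q (Y q) (Z q)) p (X p) + mdiff A (\<lambda>q. \<omega> q (Z q) (X q)) p (Y p)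
      + mdiff A (\<lambda>q. \<omega> q (X q) (Y q)) p (Z p) - \<omega> p (lie_bracket A X Y p) (Z p)
      - \<omega> p (lie_bracket A Y Z p) (X p) - \<omega> p (lie_bracket A Z X p) (Y p) = 0"
    unfolding par[OF Y Z] par[OF Z X] par[OF X Y] br[OF X Y] br[OF Y Z] br[OF Z X] bilinear_lsub[OF bil]
    using skew[of "Y p" "nabla p (X p) Z"] skew[of "Z p" "nabla p (Y p) X"] skew[of "X p" "nabla p (Z p) Y"]
    by simp
qed

text \<open>In the parallel frame the form has constant coefficients
  \<open>2 * sympl (L a) (L b)\<close>; being parallel and nondegenerate can be read off there, and
  it is closed because it is parallel.\<close>

lemma induced_form_symplectic:
  fixes \<phi> :: "'m \<Rightarrow> 'n cotangent"
  assumes L: "linear L" "inj L" and \<phi>: "\<And>q. has_mderiv \<phi> q (Phi L q)"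
  shows "symplectic_form A (induced_form A \<phi>)" "parallel_form A nabla (induced_form A \<phi>)"
proof -
  note eq = induced_form_eq[OF \<phi>]
  have bil: "bilinear (induced_form A \<phi> q)" for q
    using bilinear_sympl unfolding bilinear_def eq
    by (auto intro!: linearI simp: linear_add[OF L(1)] linear_scale[OF L(1)] linear_add[OF linear_\<theta>]
        linear_scale[OF linear_\<theta>] bilinear_ladd[OF bilinear_sympl] bilinear_radd[OF bilinear_sympl]
        bilinear_lmul[OF bilinear_sympl] bilinear_rmul[OF bilinear_sympl] algebra_simps)
  have two: "two_form A (induced_form A \<phi>)"
    unfolding two_form_def
  proof (intro conjI allI impI)
    show "bilinear (induced_form A \<phi> q)" for q by (rule bil)
    show "induced_form A \<phi> q v v = 0" for q v by (simp add: eq sympl_self)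
    fix U X Y assume "open U \<and> vector_field A U X \<and> vector_field A U Y"
    then have U: "open U" and X: "vector_field A U X" and Y: "vector_field A U Y" by auto
    have s: "smooth_fun A U (\<lambda>q. L (\<theta> q (X q)) $ k)" if X: "vector_field A U X" for X k
    proof -
      have "smooth_fun A U (\<lambda>p. Re (\<phi> p $ k))"
        by (rule smooth_fun_subset[OF smooth_fun_of_hol[OF holomorphic_immersionI[OF L \<phi>] bounded_linear_Re_component]]) simp
      from smooth_fun_mdiff_field[OF this U X]
      show ?thesis
        using mdiff_eq[OF has_mderiv_bounded_linear[OF bounded_linear_Re_component \<phi>]] by (simp add: Phi_component)
    qed
    have "smooth_fun A U (\<lambda>q. 2 * (\<Sum>i\<in>UNIV. L (\<theta> q (X q)) $ Inl i * L (\<theta> q (Y q)) $ Inr i +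
        (- 1) * (L (\<theta> q (X q)) $ Inr i * L (\<theta> q (Y q)) $ Inl i)))"
      by (intro smooth_fun_mult smooth_fun_sum smooth_fun_add smooth_fun_const s X Y U finite)
    then show "smooth_fun A U (\<lambda>q. induced_form A \<phi> q (X q) (Y q))"
      by (simp add: eq sympl_def)
  qed
  show par: "parallel_form A nabla (induced_form A \<phi>)"
    unfolding parallel_form_def
  proof (intro allI impI ballI)
    fix U X Y p v assume UXY: "open U \<and> vector_field A U X \<and> vector_field A U Y" and p: "p \<in> U"
    have "bounded_linear L" using L(1) linear_conv_bounded_linear by blast
    then have d: "has_mderiv (\<lambda>q. L (\<theta> q (X q))) p (\<lambda>v. L (\<theta> p (nabla p v X)))" if "vector_field A U X" for X
      using has_mderiv_bounded_linear[OF _ coframe_mderiv_field[OF parallel_frame_subset[OF frame] _ p that]] UXY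
      by (simp add: \<theta>_def)
    have "bounded_bilinear sympl" using bilinear_sympl bilinear_conv_bounded_bilinear by blast
    from bounded_bilinear.FDERIV[OF this d[unfolded has_mderiv_def] d[unfolded has_mderiv_def], of X Y] UXY
    have "has_mderiv (\<lambda>q. sympl (L (\<theta> q (X q))) (L (\<theta> q (Y q)))) p
      (\<lambda>v. sympl (L (\<theta> p (X p))) (L (\<theta> p (nabla p v Y))) + sympl (L (\<theta> p (nabla p v X))) (L (\<theta> p (Y p))))"
      unfolding has_mderiv_def using chart_at by (simp add: o_def)
    from mdiff_eq[OF has_mderiv_bounded_linear[OF bounded_linear_mult_right[of 2] this]]
    show "mdiff A (\<lambda>q. induced_form A \<phi> q (X q) (Y q)) p v =
      induced_form A \<phi> p (nabla p v X) (Y p) + induced_form A \<phi> p (X p) (nabla p v Y)"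
      by (simp add: eq)
  qed
  have "u = 0" if "\<forall>v. induced_form A \<phi> p u v = 0" for p u
  proof -
    have "sympl (L (\<theta> p u)) (L w) = 0" for w using spec[OF that, of "Q p w"] by (simp add: eq)
    then have "\<theta> p u = 0" by (intro sympl_nondegenerate[OF L]) simp_all
    then show ?thesis using Q_\<theta>[of p u] linear_0[OF linear_Q] by simp
  qed
  with two parallel_form_closed[OF two par] show "symplectic_form A (induced_form A \<phi>)"
    by (simp add: symplectic_form_def)
qed

lemma parallel_form_in_frame:
  assumes \<omega>: "symplectic_form A \<omega>" "parallel_form A nabla \<omega>"
  shows "\<exists>L :: complex^'n \<Rightarrow> real^('n + 'n). linear L \<and> inj L \<and> (\<forall>p u v. \<omega> p u v = 2 * sympl (L (\<theta> p u)) (L (\<theta> p v)))"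
proof -
  let ?p = "undefined :: 'm"
  have two: "two_form A \<omega>" using \<omega>(1) by (simp add: symplectic_form_def)
  have const: "\<omega> p (Q p a) (Q p b) = \<omega> ?p (Q ?p a) (Q ?p b)" for p a b
  proof (rule has_mderiv_zero_imp_constant[OF _ open_UNIV connected_UNIV UNIV_I UNIV_I, of "\<lambda>p. \<omega> p (Q p a) (Q p b)"])
    fix q
    have vf: "vector_field A UNIV (\<lambda>q. Q q w)" and par: "nabla p v (\<lambda>q. Q q w) = 0" for p v w
      using parallel_Q by (auto simp: parallel_field_def)
    have "smooth_fun A UNIV (\<lambda>p. \<omega> p (Q p a) (Q p b))"
      using two vf unfolding two_form_def by blast
    from smooth_fun_has_mderiv[OF this open_UNIV UNIV_I, of q]
    have 1: "has_mderiv (\<lambda>p. \<omega> p (Q p a) (Q p b)) q (mdiff A (\<lambda>p. \<omega> p (Q p a) (Q p b)) q)" .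
    have bil: "bilinear (\<omega> q)" using two by (simp add: two_form_def)
    have "mdiff A (\<lambda>p. \<omega> p (Q p a) (Q p b)) q v = \<omega> q (nabla q v (\<lambda>q. Q q a)) (Q q b) + \<omega> q (Q q a) (nabla q v (\<lambda>q. Q q b))" for v
      using \<omega>(2) vf unfolding parallel_form_def by blast
    then have "mdiff A (\<lambda>p. \<omega> p (Q p a) (Q p b)) q = (\<lambda>v. 0)"
      by (simp add: fun_eq_iff par bilinear_lzero[OF bil] bilinear_rzero[OF bil])
    with 1 show "has_mderiv (\<lambda>p. \<omega> p (Q p a) (Q p b)) q (\<lambda>v. 0)" by simp
  qed
  \<comment> \<open>Half of the form in the frame at one point, because the induced form carries a
    factor 2.\<close>
  define \<sigma> where "\<sigma> a b = \<omega> ?p (Q ?p a) (Q ?p b) / 2" for a b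
  have bil: "bilinear (\<omega> ?p)" using two by (simp add: two_form_def)
  have "\<exists>L :: complex^'n \<Rightarrow> real^('n + 'n). linear L \<and> inj L \<and> (\<forall>u v. \<sigma> u v = sympl (L u) (L v))"
  proof (rule symplectic_coordinates)
    show "bilinear \<sigma>"
      unfolding bilinear_def \<sigma>_def
      by (auto intro!: linearI simp: linear_add[OF linear_Q] linear_scale[OF linear_Q] bilinear_ladd[OF bil]
          bilinear_radd[OF bil] bilinear_lmul[OF bil] bilinear_rmul[OF bil] add_divide_distrib)
    show "\<sigma> v v = 0" for v using two by (simp add: \<sigma>_def two_form_def)
    show "u = 0" if "\<And>v. \<sigma> u v = 0" for u
    proof -
      have "\<omega> ?p (Q ?p u) v = 0" for v using that[of "\<theta> ?p v"] by (simp add: \<sigma>_def)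
      then have "Q ?p u = 0" using \<omega>(1) unfolding symplectic_form_def by blast
      then show ?thesis using \<theta>_Q[of ?p u] linear_0[OF linear_\<theta>] by simp
    qed
  qed simp
  then obtain L :: "complex^'n \<Rightarrow> real^('n + 'n)" where L: "linear L" "inj L" "\<And>u v. \<sigma> u v = sympl (L u) (L v)" by blast
  have "\<omega> p u v = 2 * sympl (L (\<theta> p u)) (L (\<theta> p v))" for p u v
    using const[of p "\<theta> p u" "\<theta> p v"] by (simp add: L(3)[symmetric] \<sigma>_def)
  with L(1,2) show ?thesis by blast
qed

text \<open>Both differentials complexify isomorphic images of the same coframe, so the
  complexification of \<open>M \<circ> inv L\<close> carries one to the other and the maps differ by
  a constant. Preservation of \<open>Omega\<close> is an implication so that one lemma serves with
  and without a symplectic form.\<close>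

lemma immersion_unique:
  fixes \<phi> \<psi> :: "'m \<Rightarrow> 'n cotangent"
  assumes L: "linear L" "inj L" "\<And>q. has_mderiv \<phi> q (Phi L q)"
    and M: "linear M" "inj M" "\<And>q. has_mderiv \<psi> q (Phi M q)"
    and conic: "conic_immersion \<phi>" "conic_immersion \<psi>"
  shows "\<exists>T b. preserves_tau T \<and> ((\<forall>u v. sympl (M u) (M v) = sympl (L u) (L v)) \<longrightarrow> preserves_Omega_tau T) \<and>
    (\<forall>p. \<psi> p = T (\<phi> p) + b) \<and>
    ((\<exists>W act. conic_action A nabla W act \<and> equivariant W act \<phi> \<and> equivariant W act \<psi>) \<or>
      \<not> (\<exists>X. parallel_field A nabla UNIV X \<and> parallel_field A nabla UNIV (\<lambda>p. cstruct (X p)) \<and> (\<exists>p. X p \<noteq> 0))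
      \<longrightarrow> b = 0)"
proof -
  have sL: "surj L" and sM: "surj M" using linear_bij_dim[OF L(1)] linear_bij_dim[OF M(1)] L(2) M(2) by simp_all
  have iL: "inv L (L w) = w" "L (inv L a) = a" for w a
    using L(2) surj_f_inv_f[OF sL] by simp_all
  have lin_inv: "linear (inv L)"
    by (rule linearI; rule injD[OF L(2)]) (simp_all add: iL linear_add[OF L(1)] linear_scale[OF L(1)])
  define B where "B = M \<circ> inv L"
  have B: "linear B" "bij B" "B (L w) = M w" for w
  proof -
    show "linear B" unfolding B_def by (rule linear_compose[OF lin_inv M(1)])
    have "bij L" "bij M" using L(2) M(2) sL sM by (auto simp: bij_def)
    then show "bij B" unfolding B_def by (intro bij_comp bij_imp_bij_inv)
    show "B (L w) = M w" by (simp add: B_def iL)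
  qed
  let ?T = "cext B"
  have T: "preserves_tau ?T" by (rule preserves_tau_cext[OF B(1,2)])
  have Tlin: "linear ?T" by (rule linear_cext[OF B(1)])
  have TPhi: "?T (Phi L q v) = Phi M q v" for q v
    by (rule complex_vec_eqI) (simp_all add: im_Phi B(3) linear_neg[OF B(1)])
  define b where "b = \<psi> undefined - ?T (\<phi> undefined)"
  have \<psi>: "\<psi> p = ?T (\<phi> p) + b" for p
  proof -
    have "\<psi> p - ?T (\<phi> p) = \<psi> undefined - ?T (\<phi> undefined)"
    proof (rule has_mderiv_zero_imp_constant[OF _ open_UNIV connected_UNIV UNIV_I UNIV_I, of "\<lambda>p. \<psi> p - ?T (\<phi> p)"])
      fix q
      have "bounded_linear ?T" using Tlin linear_conv_bounded_linear by blast
      from has_derivative_diff[OF M(3)[unfolded has_mderiv_def]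
          has_mderiv_bounded_linear[OF this L(3), unfolded has_mderiv_def], of q]
      show "has_mderiv (\<lambda>p. \<psi> p - ?T (\<phi> p)) q (\<lambda>v. 0)"
        unfolding has_mderiv_def by (simp add: TPhi o_def)
    qed
    then show ?thesis by (simp add: b_def algebra_simps)
  qed
  have Om: "preserves_Omega_tau ?T" if "\<forall>u v. sympl (M u) (M v) = sympl (L u) (L v)"
  proof -
    have "sympl (B x) (B y) = sympl x y" for x y using that by (simp add: B_def iL(2))
    from Omega_cext[OF this] T show ?thesis by (simp add: preserves_Omega_tau_def)
  qed
  \<comment> \<open>At a scalar \<open>l \<noteq> 1\<close> near 1, comparing the two equivariances
    at one point leaves \<open>(l - 1) *s b = 0\<close>.\<close>
  have b1: "b = 0" if eq: "equivariant W act \<phi>" "equivariant W act \<psi>" for W act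
  proof -
    let ?p = "undefined :: 'm"
    obtain N1 where N1: "open N1" "(1, ?p) \<in> N1" "\<forall>(l, q)\<in>N1. \<phi> (act l q) = l *s \<phi> q"
      using eq(1) unfolding equivariant_def by blast
    obtain N2 where N2: "open N2" "(1, ?p) \<in> N2" "\<forall>(l, q)\<in>N2. \<psi> (act l q) = l *s \<psi> q"
      using eq(2) unfolding equivariant_def by blast
    have "open ((\<lambda>l. (l, ?p)) -` (N1 \<inter> N2))" "1 \<in> (\<lambda>l. (l, ?p)) -` (N1 \<inter> N2)"
      using N1(1,2) N2(1,2) by (auto intro!: open_vimage continuous_intros open_Int)
    then obtain t where t: "t > 0" "ball 1 t \<subseteq> (\<lambda>l. (l, ?p)) -` (N1 \<inter> N2)" using open_contains_ball by blast
    define l where "l = 1 + complex_of_real (t / 2)"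
    have "l \<in> ball 1 t" using t(1) by (simp add: l_def dist_norm norm_divide)
    then have l: "(l, ?p) \<in> N1" "(l, ?p) \<in> N2" using t(2) by auto
    have Tl: "?T (l *s z) = l *s ?T z" for z
      by (rule linear_complex_scale[OF Tlin]) (simp add: cext_cstruct[OF B(1)], simp add: cstruct_def)
    have "l *s \<psi> ?p = \<psi> (act l ?p)" using N2(3) l(2) by auto
    also have "\<dots> = l *s ?T (\<phi> ?p) + b" using N1(3) l(1) Tl by (auto simp: \<psi>)
    finally have "(l - 1) *s b = 0"
      by (simp add: \<psi> vec_eq_iff algebra_simps)
    moreover have "l - 1 \<noteq> 0" using t(1) by (simp add: l_def)
    ultimately show ?thesis by (simp add: vec_eq_iff)
  qed
  have b2: "b = 0" if no: "\<not> (\<exists>X. parallel_field A nabla UNIV X \<and> parallel_field A nabla UNIV (\<lambda>p. cstruct (X p)) \<and> (\<exists>p. X p \<noteq> 0))"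
  proof (rule ccontr)
    assume "b \<noteq> 0"
    have bT: "bij ?T" using T by (simp add: preserves_tau_def)
    define c where "c = inv ?T b"
    have c: "?T c = b" using surj_f_inv_f[OF bij_is_surj[OF bT]] by (simp add: c_def)
    have injPhi: "inj (Phi K q)" if "linear K" "inj K" for K :: "complex^'n \<Rightarrow> real^('n + 'n)" and q
    proof -
      have "v = 0" if "Phi K q v = 0" for v
        by (rule Phi_real_eq_0[OF \<open>linear K\<close> \<open>inj K\<close>, of q]) (simp add: that)
      then show ?thesis using linear_injective_0[OF linear_Phi[OF \<open>linear K\<close>]] by blast
    qed
    \<comment> \<open>\<open>\<phi> p\<close> and \<open>\<psi> p\<close> lie in the images of their
      own differentials, which \<open>?T\<close> matches. Hence \<open>c\<close>, the preimage of
      \<open>b\<close>, lies in the image of the differential of \<open>\<phi>\<close> at every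
      point.\<close>
    have ex: "\<exists>Z. Phi L p Z = c" for p
    proof -
      obtain x where x: "\<phi> p = Phi L p x" using conic_tangent[OF conic(1) L(3) injPhi[OF L(1,2)]] by blast
      obtain y where y: "\<psi> p = Phi M p y" using conic_tangent[OF conic(2) M(3) injPhi[OF M(1,2)]] by blast
      have "?T (Phi L p (y - x)) = ?T c"
        using \<psi>[of p] by (simp add: linear_diff[OF linear_Phi[OF L(1)]] linear_diff[OF Tlin] TPhi x[symmetric] y[symmetric] c)
      then show ?thesis using injD[OF bij_is_inj[OF bT]] by blast
    qed
    then obtain Z where Z: "\<And>p. Phi L p (Z p) = c" by metis
    \<comment> \<open>Real and imaginary part of the fixed vector \<open>c\<close> determine the
      frame components of \<open>Z p\<close> and \<open>cstruct (Z p)\<close>. These are therefore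
      constant, and both fields are parallel.\<close>
    have 1: "Z p = Q p (inv L (re c))" for p
      using arg_cong[OF Z[of p], of re] iL(1)[of "\<theta> p (Z p)"] by (metis Q_\<theta> re_Phi)
    have 2: "cstruct (Z p) = Q p (inv L (- im c))" for p
    proof -
      have "L (\<theta> p (cstruct (Z p))) = - im c" using arg_cong[OF Z[of p], of im] by (simp add: im_Phi flip: minus_equation_iff)
      then show ?thesis using iL(1)[of "\<theta> p (cstruct (Z p))"] by (metis Q_\<theta>)
    qed
    have "Z = (\<lambda>p. Q p (inv L (re c)))" "(\<lambda>p. cstruct (Z p)) = (\<lambda>p. Q p (inv L (- im c)))"
      using 1 2 by (auto simp: fun_eq_iff)
    then have "parallel_field A nabla UNIV Z" "parallel_field A nabla UNIV (\<lambda>p. cstruct (Z p))"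
      using parallel_Q by simp_all
    moreover have "Z undefined \<noteq> 0"
    proof
      assume "Z undefined = 0"
      then have "c = 0" using Z[of undefined] linear_0[OF linear_Phi[OF L(1)]] by simp
      then show False using c linear_0[OF Tlin] \<open>b \<noteq> 0\<close> by simp
    qed
    ultimately show False using no by blast
  qed
  show ?thesis
    using T Om \<psi> b1 b2 by (intro exI[of _ ?T] exI[of _ b]) blast
qed

end

section \<open>Existence and uniqueness\<close>

lemma (in flat_manifold) framed_manifold_exists:
  assumes "simply_connected (UNIV :: 'm set)"
  obtains Q where "framed_manifold A nabla Q"
proof -
  obtain Q where "parallel_frame UNIV Q" using global_parallel_frame[OF assms] by blast
  then have "framed_manifold A nabla Q"
    by unfold_locales (use path_connected_imp_connected[OF simply_connected_imp_path_connected_UNIV[OF assms]] in auto)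
  then show thesis by (rule that)
qed

lemma Omega_tau: "Omega (tau u) (tau v) = cnj (Omega u v)"
  by (simp add: Omega_def tau_def)

text \<open>For real \<open>x\<close> in the tangent image, \<open>Omega x (tau y)\<close> is the
  conjugate of \<open>Omega x y\<close> and vanishes on a Lagrangian image. So \<open>x\<close> lies
  in the kernel of \<open>gam\<close>.\<close>

lemma (in atlas) lagrangian_nondegenerate_totally_complex:
  fixes \<phi> :: "'m \<Rightarrow> 'n cotangent"
  assumes hol: "holomorphic_immersion A \<phi>" and nd: "nondegenerate A \<phi>" and lag: "lagrangian A \<phi>"
  shows "totally_complex A \<phi>"
  unfolding totally_complex_def
proof
  fix p
  let ?D = "mdiff A \<phi> p"
  have lin: "linear ?D" by (rule has_mderiv_linear[OF holomorphic_immersion_mderiv(1)[OF hol]])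
  have "u = 0" if u: "tau (?D u) = ?D u" for u
  proof -
    have "gam (?D u) (?D v) = 0" for v
    proof -
      have "Omega (?D u) (tau (?D v)) = cnj (Omega (?D u) (?D v))"
        using Omega_tau[of "?D u" "?D v"] u by simp
      then show ?thesis using lag by (simp add: gam_def lagrangian_def)
    qed
    then show ?thesis using nd unfolding nondegenerate_def by blast
  qed
  moreover have "?D 0 = 0" by (rule linear_0[OF lin])
  moreover have "tau (0 :: 'n cotangent) = 0" by (simp add: tau_def vec_eq_iff)
  ultimately show "{v. tau v = v} \<inter> range ?D = {0}" by (auto simp: image_iff intro!: exI[of _ 0])
qed

section \<open>Adapted immersions: existence, uniqueness and the Kaehler case\<close>

context framed_manifold
begin

definition adapted :: "('m \<Rightarrow> 'n cotangent) \<Rightarrow> bool" where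
  "adapted \<phi> \<longleftrightarrow> conic_immersion \<phi> \<and> holomorphic_immersion A \<phi> \<and> totally_complex A \<phi> \<and> induces_connection A nabla \<phi>"

lemma adapted_Phi:
  assumes "adapted \<phi>"
  obtains L where "linear L" "inj L" "\<And>q. has_mderiv \<phi> q (Phi L q)"
  using immersion_Phi[of \<phi>] assms that unfolding adapted_def by blast

lemma adapted_exists:
  assumes L: "linear L" "inj L" and act: "conic_action A nabla W act"
  shows "\<exists>\<phi>. adapted \<phi> \<and> equivariant W act \<phi> \<and> (\<forall>q. has_mderiv \<phi> q (Phi L q))"
proof -
  interpret conic_manifold A nabla Q W act by unfold_locales (rule act)
  have "has_mderiv (phi L) q (Phi L q)" for q by (rule phi_mderiv[OF L(1)])
  with conic_phi[OF L(1)] equivariant_phi[OF L(1)] holomorphic_immersionI[OF L] totally_complexI[OF L] affine_functionI[OF L]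
  show ?thesis
    unfolding adapted_def induces_connection_def by (intro exI[of _ "phi L"]) blast
qed

lemma unique_up_to_tau:
  assumes "\<And>\<phi>. P \<phi> \<Longrightarrow> adapted \<phi>"
  shows "unique_up_to preserves_tau A nabla P"
  unfolding unique_up_to_def
proof (intro allI impI, elim conjE)
  fix \<phi> \<psi> assume "P \<phi>" "P \<psi>"
  then have a: "adapted \<phi>" "adapted \<psi>" by (simp_all add: assms)
  obtain L where L: "linear L" "inj L" "\<And>q. has_mderiv \<phi> q (Phi L q)" by (rule adapted_Phi[OF a(1)]) blast
  obtain M where M: "linear M" "inj M" "\<And>q. has_mderiv \<psi> q (Phi M q)" by (rule adapted_Phi[OF a(2)]) blast
  show "\<exists>T b. preserves_tau T \<and> (\<forall>p. \<psi> p = T (\<phi> p) + b) \<and>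
    ((\<exists>W act. conic_action A nabla W act \<and> equivariant W act \<phi> \<and> equivariant W act \<psi>) \<or>
      \<not> (\<exists>X. parallel_field A nabla UNIV X \<and> parallel_field A nabla UNIV (\<lambda>p. cstruct (X p)) \<and> (\<exists>p. X p \<noteq> 0))
      \<longrightarrow> b = 0)"
    using immersion_unique[OF L M] a unfolding adapted_def by blast
qed

lemma unique_up_to_Omega_tau:
  assumes "\<And>\<phi>. P \<phi> \<Longrightarrow> adapted \<phi> \<and> \<omega> = induced_form A \<phi>"
  shows "unique_up_to preserves_Omega_tau A nabla P"
  unfolding unique_up_to_def
proof (intro allI impI, elim conjE)
  fix \<phi> \<psi> assume P: "P \<phi>" "P \<psi>"
  then have a: "adapted \<phi>" "adapted \<psi>" and w: "\<omega> = induced_form A \<phi>" "\<omega> = induced_form A \<psi>"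
    using assms by blast+
  obtain L where L: "linear L" "inj L" "\<And>q. has_mderiv \<phi> q (Phi L q)" by (rule adapted_Phi[OF a(1)]) blast
  obtain M where M: "linear M" "inj M" "\<And>q. has_mderiv \<psi> q (Phi M q)" by (rule adapted_Phi[OF a(2)]) blast
  have "sympl (M u) (M v) = sympl (L u) (L v)" for u v
  proof -
    let ?p = "undefined :: 'm"
    have "induced_form A \<phi> ?p (Q ?p u) (Q ?p v) = induced_form A \<psi> ?p (Q ?p u) (Q ?p v)" using w by simp
    then show ?thesis by (simp add: induced_form_eq[OF L(3)] induced_form_eq[OF M(3)])
  qed
  then show "\<exists>T b. preserves_Omega_tau T \<and> (\<forall>p. \<psi> p = T (\<phi> p) + b) \<and>
    ((\<exists>W act. conic_action A nabla W act \<and> equivariant W act \<phi> \<and> equivariant W act \<psi>) \<or>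
      \<not> (\<exists>X. parallel_field A nabla UNIV X \<and> parallel_field A nabla UNIV (\<lambda>p. cstruct (X p)) \<and> (\<exists>p. X p \<noteq> 0))
      \<longrightarrow> b = 0)"
    using immersion_unique[OF L M] a unfolding adapted_def by blast
qed

lemma symplectic_adapted_exists:
  assumes \<omega>: "symplectic_form A \<omega>" "parallel_form A nabla \<omega>" and act: "conic_action A nabla W act"
  shows "\<exists>\<phi>. (adapted \<phi> \<and> \<omega> = induced_form A \<phi>) \<and> equivariant W act \<phi>"
proof -
  obtain L :: "complex^'n \<Rightarrow> real^('n + 'n)" where L: "linear L" "inj L"
    "\<And>p u v. \<omega> p u v = 2 * sympl (L (\<theta> p u)) (L (\<theta> p v))"
    using parallel_form_in_frame[OF \<omega>] by blast
  obtain \<phi> where \<phi>: "adapted \<phi>" "equivariant W act \<phi>" "\<And>q. has_mderiv \<phi> q (Phi L q)"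
    using adapted_exists[OF L(1,2) act] by blast
  have "\<omega> = induced_form A \<phi>" by (intro ext) (simp add: L(3) induced_form_eq[OF \<phi>(3)])
  with \<phi> show ?thesis by blast
qed

text \<open>The differential has real part \<open>L (\<theta> p u)\<close> and imaginary part
  \<open>- L (\<theta> p (cstruct u))\<close>. J-invariance makes the contributions to
  \<open>Omega\<close> cancel in pairs. In \<open>gam\<close> the conjugation flips a sign, and they
  add up to \<open>\<omega> p (cstruct u) v\<close> instead.\<close>

lemma kaehler_lagrangian:
  assumes a: "adapted \<phi>" and \<omega>: "\<omega> = induced_form A \<phi>"
    and inv: "\<And>p u v. \<omega> p (cstruct u) (cstruct v) = \<omega> p u v"
  shows "nondegenerate A \<phi>" "lagrangian A \<phi>" "kaehler_metric \<omega> = induced_metric A \<phi>"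
proof -
  obtain L where L: "linear L" "inj L" "\<And>q. has_mderiv \<phi> q (Phi L q)" by (rule adapted_Phi[OF a]) blast
  have D: "mdiff A \<phi> p = Phi L p" for p by (rule mdiff_eq[OF L(3)])
  have w: "sympl (L (\<theta> p u)) (L (\<theta> p v)) = \<omega> p u v / 2" for p u v
    by (simp add: \<omega> induced_form_eq[OF L(3)])
  have bil: "bilinear (\<omega> p)" for p
    using induced_form_symplectic(1)[OF L] \<omega> by (simp add: symplectic_form_def two_form_def)
  have sw: "\<omega> p (cstruct u) v = - \<omega> p u (cstruct v)" for p u v
    using bilinear_rneg[OF bil, of p "cstruct u" v] inv[of p u "cstruct v"] by (simp add: J.I_I)
  note bs = bilinear_lneg[OF bilinear_sympl] bilinear_rneg[OF bilinear_sympl]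
  have "Omega (Phi L p u) (Phi L p v) = 0" for p u v
    by (simp add: Omega_sympl im_Phi bs w inv sw complex_eq_iff J.I_I bilinear_rneg[OF bil])
  then show "lagrangian A \<phi>" by (simp add: lagrangian_def D)
  have g: "Re (gam (Phi L p u) (Phi L p v)) = \<omega> p (cstruct u) v" for p u v
    by (simp add: gam_def Omega_sympl re_im_tau im_Phi bs w sw)
  then show "kaehler_metric \<omega> = induced_metric A \<phi>"
    by (intro ext) (simp add: kaehler_metric_def induced_metric_def D)
  show "nondegenerate A \<phi>"
    unfolding nondegenerate_def D
  proof (intro allI impI)
    fix p u assume "\<forall>v. gam (Phi L p u) (Phi L p v) = 0"
    then have "\<omega> p (cstruct u) v = 0" for v using g[of p u v] by simp
    then have "cstruct u = 0"
      using induced_form_symplectic(1)[OF L] \<omega> unfolding symplectic_form_def by blast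
    then show "u = 0" by simp
  qed
qed

end

theorem theorem9:
  fixes A :: "('m::{t2_space, second_countable_topology}, 'n::finite) chart set"
    and nabla :: "('m, 'n) conn"
    and \<omega> :: "('m, 'n) form2"
  assumes "simply_connected (UNIV :: 'm set)"
  shows
    "(conic_complex_manifold A nabla \<longrightarrow>
        (let P = (\<lambda>\<phi>. conic_immersion \<phi> \<and> holomorphic_immersion A \<phi> \<and> totally_complex A \<phi> \<and>
                      induces_connection A nabla \<phi>)
         in (\<exists>\<phi>. P \<phi>) \<and> exists_for_each_action A nabla P \<and>
            unique_up_to preserves_tau A nabla P \<and>
            (\<forall>\<phi>. P \<phi> \<longrightarrow> conic_symplectic_manifold A nabla (induced_form A \<phi>)))) \<and>
     (conic_symplectic_manifold A nabla \<omega> \<longrightarrow>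
        (let P = (\<lambda>\<phi>. conic_immersion \<phi> \<and> holomorphic_immersion A \<phi> \<and> totally_complex A \<phi> \<and>
                      induces_connection A nabla \<phi> \<and> \<omega> = induced_form A \<phi>)
         in (\<exists>\<phi>. P \<phi>) \<and> exists_for_each_action A nabla P \<and>
            unique_up_to preserves_Omega_tau A nabla P)) \<and>
     (conic_kaehler_manifold A nabla \<omega> \<longrightarrow>
        (let P = (\<lambda>\<phi>. conic_immersion \<phi> \<and> holomorphic_immersion A \<phi> \<and> nondegenerate A \<phi> \<and>
                      lagrangian A \<phi> \<and> kaehler_metric \<omega> = induced_metric A \<phi> \<and>
                      induces_connection A nabla \<phi> \<and> \<omega> = induced_form A \<phi>)
         in (\<exists>\<phi>. P \<phi>) \<and> exists_for_each_action A nabla P \<and>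
            unique_up_to preserves_Omega_tau A nabla P \<and>
            (\<forall>\<phi>. holomorphic_immersion A \<phi> \<and> nondegenerate A \<phi> \<and> lagrangian A \<phi> \<longrightarrow>
                 totally_complex A \<phi>) \<and>
            (\<forall>p u v. \<omega> p u v = kaehler_metric \<omega> p u (cstruct v))))"
proof -
  have fm: thesis
    if M: "conic_complex_manifold A nabla"
      and elim: "\<And>Q W act. framed_manifold A nabla Q \<Longrightarrow> conic_action A nabla W act \<Longrightarrow> thesis" for thesis
  proof -
    have "flat_manifold A nabla"
      using M unfolding conic_complex_manifold_def by unfold_locales auto
    then obtain Q where "framed_manifold A nabla Q"
      by (rule flat_manifold.framed_manifold_exists[OF _ assms])
    moreover obtain W act where "conic_action A nabla W act"
      using M unfolding conic_complex_manifold_def by blast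
    ultimately show thesis by (rule elim)
  qed
  show ?thesis
  proof (intro conjI impI)
    assume M: "conic_complex_manifold A nabla"
    obtain Q W act where Q: "framed_manifold A nabla Q" and act: "conic_action A nabla W act"
      by (rule fm[OF M])
    interpret framed_manifold A nabla Q by (rule Q)
    obtain L :: "complex^'n \<Rightarrow> real^('n + 'n)" where L: "linear L" "inj L" using coordinates_exist by blast
    have ex: "\<exists>\<phi>. adapted \<phi> \<and> equivariant W act \<phi>" if "conic_action A nabla W act" for W act
      using adapted_exists[OF L that] by blast
    have sympl: "conic_symplectic_manifold A nabla (induced_form A \<phi>)" if a: "adapted \<phi>" for \<phi>
    proof -
      obtain L where L: "linear L" "inj L" "\<And>q. has_mderiv \<phi> q (Phi L q)" by (rule adapted_Phi[OF a]) blast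
      from induced_form_symplectic[OF L] M show ?thesis by (simp add: conic_symplectic_manifold_def)
    qed
    show "let P = (\<lambda>\<phi>. conic_immersion \<phi> \<and> holomorphic_immersion A \<phi> \<and> totally_complex A \<phi> \<and>
                      induces_connection A nabla \<phi>)
         in (\<exists>\<phi>. P \<phi>) \<and> exists_for_each_action A nabla P \<and>
            unique_up_to preserves_tau A nabla P \<and>
            (\<forall>\<phi>. P \<phi> \<longrightarrow> conic_symplectic_manifold A nabla (induced_form A \<phi>))"
      unfolding Let_def exists_for_each_action_def adapted_def[symmetric]
      using ex ex[OF act] unique_up_to_tau[of adapted] sympl by blast
  next
    assume M: "conic_symplectic_manifold A nabla \<omega>"
    then have cM: "conic_complex_manifold A nabla" and \<omega>: "symplectic_form A \<omega>" "parallel_form A nabla \<omega>"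
      by (simp_all add: conic_symplectic_manifold_def)
    obtain Q W act where Q: "framed_manifold A nabla Q" and act: "conic_action A nabla W act"
      by (rule fm[OF cM])
    interpret framed_manifold A nabla Q by (rule Q)
    let ?P = "\<lambda>\<phi>. conic_immersion \<phi> \<and> holomorphic_immersion A \<phi> \<and> totally_complex A \<phi> \<and>
                      induces_connection A nabla \<phi> \<and> \<omega> = induced_form A \<phi>"
    have P: "?P \<phi> \<longleftrightarrow> adapted \<phi> \<and> \<omega> = induced_form A \<phi>" for \<phi> by (auto simp: adapted_def)
    show "let P = ?P in (\<exists>\<phi>. P \<phi>) \<and> exists_for_each_action A nabla P \<and> unique_up_to preserves_Omega_tau A nabla P"
      unfolding Let_def exists_for_each_action_def P
      using symplectic_adapted_exists[OF \<omega>] symplectic_adapted_exists[OF \<omega> act]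
        unique_up_to_Omega_tau[of "\<lambda>\<phi>. adapted \<phi> \<and> \<omega> = induced_form A \<phi>" \<omega>] by blast
  next
    assume "conic_kaehler_manifold A nabla \<omega>"
    then have cM: "conic_complex_manifold A nabla" and \<omega>: "symplectic_form A \<omega>" "parallel_form A nabla \<omega>"
      and inv: "\<And>p u v. \<omega> p (cstruct u) (cstruct v) = \<omega> p u v"
      by (simp_all add: conic_kaehler_manifold_def conic_symplectic_manifold_def)
    obtain Q W act where Q: "framed_manifold A nabla Q" and act: "conic_action A nabla W act"
      by (rule fm[OF cM])
    interpret framed_manifold A nabla Q by (rule Q)
    let ?P = "\<lambda>\<phi>. conic_immersion \<phi> \<and> holomorphic_immersion A \<phi> \<and> nondegenerate A \<phi> \<and>
                      lagrangian A \<phi> \<and> kaehler_metric \<omega> = induced_metric A \<phi> \<and>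
                      induces_connection A nabla \<phi> \<and> \<omega> = induced_form A \<phi>"
    \<comment> \<open>J-invariance of \<open>\<omega>\<close> supplies nondegeneracy, the Lagrangian
      property and the metric, and the first two give back total complexity. The Kaehler case thus
      reduces to the symplectic one.\<close>
    have P: "?P \<phi> \<longleftrightarrow> adapted \<phi> \<and> \<omega> = induced_form A \<phi>" for \<phi>
      using kaehler_lagrangian[of \<phi> \<omega>] inv lagrangian_nondegenerate_totally_complex[of \<phi>]
      by (auto simp: adapted_def)
    have metric: "\<omega> p u v = kaehler_metric \<omega> p u (cstruct v)" for p u v
      by (simp add: kaehler_metric_def inv)
    show "let P = ?P in (\<exists>\<phi>. P \<phi>) \<and> exists_for_each_action A nabla P \<and>
            unique_up_to preserves_Omega_tau A nabla P \<and>
            (\<forall>\<phi>. holomorphic_immersion A \<phi> \<and> nondegenerate A \<phi> \<and> lagrangian A \<phi> \<longrightarrow>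
                 totally_complex A \<phi>) \<and>
            (\<forall>p u v. \<omega> p u v = kaehler_metric \<omega> p u (cstruct v))"
      unfolding Let_def exists_for_each_action_def P
      using symplectic_adapted_exists[OF \<omega>] symplectic_adapted_exists[OF \<omega> act]
        unique_up_to_Omega_tau[of "\<lambda>\<phi>. adapted \<phi> \<and> \<omega> = induced_form A \<phi>" \<omega>]
        lagrangian_nondegenerate_totally_complex metric by blast
  qed
qed

end
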